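(* Let $Z\subseteq\mathbb{P}(V)=\mathrm{Proj}(R)$ be a finite set of points and $\mathcal{A}_Z\subseteq\mathbb{P}(W)=\mathrm{Proj}(S)$ the dual hyperplane arrangement. Let $L\subseteq\mathbb{P}(W)$ be a general line and $Q=L^{\perp}\subseteq\mathbb{P}(V)$ the dual linear subspace of codimension $2$. Then the isomorphism of $\mathbb{K}$-algebras $\tau_Q:S/I(L)\cong\mathcal{F}_Q=\mathrm{Sym}([I(Q)]_1)$ induces an isomorphism of graded $\mathcal{F}_Q$-modules $$\eta_Q:\big(D_0(\mathcal{A}_Z)|_L\otimes_{S/I(L)}\mathcal{F}_Q\big)(-1)\;\cong\;I^{\gg}_Q(Z),\qquad\eta_Q\left(\sum_{i=0}^nf_i\frac{\partial}{\partial Y_i}\right)=\sum_{i=0}^n\tau_Q(f_i)X_i,$$ where $\{Y_i\}$ and $\{X_i\}$ are dual bases of $W^*$ and $V^*$ respectively. In particular $\eta_Q$ carries $[D_0(\mathcal{A}_Z)|_L]_m$ onto $[I(Z)\cap I(Q)^m]_{m+1}$.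
   Context: $\mathbb{K}$ is an algebraically closed field of arbitrary characteristic, and $n\ge2$. $V$ and $W$ are dual $\mathbb{K}$-vector spaces of dimension $n+1$, with dual coordinates, so that the pairing is $B(v,w)=\sum v_iw_i$. $R=\mathrm{Sym}(V^* )=\mathbb{K}[X_0,\ldots,X_n]$ and $S=\mathrm{Sym}(W^* )=\mathbb{K}[Y_0,\ldots,Y_n]$. For a linear subspace $L$ of $\mathbb{P}(W)$, $L^\perp\subseteq\mathbb{P}(V)$ is its annihilator under the pairing. $\mathcal{A}_Z$ consists of the hyperplanes $\{\sum c_iY_i=0\}$ for $(c_0:\cdots:c_n)\in Z$. Derivations: for an arrangement $\mathcal{A}$, $D(\mathcal{A})$ is the $S$-module of $\mathbb{K}$-linear derivations $\theta:S\to S$ with $\theta(I(H))\subseteq I(H)$ for all $H\in\mathcal{A}$, graded by $\deg\theta=\deg\theta(\ell)$ for linear forms $\ell$; $\theta_e=\sum_iY_i\,\partial/\partial Y_i$ and $D_0(\mathcal{A})=D(\mathcal{A})/S\theta_e$. $D_0(\mathcal{A})|_L$ is the graded $S/I(L)$-module $\bigoplus_d H^0(L,\widetilde{D_0(\mathcal{A})}|_L\otimes\mathcal{O}_L(d))$. For general $L$ it equals the module of derivations $\theta=\sum_if_i\,\partial/\partial Y_i$ of $S$ into $S/I(L)$ (with $f_i\in S/I(L)$) such that $\theta(\ell_H)\in(\overline{\ell_H})$ for every linear form $\ell_H$ defining a hyperplane $H\in\mathcal{A}$, modulo $(S/I(L))\theta_e$; here $\overline{\ell_H}$ denotes the image of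 $\ell_H$ in $S/I(L)$. The map $\eta_Q$ is evaluated on representatives. Objects attached to $Q$: for $Q\subseteq\mathbb{P}(V)$ of codimension $2$, $\mathcal{F}_Q=\mathrm{Sym}_{\mathbb{K}}([I(Q)]_1)\subseteq R$, a polynomial ring in two linear forms generating $I(Q)$. Fix a basis $\alpha_1,\ldots,\alpha_{n-1}$ of the linear subspace of $V$ corresponding to $Q$. Then $\tau_Q$ is the $\mathbb{K}$-algebra isomorphism $S/I(L)\to\mathcal{F}_Q$ ($L=Q^\perp$) sending $Y_i$ to the determinant of the $(n+1)\times(n+1)$ matrix with rows, in order: the $i$-th standard basis vector (entries indexed from $0$), $(X_0,\ldots,X_n)$, $\alpha_1,\ldots,\alpha_{n-1}$. $I^{\gg}_Q(Z)$ is the graded $\mathcal{F}_Q$-submodule of $R$ with $[I^{\gg}_Q(Z)]_d=[I(Z)\cap I(Q)^{d-1}]_d$. The twist convention is $[M(-1)]_d=[M]_{d-1}$. *)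

theory Defs
  imports
    "HOL-Analysis.Analysis"
    "HOL-Library.Poly_Mapping"
    "HOL-Computational_Algebra.Polynomial"
    "HOL-Algebra.QuotRing"
    "HOL-Algebra.Ideal_Product"
    "HOL-Algebra.Generated_Rings"
begin

section \<open>Polynomials\<close>

text \<open>The index type \<open>'v\<close>, finite and linearly ordered with \<open>n + 1\<close> elements, plays the role of
  \<open>{0, ..., n}\<close>. Both \<open>R = K[X\<^sub>0, ..., X\<^sub>n]\<close> and \<open>S = K[Y\<^sub>0, ..., Y\<^sub>n]\<close> are the type \<open>('v, 'k) mp\<close>,
  and both \<open>V\<close> and \<open>W\<close> are \<open>'k ^ 'v\<close>, with \<open>Var i\<close> the \<open>i\<close>-th coordinate function.\<close>

type_synonym ('v, 'k) mp = "('v \<Rightarrow>\<^sub>0 nat) \<Rightarrow>\<^sub>0 'k"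

definition Const :: "'k::zero \<Rightarrow> ('v, 'k) mp" where
  "Const c = Poly_Mapping.single 0 c"

definition Var :: "'v \<Rightarrow> ('v, 'k::zero_neq_one) mp" where
  "Var i = Poly_Mapping.single (Poly_Mapping.single i 1) 1"

definition mdeg :: "('v \<Rightarrow>\<^sub>0 nat) \<Rightarrow> nat" where
  "mdeg t = (\<Sum>i\<in>Poly_Mapping.keys t. Poly_Mapping.lookup t i)"

definition forms :: "int \<Rightarrow> ('v, 'k::zero) mp set" where
  "forms d = {f. \<forall>t\<in>Poly_Mapping.keys f. int (mdeg t) = d}"

definition subst :: "('k::zero \<Rightarrow> 'b::comm_ring_1) \<Rightarrow> ('v::finite \<Rightarrow> 'b) \<Rightarrow> ('v, 'k) mp \<Rightarrow> 'b" where
  "subst c x f = (\<Sum>t\<in>Poly_Mapping.keys f.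
     c (Poly_Mapping.lookup f t) * (\<Prod>i\<in>UNIV. x i ^ Poly_Mapping.lookup t i))"

definition eval :: "('v::finite, 'k::comm_ring_1) mp \<Rightarrow> 'k ^ 'v \<Rightarrow> 'k" where
  "eval f v = subst id (\<lambda>i. v $ i) f"

definition pd :: "'v \<Rightarrow> ('v, 'k::comm_ring_1) mp \<Rightarrow> ('v, 'k) mp" where
  "pd i f = (\<Sum>t\<in>Poly_Mapping.keys f.
     Poly_Mapping.single (t - Poly_Mapping.single i 1)
       (of_nat (Poly_Mapping.lookup t i) * Poly_Mapping.lookup f t))"

definition mp_ring :: "('v, 'k::comm_ring_1) mp ring" where
  "mp_ring = \<lparr>carrier = UNIV, mult = (*), one = 1, zero = 0, add = (+)\<rparr>"

text \<open>The exponent is an integer, with the convention \<open>I\<^sup>k = R\<close> for \<open>k \<le> 0\<close>.\<close>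

definition ideal_power :: "('v, 'k::comm_ring_1) mp set \<Rightarrow> int \<Rightarrow> ('v, 'k) mp set" where
  "ideal_power I k = ((\<lambda>J. ideal_prod mp_ring I J) ^^ nat k) UNIV"


section \<open>Projective geometry\<close>

text \<open>A linear subspace of projective dimension \<open>k\<close> is the vector subspace of dimension \<open>k + 1\<close>
  that it comes from; in particular a point is a line through the origin.\<close>

definition proj_subspaces :: "nat \<Rightarrow> ('k::field ^ 'v::finite) set set" where
  "proj_subspaces k = {U. vec.subspace U \<and> vec.dim U = k + 1}"

definition points_on :: "('k::field ^ 'v::finite) set \<Rightarrow> ('k ^ 'v) set set" where
  "points_on L = {p \<in> proj_subspaces 0. p \<subseteq> L}"

definition pairing :: "'k::comm_ring_1 ^ 'v::finite \<Rightarrow> 'k ^ 'v \<Rightarrow> 'k" where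
  "pairing v w = (\<Sum>i\<in>UNIV. v $ i * w $ i)"

definition perp :: "('k::comm_ring_1 ^ 'v::finite) set \<Rightarrow> ('k ^ 'v) set" where
  "perp L = {v. \<forall>w\<in>L. pairing v w = 0}"

text \<open>The homogeneous ideal of a projective set is the vanishing ideal of the cone over it; over an
  infinite field the latter is automatically homogeneous.\<close>

definition vanishing_ideal :: "('k::comm_ring_1 ^ 'v::finite) set \<Rightarrow> ('v, 'k) mp set" where
  "vanishing_ideal C = {f. \<forall>v\<in>C. eval f v = 0}"

definition nonvanishing_at :: "('v::finite, 'k::comm_ring_1) mp \<Rightarrow> ('k ^ 'v) set \<Rightarrow> bool" where
  "nonvanishing_at g p \<longleftrightarrow> (\<exists>v\<in>p. eval g v \<noteq> 0)"

definition pluecker :: "'k::comm_ring_1 ^ 'v \<Rightarrow> 'k ^ 'v \<Rightarrow> 'k ^ ('v \<times> 'v)" where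
  "pluecker u v = (\<chi> ij. u $ fst ij * v $ snd ij - u $ snd ij * v $ fst ij)"

text \<open>Zariski open subsets of the Grassmannian of lines in its Pluecker embedding.\<close>

definition zariski_open_lines :: "('k::field ^ 'v::finite) set set \<Rightarrow> bool" where
  "zariski_open_lines U \<longleftrightarrow>
     (\<exists>F :: ('v \<times> 'v, 'k) mp set. (\<forall>f\<in>F. \<exists>d. f \<in> forms d) \<and>
        U = {L \<in> proj_subspaces 1.
               \<exists>f\<in>F. \<exists>u v. L = vec.span {u, v} \<and> eval f (pluecker u v) \<noteq> 0})"

definition dual_arrangement :: "('k::field ^ 'v::finite) set set \<Rightarrow> ('k ^ 'v) set set" where
  "dual_arrangement Z = {{w. pairing c w = 0} |c. c \<noteq> 0 \<and> vec.span {c} \<in> Z}"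


section \<open>Logarithmic derivations\<close>

definition derivations :: "(('v, 'k::comm_ring_1) mp \<Rightarrow> ('v, 'k) mp) set" where
  "derivations = {\<theta>. (\<forall>f g. \<theta> (f + g) = \<theta> f + \<theta> g) \<and>
     (\<forall>c f. \<theta> (Const c * f) = Const c * \<theta> f) \<and>
     (\<forall>f g. \<theta> (f * g) = f * \<theta> g + g * \<theta> f)}"

definition log_der ::
    "('k::comm_ring_1 ^ 'v::finite) set set \<Rightarrow> (('v, 'k) mp \<Rightarrow> ('v, 'k) mp) set" where
  "log_der \<A> = {\<theta> \<in> derivations. \<forall>H\<in>\<A>. \<theta> ` vanishing_ideal H \<subseteq> vanishing_ideal H}"

definition log_der_deg ::
    "('k::comm_ring_1 ^ 'v::finite) set set \<Rightarrow> int \<Rightarrow> (('v, 'k) mp \<Rightarrow> ('v, 'k) mp) set" where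
  "log_der_deg \<A> d = {\<theta> \<in> log_der \<A>. \<theta> ` forms 1 \<subseteq> forms d}"

definition euler :: "('v::finite, 'k::comm_ring_1) mp \<Rightarrow> ('v, 'k) mp" where
  "euler f = (\<Sum>i\<in>UNIV. Var i * pd i f)"

text \<open>\<open>S \<theta>\<^sub>e + I(L) D(\<A>)\<close>. The quotient of \<open>D(\<A>)\<close> by this submodule is
  \<open>D\<^sub>0(\<A>) / I(L) D\<^sub>0(\<A>) = D\<^sub>0(\<A>) \<otimes>\<^sub>S S/I(L)\<close>, whose associated sheaf is the restriction to \<open>L\<close> of the
  sheaf associated to \<open>D\<^sub>0(\<A>)\<close>.\<close>

definition restriction_relations ::
    "('k::comm_ring_1 ^ 'v::finite) set set \<Rightarrow> ('k ^ 'v) set \<Rightarrow> (('v, 'k) mp \<Rightarrow> ('v, 'k) mp) set" where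
  "restriction_relations \<A> L =
     {\<lambda>f. u * euler f + (\<Sum>j<m. a j * \<delta> j f) |u (m::nat) a \<delta>.
        \<forall>j<m. a j \<in> vanishing_ideal L \<and> \<delta> j \<in> log_der \<A>}"


section \<open>The graded module of twisted global sections on the line\<close>

record ('r, 'm) graded_module =
  component :: "int \<Rightarrow> 'm set"
  gadd :: "int \<Rightarrow> 'm \<Rightarrow> 'm \<Rightarrow> 'm"
  gsmult :: "nat \<Rightarrow> int \<Rightarrow> 'r \<Rightarrow> 'm \<Rightarrow> 'm"

text \<open>\<open>gsmult M e d a x\<close> is the product of a scalar \<open>a\<close> of degree \<open>e\<close> with \<open>x \<in> [M]\<^sub>d\<close>.\<close>

definition twist :: "int \<Rightarrow> ('r, 'm) graded_module \<Rightarrow> ('r, 'm) graded_module" where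
  "twist k M = \<lparr>component = (\<lambda>d. component M (d + k)), gadd = (\<lambda>d. gadd M (d + k)),
     gsmult = (\<lambda>e d. gsmult M e (d + k))\<rparr>"

text \<open>For a ring isomorphism \<open>\<tau> : A \<cong> B\<close>, the \<open>B\<close>-module \<open>M \<otimes>\<^sub>A B\<close> is \<open>M\<close> with \<open>B\<close> acting through
  \<open>\<tau>\<^sup>-\<^sup>1\<close>: the element \<open>x \<otimes> b\<close> is \<open>\<tau>\<^sup>-\<^sup>1(b) x\<close>.\<close>

definition base_change ::
    "('a, 'z) ring_scheme \<Rightarrow> ('a \<Rightarrow> 'b) \<Rightarrow> ('a, 'm) graded_module \<Rightarrow> ('b, 'm) graded_module" where
  "base_change A \<tau> M = \<lparr>component = component M, gadd = gadd M,
     gsmult = (\<lambda>e d b. gsmult M e d (inv_into (carrier A) \<tau> b))\<rparr>"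

definition graded_module_iso ::
    "(nat \<Rightarrow> 'r set) \<Rightarrow> ('r, 'm) graded_module \<Rightarrow> ('r, 'p) graded_module \<Rightarrow> (int \<Rightarrow> 'm \<Rightarrow> 'p) \<Rightarrow> bool"
  where
  "graded_module_iso B M N \<eta> \<longleftrightarrow>
     (\<forall>d. bij_betw (\<eta> d) (component M d) (component N d)) \<and>
     (\<forall>d. \<forall>x\<in>component M d. \<forall>y\<in>component M d. \<eta> d (gadd M d x y) = gadd N d (\<eta> d x) (\<eta> d y)) \<and>
     (\<forall>e d. \<forall>b\<in>B e. \<forall>x\<in>component M d.
        \<eta> (d + int e) (gsmult M e d b x) = gsmult N e d b (\<eta> d x))"

text \<open>Write \<open>N = D\<^sub>0(\<A>) \<otimes>\<^sub>S S/I(L)\<close>. The pairs \<open>(\<theta>, g)\<close> in \<open>fractions \<A> p d\<close> stand for the fractions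
  \<open>\<theta>/g\<close> of degree \<open>d\<close> in the localisation of \<open>N\<close> at the point \<open>p\<close>, that is, for elements of the stalk at
  \<open>p\<close> of the sheaf associated to \<open>N(d)\<close>; \<open>germ \<A> L p d \<theta> g\<close> is the class of all pairs equal
  to \<open>\<theta>/g\<close> there. In \<open>sections\<close>, a section over \<open>L\<close> is a function from the points of \<open>L\<close> to germs that is
  locally (on a basic open set) given by a single fraction, extended by the empty set off \<open>L\<close>.\<close>

type_synonym ('v, 'k) pre_germ = "(('v, 'k) mp \<Rightarrow> ('v, 'k) mp) \<times> ('v, 'k) mp"

definition fractions ::
    "('k::comm_ring_1 ^ 'v::finite) set set \<Rightarrow> ('k ^ 'v) set \<Rightarrow> int \<Rightarrow> ('v, 'k) pre_germ set" where
  "fractions \<A> p d = {(\<theta>, g). \<exists>e::nat.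
     \<theta> \<in> log_der_deg \<A> (d + int e) \<and> g \<in> forms (int e) \<and> nonvanishing_at g p}"

definition germ ::
    "('k::comm_ring_1 ^ 'v::finite) set set \<Rightarrow> ('k ^ 'v) set \<Rightarrow> ('k ^ 'v) set \<Rightarrow> int \<Rightarrow>
     (('v, 'k) mp \<Rightarrow> ('v, 'k) mp) \<Rightarrow> ('v, 'k) mp \<Rightarrow> ('v, 'k) pre_germ set" where
  "germ \<A> L p d \<theta> g = {(\<theta>', g') \<in> fractions \<A> p d.
     \<exists>(c::nat) h. h \<in> forms (int c) \<and> nonvanishing_at h p \<and>
       (\<lambda>f. h * (g' * \<theta> f - g * \<theta>' f)) \<in> restriction_relations \<A> L}"

type_synonym ('v, 'k) germ_section = "('k ^ 'v) set \<Rightarrow> ('v, 'k) pre_germ set"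

definition sections ::
    "('k::field ^ 'v::finite) set set \<Rightarrow> ('k ^ 'v) set \<Rightarrow> int \<Rightarrow> ('v, 'k) germ_section set" where
  "sections \<A> L d = {s.
     (\<forall>p\<in>points_on L. \<exists>(\<theta>, g)\<in>fractions \<A> p d.
        \<forall>q\<in>points_on L. nonvanishing_at g q \<longrightarrow> s q = germ \<A> L q d \<theta> g) \<and>
     (\<forall>p. p \<notin> points_on L \<longrightarrow> s p = {})}"

text \<open>The operations are computed on all representatives: \<open>\<theta>/g + \<theta>'/g' = (g' \<theta> + g \<theta>')/(g g')\<close>, and
  a class \<open>a \<in> [S/I(L)]\<^sub>e\<close> acts by \<open>a \<cdot> \<theta>/g = (f \<theta>)/g\<close> for the forms \<open>f\<close> of degree \<open>e\<close> in \<open>a\<close>.\<close>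

definition D0_restricted ::
    "('k::field ^ 'v::finite) set set \<Rightarrow> ('k ^ 'v) set \<Rightarrow>
     (('v, 'k) mp set, ('v, 'k) germ_section) graded_module" where
  "D0_restricted \<A> L = \<lparr>
     component = sections \<A> L,
     gadd = (\<lambda>d s t p. \<Union>(\<theta>, g)\<in>s p. \<Union>(\<theta>', g')\<in>t p.
               germ \<A> L p d (\<lambda>f. g' * \<theta> f + g * \<theta>' f) (g * g')),
     gsmult = (\<lambda>e d a s p. \<Union>f\<in>a \<inter> forms (int e). \<Union>(\<theta>, g)\<in>s p.
               germ \<A> L p (d + int e) (\<lambda>x. f * \<theta> x) g)\<rparr>"

text \<open>The tuple \<open>f\<close> of polynomials lifts a derivation \<open>\<Sum>\<^sub>i f\<^sub>i \<partial>/\<partial>Y\<^sub>i\<close> of \<open>S\<close> into \<open>S/I(L)\<close>.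
  \<open>represents L f s\<close> says that every germ \<open>\<theta>/g\<close> of \<open>s\<close> equals this derivation modulo \<open>\<theta>\<^sub>e\<close>, and
  \<open>tangent_on \<A> L f\<close> says that it maps every linear form defining a hyperplane of \<open>\<A>\<close> into the ideal
  of \<open>S/I(L)\<close> generated by the image of that linear form.\<close>

definition represents ::
    "('k::field ^ 'v::finite) set \<Rightarrow> ('v \<Rightarrow> ('v, 'k) mp) \<Rightarrow> ('v, 'k) germ_section \<Rightarrow> bool" where
  "represents L f s \<longleftrightarrow> (\<forall>p\<in>points_on L. \<forall>(\<theta>, g)\<in>s p.
     \<exists>u. \<forall>i. \<theta> (Var i) - (g * f i + u * Var i) \<in> vanishing_ideal L)"

definition tangent_on ::
    "('k::field ^ 'v::finite) set set \<Rightarrow> ('k ^ 'v) set \<Rightarrow> ('v \<Rightarrow> ('v, 'k) mp) \<Rightarrow> bool" where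
  "tangent_on \<A> L f \<longleftrightarrow> (\<forall>H\<in>\<A>. \<forall>l\<in>forms 1. {w. eval l w = 0} = H \<longrightarrow>
     (\<exists>a. (\<Sum>i\<in>UNIV. f i * pd i l) - a * l \<in> vanishing_ideal L))"


section \<open>Objects attached to the codimension two subspace\<close>

definition sym_algebra :: "('k::field ^ 'v::finite) set \<Rightarrow> ('v, 'k) mp set" where
  "sym_algebra Q = generate_ring mp_ring (range Const \<union> (vanishing_ideal Q \<inter> forms 1))"

definition sym_ring :: "('k::field ^ 'v::finite) set \<Rightarrow> ('v, 'k) mp ring" where
  "sym_ring Q = mp_ring\<lparr>carrier := sym_algebra Q\<rparr>"

definition Igg :: "('k::field ^ 'v::finite) set \<Rightarrow> ('k ^ 'v) set set \<Rightarrow>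
    (('v, 'k) mp, ('v, 'k) mp) graded_module" where
  "Igg Q Z = \<lparr>
     component = (\<lambda>d. vanishing_ideal (\<Union>Z) \<inter> ideal_power (vanishing_ideal Q) (d - 1) \<inter> forms d),
     gadd = (\<lambda>d. (+)),
     gsmult = (\<lambda>e d. (*))\<rparr>"

definition ordered_basis :: "nat \<Rightarrow> (nat \<Rightarrow> 'k::field ^ 'v::finite) \<Rightarrow> ('k ^ 'v) set \<Rightarrow> bool" where
  "ordered_basis m \<alpha> U \<longleftrightarrow>
     inj_on \<alpha> {1..m} \<and> vec.independent (\<alpha> ` {1..m}) \<and> vec.span (\<alpha> ` {1..m}) = U"

text \<open>The position of an index of \<open>'v\<close> in \<open>{0, ..., n}\<close>.\<close>

definition pos :: "'v::{finite,linorder} \<Rightarrow> nat" where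
  "pos r = card {j. j < r}"

definition tau_image ::
    "(nat \<Rightarrow> 'k::field ^ 'v::{finite,linorder}) \<Rightarrow> 'v \<Rightarrow> ('v, 'k) mp" where
  "tau_image \<alpha> i = det (\<chi> r c.
     if pos r = 0 then (if c = i then 1 else 0)
     else if pos r = 1 then Var c
     else Const (\<alpha> (pos r - 1) $ c))"

definition residue_class ::
    "('k::field ^ 'v::finite) set \<Rightarrow> ('v, 'k) mp \<Rightarrow> ('v, 'k) mp set" where
  "residue_class L f = vanishing_ideal L +>\<^bsub>mp_ring\<^esub> f"

definition coord_ring :: "('k::field ^ 'v::finite) set \<Rightarrow> ('v, 'k) mp set ring" where
  "coord_ring L = mp_ring Quot vanishing_ideal L"

text \<open>The map induced on \<open>S/I(L)\<close> by the \<open>K\<close>-algebra homomorphism \<open>Y\<^sub>i \<mapsto> tau_image \<alpha> i\<close>; the value on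
  a class is the common value on its elements.\<close>

definition tau ::
    "(nat \<Rightarrow> 'k::field ^ 'v::{finite,linorder}) \<Rightarrow> ('v, 'k) mp set \<Rightarrow> ('v, 'k) mp" where
  "tau \<alpha> a = the_elem (subst Const (tau_image \<alpha>) ` a)"

end

theory Submission
  imports Defs
begin

text \<open>
  The map \<open>\<tau>\<^sub>Q\<close> is the pullback of functions along the linear map \<open>\<sigma> : V \<rightarrow> W\<close> with
  \<open>\<sigma>(x)\<^sub>i = det(e\<^sub>i, x, \<alpha>\<^sub>1, \<dots>, \<alpha>\<^sub>n\<^sub>-\<^sub>1)\<close>, which has image \<open>L\<close> and kernel \<open>Q\<close> and satisfies \<open>x \<cdot> \<sigma>(x) = 0\<close>.
  The last identity says that \<open>\<theta> \<mapsto> \<Sum>\<^sub>i \<tau>\<^sub>Q(\<theta>\<^sub>i) X\<^sub>i\<close> kills the Euler derivation, and its kernel on tuples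
  over \<open>S/I(L)\<close> is exactly the multiples of the Euler derivation. The local fractions \<open>\<theta>/g\<close> of a
  section therefore give rational functions \<open>\<Sum>\<^sub>i \<tau>\<^sub>Q(\<theta>\<^sub>i) X\<^sub>i / \<tau>\<^sub>Q(g)\<close> which agree on overlaps; the
  denominators have no common zero on \<open>L\<close> and split into linear forms, each of which is prime in \<open>R\<close>,
  so these functions are one polynomial \<open>F\<close>.

  For \<open>c\<close> in the cone over \<open>Z\<close>, \<open>F(c)\<close> is the value of \<open>\<theta>(\<ell>\<^sub>c)/g\<close> at \<open>\<sigma>(c)\<close>, and \<open>\<sigma>(c)\<close> spans the point
  \<open>L \<inter> H\<^sub>c\<close>; hence tangency to \<open>H\<^sub>c\<close> amounts to \<open>F(c) = 0\<close>. A general \<open>L\<close> meets no intersection of two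
  hyperplanes of the arrangement, so at each of its points \<open>D(\<A>)\<close> is free with an explicit basis.
  This shows that a germ is determined by \<open>F\<close> and that every \<open>F\<close> in \<open>I\<^sup>\<gg>\<^sub>Q(Z)\<close> comes from a section.
  In degree \<open>-1\<close> both sides vanish unless \<open>Z\<close> is empty, when both are \<open>\<K>\<close>.
\<close>

section \<open>Polynomials\<close>

text \<open>The power of I(Q) has its origin in the pullback: a form of degree m on L becomes a form
  of degree m in two linear forms that generate I(Q). Conversely an element of I(Q)^m of degree m +
  1 is a combination of monomials of degree m in these generators with linear coefficients, and
  sorting by the variables \<open>Var i\<close> writes it as the image of a tuple. The obstacle is
  that a section consists only of local fractions. Tuples of forms of degree m modulo Euler
  multiples have the line bundle O_L(m - 1) as their relations, so the obstruction to lifting a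
  section to one tuple lies in H^1(L, O_L(m - 1)). This space is zero for m >= 0 and one-dimensional
  for m = -1, whence the exceptional degree. Cohomology is replaced by an induction that removes one
  linear factor of a denominator at a time. Identities in R are checked by evaluation at all
  vectors, the field being infinite, and membership in I(L) becomes an equation in R after pulling
  back.\<close>

lemma mdeg_UNIV: "mdeg (t :: 'v::finite \<Rightarrow>\<^sub>0 nat) = (\<Sum>i\<in>UNIV. Poly_Mapping.lookup t i)"
  unfolding mdeg_def by (rule sum.mono_neutral_left) (auto simp: in_keys_iff)

lemma mdeg_add: "mdeg (s + t :: 'v::finite \<Rightarrow>\<^sub>0 nat) = mdeg s + mdeg t"
  by (simp add: mdeg_UNIV lookup_add sum.distrib)

lemma mdeg_single [simp]: "mdeg (Poly_Mapping.single (i::'v::finite) n) = n"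
  by (simp add: mdeg_def)

lemma mdeg_zero [simp]: "mdeg 0 = 0"
  by (simp add: mdeg_def)

lemma mp_sum_singles:
  "f = (\<Sum>t\<in>Poly_Mapping.keys f. Poly_Mapping.single t (Poly_Mapping.lookup f t))"
  by (rule poly_mapping_eqI)
    (auto simp: lookup_sum lookup_single when_def in_keys_iff sum.delta')

lemma mp_eq_0_iff_keys: "f = 0 \<longleftrightarrow> Poly_Mapping.keys f = {}"
proof
  show "f = 0" if "Poly_Mapping.keys f = {}"
    using that by (intro poly_mapping_eqI) (auto simp: in_keys_iff)
qed simp

lemma mp_single_induct [case_names zero single add]:
  fixes P :: "('v, 'k::comm_monoid_add) mp \<Rightarrow> bool"
  assumes "P 0" "\<And>t a. P (Poly_Mapping.single t a)" "\<And>f g. P f \<Longrightarrow> P g \<Longrightarrow> P (f + g)"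
  shows "P f"
proof -
  have "P (\<Sum>t\<in>T. Poly_Mapping.single t (Poly_Mapping.lookup f t))" if "finite T" for T
    using that by (induction T rule: finite_induct) (auto intro: assms)
  then show ?thesis
    by (subst mp_sum_singles) simp
qed

lemma Const_0 [simp]: "Const 0 = 0"
  by (simp add: Const_def)

lemma Const_1 [simp]: "Const 1 = 1"
  by (simp add: Const_def)

lemma Const_add: "Const (a + b) = Const a + Const b"
  by (simp add: Const_def single_add)

lemma Const_mult: "Const (a * b :: 'k::comm_ring_1) = Const a * Const b"
  by (simp add: Const_def mult_single)

lemma Const_uminus: "Const (- a :: 'k::comm_ring_1) = - Const a"
  by (simp add: Const_def single_uminus)

lemma Const_eq_0_iff [simp]: "Const c = 0 \<longleftrightarrow> c = 0"
  by (metis Const_def lookup_single_eq lookup_zero single_zero)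

lemma Var_power: "Var i ^ n = Poly_Mapping.single (Poly_Mapping.single i n) (1::'k::comm_ring_1)"
proof (induction n)
  case (Suc n)
  then show ?case
    by (simp add: Var_def mult_single flip: single_add)
qed simp

lemma sum_single_lookup:
  "(\<Sum>i\<in>UNIV. Poly_Mapping.single i (Poly_Mapping.lookup t i)) = (t :: 'v::finite \<Rightarrow>\<^sub>0 nat)"
  by (rule poly_mapping_eqI) (simp add: lookup_sum lookup_single when_def sum.delta)

lemma single_eq_monomial:
  "Poly_Mapping.single t (a::'k::comm_ring_1) =
    Const a * (\<Prod>i\<in>UNIV. Var i ^ Poly_Mapping.lookup (t :: 'v::finite \<Rightarrow>\<^sub>0 nat) i)"
proof -
  have "(\<Prod>i\<in>A. Var i ^ n i) = Poly_Mapping.single (\<Sum>i\<in>A. Poly_Mapping.single i (n i)) (1::'k)"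
    if "finite A" for A :: "'v set" and n
    using that by (induction A rule: finite_induct) (auto simp: Var_power mult_single)
  then have "(\<Prod>i\<in>UNIV. Var i ^ Poly_Mapping.lookup t i) = Poly_Mapping.single t (1::'k)"
    by (simp add: sum_single_lookup)
  then show ?thesis
    by (simp add: Const_def mult_single)
qed

text \<open>Reduces an identity between ring homomorphisms on polynomials to constants and
  variables.\<close>

lemma mp_induct [case_names Const Var add mult]:
  fixes P :: "('v::finite, 'k::comm_ring_1) mp \<Rightarrow> bool"
  assumes "\<And>c. P (Const c)" "\<And>i. P (Var i)"
    and add: "\<And>f g. P f \<Longrightarrow> P g \<Longrightarrow> P (f + g)" and mult: "\<And>f g. P f \<Longrightarrow> P g \<Longrightarrow> P (f * g)"
  shows "P f"
proof -
  have 1: "P 1"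
    using assms(1)[of 1] by simp
  have pow: "P (Var i ^ n)" for i n
    by (induction n) (auto intro: assms 1)
  have prod: "P (\<Prod>i\<in>A. Var i ^ n i)" if "finite A" for A :: "'v set" and n
    using that by (induction A rule: finite_induct) (auto intro: mult pow 1)
  show ?thesis
  proof (induction f rule: mp_single_induct)
    case zero
    show ?case using assms(1)[of 0] by simp
  next
    case (single t a)
    show ?case unfolding single_eq_monomial by (intro mult prod assms) auto
  qed (rule add)
qed

section \<open>Substitution homomorphisms\<close>

text \<open>Evaluation at a vector, substitution of polynomials and restriction to a parametrised
  line differ only in where the coefficients are sent; the three interpretations below cover
  them.\<close>

locale coeff_hom =
  fixes c :: "'k::comm_ring_1 \<Rightarrow> 'b::comm_ring_1"
  assumes c_add: "c (a + b) = c a + c b"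
    and c_mult: "c (a * b) = c a * c b"
    and c_one: "c 1 = 1"
begin

lemma c_zero: "c 0 = 0"
  using c_add[of 0 0] by simp

lemma subst_superset:
  assumes "finite T" "Poly_Mapping.keys f \<subseteq> T"
  shows "subst c x f =
    (\<Sum>t\<in>T. c (Poly_Mapping.lookup f t) * (\<Prod>i\<in>UNIV. x i ^ Poly_Mapping.lookup t i))"
  unfolding subst_def using assms
  by (intro sum.mono_neutral_left) (auto simp: in_keys_iff c_zero)

lemma subst_add: "subst c x (f + g) = subst c x f + subst c x g"
proof -
  let ?T = "Poly_Mapping.keys f \<union> Poly_Mapping.keys g"
  have "Poly_Mapping.keys (f + g) \<subseteq> ?T" by (rule keys_add)
  then show ?thesis
    by (simp add: subst_superset[of ?T] lookup_add c_add distrib_right sum.distrib)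
qed

lemma subst_zero: "subst c x 0 = 0"
  by (simp add: subst_def)

lemma subst_single:
  "subst c x (Poly_Mapping.single t a) = c a * (\<Prod>i\<in>UNIV. x i ^ Poly_Mapping.lookup t i)"
  by (simp add: subst_superset[of "{t}"])

lemma subst_mult: "subst c x (f * g) = subst c x f * subst c x g"
proof (induction f rule: mp_single_induct)
  case (single t a)
  show ?case
  proof (induction g rule: mp_single_induct)
    case (single s b)
    show ?case
      by (simp add: mult_single subst_single c_mult lookup_add power_add prod.distrib mult_ac)
  qed (simp_all add: subst_zero subst_add algebra_simps)
qed (simp_all add: subst_zero subst_add algebra_simps)

lemma subst_Const: "subst c x (Const a) = c a"
  by (simp add: Const_def subst_single)

lemma subst_Var: "subst c x (Var i) = x i"
proof -
  have "(\<Prod>j\<in>UNIV. x j ^ Poly_Mapping.lookup (Poly_Mapping.single i 1) j) = (\<Prod>j\<in>UNIV. if j = i then x j else 1)"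
    by (intro prod.cong) (auto simp: lookup_single when_def)
  then show ?thesis
    by (simp add: Var_def subst_single c_one prod.delta')
qed

lemma subst_one: "subst c x 1 = 1"
  using subst_Const[of x 1] by (simp add: c_one)

lemma subst_uminus: "subst c x (- f) = - subst c x f"
  using subst_add[of x f "- f"] by (simp add: subst_zero eq_neg_iff_add_eq_0 add.commute)

lemma subst_minus: "subst c x (f - g) = subst c x f - subst c x g"
  using subst_add[of x f "- g"] by (simp add: subst_uminus)

lemma subst_sum: "subst c x (sum f A) = (\<Sum>a\<in>A. subst c x (f a))"
  by (induction A rule: infinite_finite_induct) (auto simp: subst_zero subst_add)

lemma subst_prod: "subst c x (prod f A) = (\<Prod>a\<in>A. subst c x (f a))"
  by (induction A rule: infinite_finite_induct) (auto simp: subst_one subst_mult)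

lemma subst_power: "subst c x (f ^ m) = subst c x f ^ m"
  by (induction m) (auto simp: subst_one subst_mult)

lemmas subst_simps = subst_zero subst_one subst_add subst_mult subst_Const subst_Var
  subst_uminus subst_minus subst_sum subst_prod subst_power

end

interpretation id_hom: coeff_hom "id :: 'k::comm_ring_1 \<Rightarrow> 'k"
  by standard auto

interpretation Const_hom: coeff_hom "Const :: 'k::comm_ring_1 \<Rightarrow> ('v, 'k) mp"
  by standard (auto simp: Const_add Const_mult)

interpretation pConst_hom: coeff_hom "\<lambda>c::'k::comm_ring_1. [:c:]"
  by standard (auto simp: one_pCons)

lemma eval_simps [simp]:
  "eval 0 v = 0" "eval 1 v = 1" "eval (f + g) v = eval f v + eval g v"
  "eval (f * g) v = eval f v * eval g v" "eval (Const a) v = a" "eval (Var i) v = v $ i"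
  "eval (- f) v = - eval f v" "eval (f - g) v = eval f v - eval g v"
  "eval (sum F A) v = (\<Sum>a\<in>A. eval (F a) v)" "eval (prod F A) v = (\<Prod>a\<in>A. eval (F a) v)"
  "eval (f ^ m) v = eval f v ^ m"
  by (simp_all add: eval_def id_hom.subst_simps)

lemma eval_subst: "eval (subst Const l f) v = eval f (\<chi> i. eval (l i) v)"
  by (induction f rule: mp_induct) (auto simp: Const_hom.subst_simps)

lemma poly_subst: "poly (subst (\<lambda>c. [:c:]) l f) x = eval f (\<chi> i. poly (l i) x)"
  by (induction f rule: mp_induct) (auto simp: pConst_hom.subst_simps)

section \<open>Polynomials as functions on an infinite field\<close>

text \<open>Over a finite field, 1 plus the product of all X - a would be nonconstant without a
  root.\<close>

lemma infinite_UNIV_alg_closed: "infinite (UNIV :: 'k::alg_closed_field set)"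
proof
  assume fin: "finite (UNIV :: 'k set)"
  let ?q = "\<Prod>a\<in>(UNIV::'k set). [:- a, 1:]"
  have "degree ?q = (\<Sum>a\<in>(UNIV::'k set). degree [:- a, 1:])"
    by (rule degree_prod_eq_sum_degree) auto
  then have "degree ?q = card (UNIV :: 'k set)"
    by simp
  then have "degree ?q > 0"
    using fin by (simp add: card_gt_0_iff)
  then have "degree (?q + 1) > 0"
    by (subst degree_add_eq_left) auto
  then obtain x where "poly (?q + 1) x = 0"
    using alg_closed_imp_poly_has_root by blast
  moreover have "poly ?q x = 0"
    using fin by (auto simp: poly_prod prod_zero_iff)
  ultimately show False by simp
qed

text \<open>The weights are digits of a positional system: a new variable gets a weight N above all
  weights reached so far on T, so the old weight is the remainder modulo N and the new exponent is
  the quotient.\<close>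

lemma separating_weights:
  fixes T :: "('v \<Rightarrow>\<^sub>0 nat) set"
  assumes "finite J" "finite T"
  shows "\<exists>k :: 'v \<Rightarrow> nat. \<forall>s\<in>T. \<forall>t\<in>T.
    (\<Sum>i\<in>J. Poly_Mapping.lookup s i * k i) = (\<Sum>i\<in>J. Poly_Mapping.lookup t i * k i) \<longrightarrow>
    (\<forall>i\<in>J. Poly_Mapping.lookup s i = Poly_Mapping.lookup t i)"
  using assms(1)
proof (induction J rule: finite_induct)
  case (insert j J)
  then obtain k where k: "\<And>s t. s \<in> T \<Longrightarrow> t \<in> T \<Longrightarrow>
    (\<Sum>i\<in>J. Poly_Mapping.lookup s i * k i) = (\<Sum>i\<in>J. Poly_Mapping.lookup t i * k i) \<Longrightarrow>
    (\<forall>i\<in>J. Poly_Mapping.lookup s i = Poly_Mapping.lookup t i)" by metis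
  define w where "w s = (\<Sum>i\<in>J. Poly_Mapping.lookup s i * k i)" for s
  obtain N where N: "\<And>s. s \<in> T \<Longrightarrow> w s < N"
    using finite_nat_set_iff_bounded[of "w ` T"] assms(2) by auto
  define k' where "k' = k(j := N)"
  have w': "(\<Sum>i\<in>insert j J. Poly_Mapping.lookup s i * k' i) = Poly_Mapping.lookup s j * N + w s" for s
    using insert(1,2) unfolding w_def k'_def by (auto intro!: sum.cong)
  show ?case
  proof (intro exI[of _ k'] ballI impI)
    fix s t i
    assume s: "s \<in> T" and t: "t \<in> T" and i: "i \<in> insert j J"
      and eq: "(\<Sum>i\<in>insert j J. Poly_Mapping.lookup s i * k' i) = (\<Sum>i\<in>insert j J. Poly_Mapping.lookup t i * k' i)"
    have eq: "Poly_Mapping.lookup s j * N + w s = Poly_Mapping.lookup t j * N + w t"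
      using eq by (simp only: w')
    have "(Poly_Mapping.lookup s j * N + w s) mod N = w s" "(Poly_Mapping.lookup t j * N + w t) mod N = w t"
      using N s t by auto
    then have "w s = w t" using eq by simp
    moreover from this eq N[OF s] have "Poly_Mapping.lookup s j = Poly_Mapping.lookup t j" by auto
    ultimately show "Poly_Mapping.lookup s i = Poly_Mapping.lookup t i"
      using k[OF s t] i unfolding w_def by auto
  qed
qed simp

lemma inj_on_weights:
  fixes T :: "('v::finite \<Rightarrow>\<^sub>0 nat) set"
  assumes "finite T"
  obtains k :: "'v \<Rightarrow> nat" where "inj_on (\<lambda>s. \<Sum>i\<in>UNIV. Poly_Mapping.lookup s i * k i) T"
proof -
  obtain k :: "'v \<Rightarrow> nat" where k: "\<forall>s\<in>T. \<forall>t\<in>T.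
    (\<Sum>i\<in>UNIV. Poly_Mapping.lookup s i * k i) = (\<Sum>i\<in>UNIV. Poly_Mapping.lookup t i * k i) \<longrightarrow>
    (\<forall>i\<in>UNIV. Poly_Mapping.lookup s i = Poly_Mapping.lookup t i)"
    using separating_weights[OF finite_class.finite_UNIV assms] by (rule exE)
  have "inj_on (\<lambda>s. \<Sum>i\<in>UNIV. Poly_Mapping.lookup s i * k i) T"
  proof (rule inj_onI)
    fix s t assume "s \<in> T" "t \<in> T"
      "(\<Sum>i\<in>UNIV. Poly_Mapping.lookup s i * k i) = (\<Sum>i\<in>UNIV. Poly_Mapping.lookup t i * k i)"
    then show "s = t"
      by (intro poly_mapping_eqI) (rule k[THEN bspec, THEN bspec, THEN mp, THEN bspec, OF _ _ _ UNIV_I])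
  qed
  then show ?thesis by (rule that)
qed

text \<open>Kronecker substitution: separating weights \<open>k\<close> make \<open>f(x\<^sup>k)\<close> a nonzero univariate polynomial.\<close>

lemma eval_eq_0_imp_eq_0:
  fixes f :: "('v::finite, 'k::alg_closed_field) mp"
  assumes "\<And>v. eval f v = 0"
  shows "f = 0"
proof (rule ccontr)
  assume "f \<noteq> 0"
  then obtain t0 where t0: "t0 \<in> Poly_Mapping.keys f"
    unfolding mp_eq_0_iff_keys by blast
  obtain k :: "'v \<Rightarrow> nat"
    where k: "inj_on (\<lambda>s. \<Sum>i\<in>UNIV. Poly_Mapping.lookup s i * k i) (Poly_Mapping.keys f)"
    by (rule inj_on_weights[OF finite_keys])
  define w where "w s = (\<Sum>i\<in>UNIV. Poly_Mapping.lookup s i * k i)" for s :: "'v \<Rightarrow>\<^sub>0 nat"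
  define p where "p = (\<Sum>t\<in>Poly_Mapping.keys f. Polynomial.monom (Poly_Mapping.lookup f t) (w t))"
  have "poly p x = eval f (\<chi> i. x ^ k i)" for x
    unfolding p_def eval_def subst_def
    by (simp add: poly_sum poly_monom w_def power_sum mult.commute flip: power_mult)
  then have "poly p x = 0" for x
    using assms by simp
  then have "p = 0"
    using poly_roots_finite[of p] infinite_UNIV_alg_closed[where 'k = 'k] by auto
  have "Polynomial.coeff p (w t0) = (\<Sum>t\<in>Poly_Mapping.keys f. if t = t0 then Poly_Mapping.lookup f t else 0)"
    unfolding p_def coeff_sum using inj_onD[OF k _ _ t0] by (intro sum.cong) (auto simp: w_def)
  then have "Polynomial.coeff p (w t0) = Poly_Mapping.lookup f t0"
    using t0 by (simp add: sum.delta')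
  then show False
    using \<open>p = 0\<close> t0 by (simp add: in_keys_iff)
qed

lemma mp_eqI:
  fixes f g :: "('v::finite, 'k::alg_closed_field) mp"
  assumes "\<And>v. eval f v = eval g v"
  shows "f = g"
  using eval_eq_0_imp_eq_0[of "f - g"] assms by simp

section \<open>Forms and homogeneous components\<close>

lemma zero_in_forms [simp]: "0 \<in> forms d"
  by (simp add: forms_def)

lemma forms_add: "f \<in> forms d \<Longrightarrow> g \<in> forms d \<Longrightarrow> f + g \<in> forms d"
  unfolding forms_def using keys_add[of f g] by auto

lemma forms_mult:
  fixes f g :: "('v::finite, 'k::comm_ring_1) mp"
  assumes "f \<in> forms d" "g \<in> forms e"
  shows "f * g \<in> forms (d + e)"
  using assms keys_mult[of f g] unfolding forms_def by (fastforce simp: mdeg_add)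

lemma Const_in_forms [simp]: "Const c \<in> forms 0"
  by (auto simp: forms_def Const_def)

lemma one_in_forms [simp]: "(1 :: ('v, 'k::comm_ring_1) mp) \<in> forms 0"
  using Const_in_forms[of "1::'k"] by simp

lemma Var_in_forms [simp]: "Var (i::'v::finite) \<in> forms 1"
  by (auto simp: forms_def Var_def)

lemma forms_Const_mult: "f \<in> forms d \<Longrightarrow> Const c * f \<in> forms d"
  for f :: "('v::finite, 'k::comm_ring_1) mp"
  using forms_mult[of "Const c" 0 f d] by simp

lemma forms_uminus: "f \<in> forms d \<Longrightarrow> - f \<in> forms d"
  for f :: "('v::finite, 'k::comm_ring_1) mp"
  using forms_Const_mult[of f d "-1"] by (simp add: Const_uminus)

lemma forms_minus: "f \<in> forms d \<Longrightarrow> g \<in> forms d \<Longrightarrow> f - g \<in> forms d"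
  for f :: "('v::finite, 'k::comm_ring_1) mp"
  using forms_add[of f d "- g"] by (simp add: forms_uminus)

lemma forms_sum: "(\<And>a. a \<in> A \<Longrightarrow> F a \<in> forms d) \<Longrightarrow> sum F A \<in> forms d"
  by (induction A rule: infinite_finite_induct) (auto intro: forms_add)

lemma forms_power: "f \<in> forms d \<Longrightarrow> f ^ m \<in> forms (int m * d)"
  for f :: "('v::finite, 'k::comm_ring_1) mp"
proof (induction m)
  case (Suc m)
  then show ?case using forms_mult[of f d "f ^ m" "int m * d"] by (simp add: algebra_simps)
qed simp

lemma forms_prod:
  fixes F :: "'a \<Rightarrow> ('v::finite, 'k::comm_ring_1) mp"
  assumes "\<And>a. a \<in> A \<Longrightarrow> F a \<in> forms (D a)"
  shows "prod F A \<in> forms (sum D A)"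
  using assms
proof (induction A rule: infinite_finite_induct)
  case (insert a A)
  then show ?case using forms_mult[of "F a" "D a" "prod F A" "sum D A"] by simp
qed simp_all

lemma forms_neg: "d < 0 \<Longrightarrow> f \<in> forms d \<Longrightarrow> f = 0"
  unfolding mp_eq_0_iff_keys by (force simp: forms_def)

lemma forms_0: "f \<in> forms 0 \<Longrightarrow> \<exists>c. f = Const c"
  for f :: "('v::finite, 'k::comm_ring_1) mp"
proof -
  assume f: "f \<in> forms 0"
  have "t = 0" if "t \<in> Poly_Mapping.keys f" for t
  proof -
    have "mdeg t = 0" using f that by (auto simp: forms_def)
    then show ?thesis by (intro poly_mapping_eqI) (simp add: mdeg_UNIV)
  qed
  then have "f = Const (Poly_Mapping.lookup f 0)"
    by (intro poly_mapping_eqI) (metis Const_def in_keys_iff lookup_single_eq lookup_single_not_eq)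
  then show ?thesis by blast
qed

text \<open>Serves to make cofactors homogeneous. With an integer degree, components of negative
  degree are 0 and \<open>hcomp_mult\<close> holds without a condition on d.\<close>

definition hcomp :: "int \<Rightarrow> ('v, 'k::comm_monoid_add) mp \<Rightarrow> ('v, 'k) mp" where
  "hcomp d f = (\<Sum>t | t \<in> Poly_Mapping.keys f \<and> int (mdeg t) = d.
     Poly_Mapping.single t (Poly_Mapping.lookup f t))"

lemma lookup_hcomp:
  "Poly_Mapping.lookup (hcomp d f) t = (if int (mdeg t) = d then Poly_Mapping.lookup f t else 0)"
  by (auto simp: hcomp_def lookup_sum lookup_single when_def sum.delta' in_keys_iff)

lemma hcomp_in_forms [simp]: "hcomp d f \<in> forms d"
  by (auto simp: forms_def in_keys_iff lookup_hcomp split: if_splits)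

lemma hcomp_add: "hcomp d (f + g) = hcomp d f + hcomp d g"
  by (rule poly_mapping_eqI) (simp add: lookup_hcomp lookup_add)

lemma hcomp_zero [simp]: "hcomp d 0 = 0"
  by (rule poly_mapping_eqI) (simp add: lookup_hcomp)

lemma hcomp_minus: "hcomp d (f - g) = hcomp d f - hcomp d g"
  for f :: "('v, 'k::comm_ring_1) mp"
  by (rule poly_mapping_eqI) (simp add: lookup_hcomp lookup_minus)

lemma hcomp_sum: "hcomp d (sum F A) = (\<Sum>a\<in>A. hcomp d (F a))"
  by (induction A rule: infinite_finite_induct) (auto simp: hcomp_add)

lemma hcomp_forms: "f \<in> forms d \<Longrightarrow> hcomp e f = (if e = d then f else 0)"
  by (rule poly_mapping_eqI) (auto simp: lookup_hcomp forms_def in_keys_iff)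

lemma mp_sum_hcomp: "f = (\<Sum>d\<in>(\<lambda>t. int (mdeg t)) ` Poly_Mapping.keys f. hcomp d f)"
  by (rule poly_mapping_eqI) (auto simp: lookup_sum lookup_hcomp sum.delta' in_keys_iff)

lemma hcomp_mult:
  fixes f g :: "('v::finite, 'k::comm_ring_1) mp"
  assumes "f \<in> forms e"
  shows "hcomp d (f * g) = f * hcomp (d - e) g"
proof -
  have "hcomp d (f * hcomp b g) = (if b = d - e then f * hcomp b g else 0)" for b
    using hcomp_forms[OF forms_mult[OF assms hcomp_in_forms[of b g]], of d] by auto
  note * = this
  let ?B = "(\<lambda>t. int (mdeg t)) ` Poly_Mapping.keys g"
  have "hcomp d (f * g) = (\<Sum>b\<in>?B. hcomp d (f * hcomp b g))"
    by (subst mp_sum_hcomp[of g]) (simp add: sum_distrib_left hcomp_sum)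
  also have "\<dots> = f * (\<Sum>b\<in>?B. hcomp (d - e) (hcomp b g))"
    unfolding sum_distrib_left by (intro sum.cong refl) (simp add: * hcomp_forms[OF hcomp_in_forms])
  also have "\<dots> = f * hcomp (d - e) g"
    by (subst (2) mp_sum_hcomp[of g]) (simp add: hcomp_sum)
  finally show ?thesis .
qed

lemma eval_form_scale:
  fixes f :: "('v::finite, 'k::comm_ring_1) mp"
  assumes "f \<in> forms d" "d \<ge> 0"
  shows "eval f (a *s w) = a ^ nat d * eval f w"
proof -
  have "(\<Prod>i\<in>UNIV. (a * w $ i) ^ Poly_Mapping.lookup t i) =
    a ^ nat d * (\<Prod>i\<in>UNIV. w $ i ^ Poly_Mapping.lookup t i)" if "t \<in> Poly_Mapping.keys f" for t
  proof -
    have "mdeg t = nat d" using assms that by (auto simp: forms_def)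
    then show ?thesis
      by (simp add: power_mult_distrib prod.distrib mdeg_UNIV flip: power_sum)
  qed
  then show ?thesis
    by (auto simp: eval_def subst_def sum_distrib_left mult_ac intro!: sum.cong)
qed

section \<open>Linear forms, partial derivatives and the pairing\<close>

definition linform :: "'k::comm_ring_1 ^ 'v::finite \<Rightarrow> ('v, 'k) mp" where
  "linform c = (\<Sum>i\<in>UNIV. Const (c $ i) * Var i)"

lemma linform_in_forms [simp]: "linform c \<in> forms 1"
  unfolding linform_def by (intro forms_sum forms_Const_mult) simp

lemma eval_linform [simp]: "eval (linform c) w = pairing c w"
  by (simp add: linform_def pairing_def)

lemma forms_1: "l \<in> forms 1 \<Longrightarrow> \<exists>c. l = linform c"
  for l :: "('v::finite, 'k::comm_ring_1) mp"
proof -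
  assume l: "l \<in> forms 1"
  define c :: "'k ^ 'v" where "c = (\<chi> i. Poly_Mapping.lookup l (Poly_Mapping.single i 1))"
  have inj: "Poly_Mapping.single i (1::nat) = Poly_Mapping.single j 1 \<longleftrightarrow> i = j" for i j :: 'v
    by (metis keys_single one_neq_zero singleton_inject)
  have lk: "Poly_Mapping.lookup (linform c) t = (\<Sum>i\<in>UNIV. if Poly_Mapping.single i 1 = t then c $ i else 0)" for t
    by (simp add: linform_def Const_def Var_def mult_single lookup_sum lookup_single when_def)
  have "Poly_Mapping.lookup l t = Poly_Mapping.lookup (linform c) t" for t
  proof (cases "\<exists>j. t = Poly_Mapping.single j 1")
    case True
    then obtain j where j: "t = Poly_Mapping.single j 1" ..
    show ?thesis unfolding j lk inj by (simp add: c_def sum.delta')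
  next
    case False
    have "t \<notin> Poly_Mapping.keys l"
    proof
      assume "t \<in> Poly_Mapping.keys l"
      then have "mdeg t = 1"
        using l by (auto simp: forms_def)
      then have "(\<Sum>i\<in>UNIV. Poly_Mapping.lookup t i) = 1"
        by (simp add: mdeg_UNIV)
      then obtain j where "Poly_Mapping.lookup t j = 1" "\<forall>i. i \<noteq> j \<longrightarrow> Poly_Mapping.lookup t i = 0"
        by (auto simp: sum_eq_Suc0_iff)
      then have "t = Poly_Mapping.single j 1"
        by (intro poly_mapping_eqI) (auto simp: lookup_single when_def)
      with False show False by blast
    qed
    moreover have "Poly_Mapping.lookup (linform c) t = 0"
      using False unfolding lk by (intro sum.neutral) auto
    ultimately show ?thesis by (simp add: in_keys_iff)
  qed
  then have "l = linform c" by (rule poly_mapping_eqI)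
  then show ?thesis by blast
qed

lemma pd_superset:
  assumes "finite T" "Poly_Mapping.keys f \<subseteq> T"
  shows "pd i f = (\<Sum>t\<in>T. Poly_Mapping.single (t - Poly_Mapping.single i 1)
       (of_nat (Poly_Mapping.lookup t i) * Poly_Mapping.lookup f t))"
  unfolding pd_def using assms by (intro sum.mono_neutral_left) (auto simp: in_keys_iff)

lemma pd_add: "pd i (f + g) = pd i f + pd i g"
proof -
  let ?T = "Poly_Mapping.keys f \<union> Poly_Mapping.keys g"
  have "Poly_Mapping.keys (f + g) \<subseteq> ?T" by (rule keys_add)
  then show ?thesis
    by (simp add: pd_superset[of ?T] lookup_add distrib_left single_add sum.distrib)
qed

lemma pd_zero [simp]: "pd i 0 = 0"
  by (simp add: pd_def)

lemma pd_single: "pd i (Poly_Mapping.single t a) =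
    Poly_Mapping.single (t - Poly_Mapping.single i 1) (of_nat (Poly_Mapping.lookup t i) * a)"
  by (simp add: pd_superset[of "{t}"])

lemma pd_mult: "pd i (f * g) = f * pd i g + g * pd i f"
proof (induction f rule: mp_single_induct)
  case (single t a)
  show ?case
  proof (induction g rule: mp_single_induct)
    case (single s b)
    let ?e = "Poly_Mapping.single i (Suc 0)"
    \<comment> \<open>Subtraction of exponents is truncated; where it would go wrong the exponent is
      0 and the coefficient kills the term.\<close>
    have sub: "x + (y - ?e) = x + y - ?e" if "Poly_Mapping.lookup y i \<noteq> 0" for x y
      using that by (intro poly_mapping_eqI) (auto simp: lookup_add lookup_minus lookup_single when_def)
    have 1: "Poly_Mapping.single t a * pd i (Poly_Mapping.single s b) =
      Poly_Mapping.single (t + s - ?e) (of_nat (Poly_Mapping.lookup s i) * (a * b))"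
      by (cases "Poly_Mapping.lookup s i = 0") (simp_all add: pd_single mult_single sub mult_ac)
    have 2: "Poly_Mapping.single s b * pd i (Poly_Mapping.single t a) =
      Poly_Mapping.single (t + s - ?e) (of_nat (Poly_Mapping.lookup t i) * (a * b))"
      by (cases "Poly_Mapping.lookup t i = 0") (simp_all add: pd_single mult_single sub add.commute[of t s] mult_ac)
    show ?case
      unfolding 1 2 by (simp add: mult_single pd_single lookup_add distrib_right single_add add.commute)
  qed (simp_all add: pd_add algebra_simps)
qed (simp_all add: pd_add algebra_simps)

lemma pd_Const [simp]: "pd i (Const c) = 0"
  by (simp add: Const_def pd_single)

lemma pd_Var: "pd i (Var j) = (if i = j then 1 else 0)"
  by (auto simp: Var_def pd_single lookup_single when_def)

lemma pd_sum: "pd i (sum F A) = (\<Sum>a\<in>A. pd i (F a))"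
  by (induction A rule: infinite_finite_induct) (auto simp: pd_add)

lemma pd_linform [simp]: "pd i (linform c) = Const (c $ i)"
proof -
  have "pd i (Const (c $ j) * Var j) = (if i = j then Const (c $ j) else 0)" for j
    by (simp add: pd_mult pd_Var)
  then show ?thesis
    by (simp add: linform_def pd_sum sum.delta')
qed

lemma pairing_simps [simp]:
  "pairing (a + b) w = pairing a w + pairing b w" "pairing c (v + w) = pairing c v + pairing c w"
  "pairing (a - b) w = pairing a w - pairing b w" "pairing c (v - w) = pairing c v - pairing c w"
  "pairing (k *s c) w = k * pairing c w" "pairing c (k *s w) = k * pairing c w"
  "pairing 0 w = 0" "pairing c 0 = 0"
  by (simp_all add: pairing_def distrib_left distrib_right left_diff_distrib right_diff_distrib
      sum.distrib sum_subtractf sum_distrib_left mult_ac)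

lemma pairing_axis [simp]: "pairing c (axis i 1) = c $ i" "pairing (axis i 1) w = w $ i"
  by (simp_all add: pairing_def axis_def if_distrib[of "\<lambda>x. _ * x"] if_distrib[of "\<lambda>x. x * _"] cong: if_cong)

lemma pairing_commute: "pairing v w = pairing w v"
  by (simp add: pairing_def mult.commute)

lemma pairing_neg [simp]: "pairing (- c) w = - pairing c w" "pairing c (- w) = - pairing c w"
  by (simp_all add: pairing_def sum_negf)

section \<open>Vanishing ideals of linear subspaces\<close>

lemma vanishing_ideal_iff: "f \<in> vanishing_ideal C \<longleftrightarrow> (\<forall>v\<in>C. eval f v = 0)"
  by (simp add: vanishing_ideal_def)

lemma vanishing_idealD: "f \<in> vanishing_ideal C \<Longrightarrow> v \<in> C \<Longrightarrow> eval f v = 0"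
  by (simp add: vanishing_ideal_iff)

lemma poly_line_restriction:
  "poly (subst (\<lambda>c. [:c:]) (\<lambda>i. [:v $ i, w $ i:]) f) x = eval f (v + x *s w)"
  unfolding poly_subst by (rule arg_cong[of _ _ "eval f"]) (simp add: vec_eq_iff)

text \<open>Restrict both factors to the line joining a point where the first does not vanish
  to a point where the second does not vanish.\<close>

lemma vanishing_ideal_prime:
  fixes f g :: "('v::finite, 'k::alg_closed_field) mp"
  assumes "vec.subspace U" and "f * g \<in> vanishing_ideal U"
  shows "f \<in> vanishing_ideal U \<or> g \<in> vanishing_ideal U"
proof (rule ccontr)
  assume "\<not> ?thesis"
  then obtain v w where vw: "v \<in> U" "eval f v \<noteq> 0" "w \<in> U" "eval g w \<noteq> 0"
    by (auto simp: vanishing_ideal_iff)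
  define p where "p = subst (\<lambda>c. [:c:]) (\<lambda>i. [:v $ i, (w - v) $ i:]) f"
  define q where "q = subst (\<lambda>c. [:c:]) (\<lambda>i. [:v $ i, (w - v) $ i:]) g"
  have "p \<noteq> 0" "q \<noteq> 0"
    using vw poly_line_restriction[of v "w - v" f 0] poly_line_restriction[of v "w - v" g 1]
    unfolding p_def q_def by auto
  moreover have "poly (p * q) x = 0" for x
  proof -
    have "v + x *s (w - v) \<in> U"
      using assms(1) vw by (intro vec.subspace_add vec.subspace_scale vec.subspace_diff)
    then have "eval (f * g) (v + x *s (w - v)) = 0"
      by (rule vanishing_idealD[OF assms(2)])
    then show ?thesis
      unfolding p_def q_def poly_mult poly_line_restriction by simp
  qed
  then have "p * q = 0"
    using poly_roots_finite[of "p * q"] infinite_UNIV_alg_closed[where 'k = 'k] by auto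
  ultimately show False by simp
qed

text \<open>U is closed under scaling, so for w in U the polynomial in x with value f(xw) has every
  scalar as a root. Its coefficients are the values of the components of f at w.\<close>

lemma vanishing_ideal_hcomp:
  fixes f :: "('v::finite, 'k::alg_closed_field) mp"
  assumes "vec.subspace U" and "f \<in> vanishing_ideal U"
  shows "hcomp d f \<in> vanishing_ideal U"
proof (cases "d \<in> (\<lambda>t. int (mdeg t)) ` Poly_Mapping.keys f")
  case True
  let ?B = "(\<lambda>t. int (mdeg t)) ` Poly_Mapping.keys f"
  show ?thesis unfolding vanishing_ideal_iff
  proof
    fix w assume w: "w \<in> U"
    define p where "p = (\<Sum>b\<in>?B. Polynomial.monom (eval (hcomp b f) w) (nat b))"
    have nn: "b \<ge> 0" if "b \<in> ?B" for b
      using that by auto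
    have "poly p x = 0" for x
    proof -
      have "poly p x = (\<Sum>b\<in>?B. eval (hcomp b f) (x *s w))"
        unfolding p_def poly_sum poly_monom
        by (intro sum.cong refl) (simp add: eval_form_scale[OF hcomp_in_forms nn])
      also have "\<dots> = eval f (x *s w)"
        by (subst (2) mp_sum_hcomp[of f]) simp
      also have "\<dots> = 0"
        using assms w by (intro vanishing_idealD[OF assms(2)] vec.subspace_scale)
      finally show ?thesis .
    qed
    then have "p = 0"
      using poly_roots_finite[of p] infinite_UNIV_alg_closed[where 'k = 'k] by auto
    moreover have "Polynomial.coeff p (nat d) = (\<Sum>b\<in>?B. if b = d then eval (hcomp b f) w else 0)"
      unfolding p_def coeff_sum using nn True by (intro sum.cong refl) (auto simp: nat_eq_iff)
    ultimately show "eval (hcomp d f) w = 0"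
      using True by (simp add: sum.delta')
  qed
next
  case False
  then have "hcomp d f = 0"
    by (intro poly_mapping_eqI) (auto simp: lookup_hcomp in_keys_iff)
  then show ?thesis by (simp add: vanishing_ideal_iff)
qed

text \<open>The substitution is the identity modulo l on the variables, hence on every
  polynomial.\<close>

lemma minus_subst_shift_dvd:
  fixes f :: "('v::finite, 'k::comm_ring_1) mp"
  shows "\<exists>a. f - subst Const (\<lambda>i. Var i - Const (e $ i) * l) f = a * l"
proof (induction f rule: mp_induct)
  case (Const c)
  then show ?case by (auto simp: Const_hom.subst_simps intro: exI[of _ 0])
next
  case (Var i)
  then show ?case by (auto simp: Const_hom.subst_simps)
next
  case (add f g)
  let ?s = "subst Const (\<lambda>i. Var i - Const (e $ i) * l)"
  from add obtain a b where a: "f - ?s f = a * l" and b: "g - ?s g = b * l" by blast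
  have "f + g - ?s (f + g) = (f - ?s f) + (g - ?s g)"
    by (simp add: Const_hom.subst_add)
  also have "\<dots> = (a + b) * l"
    unfolding a b by (simp add: algebra_simps)
  finally show ?case by blast
next
  case (mult f g)
  let ?s = "subst Const (\<lambda>i. Var i - Const (e $ i) * l)"
  from mult obtain a b where a: "f - ?s f = a * l" and b: "g - ?s g = b * l" by blast
  have "f * g - ?s (f * g) = (f - ?s f) * g + ?s f * (g - ?s g)"
    by (simp add: Const_hom.subst_mult algebra_simps)
  also have "\<dots> = (a * g + ?s f * b) * l"
    unfolding a b by (simp add: algebra_simps)
  finally show ?case by blast
qed

text \<open>Projecting along \<open>e\<close> onto the hyperplane changes \<open>f\<close> by a multiple of the linear form.\<close>

lemma vanishing_ideal_divide:
  fixes f :: "('v::finite, 'k::field) mp"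
  assumes U: "vec.subspace U" and e: "e \<in> U" "pairing c e \<noteq> 0"
    and f: "\<And>w. w \<in> U \<Longrightarrow> pairing c w = 0 \<Longrightarrow> eval f w = 0"
  shows "\<exists>a. f - a * linform c \<in> vanishing_ideal U"
proof -
  define e' where "e' = (1 / pairing c e) *s e"
  have e': "e' \<in> U" "pairing c e' = 1"
    using U e by (auto simp: e'_def vec.subspace_scale)
  let ?s = "subst Const (\<lambda>i. Var i - Const (e' $ i) * linform c) f"
  obtain a where a: "f - ?s = a * linform c"
    using minus_subst_shift_dvd by blast
  have "eval ?s w = 0" if w: "w \<in> U" for w
  proof -
    have "eval ?s w = eval f (w - pairing c w *s e')"
      unfolding eval_subst by (rule arg_cong[of _ _ "eval f"]) (simp add: vec_eq_iff)
    also have "\<dots> = 0"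
      using U w e' by (intro f vec.subspace_diff vec.subspace_scale) auto
    finally show ?thesis .
  qed
  moreover have "f - a * linform c = ?s"
    using a by (simp add: algebra_simps)
  ultimately show ?thesis
    unfolding vanishing_ideal_iff by metis
qed

lemma vanishing_ideal_divide_form:
  fixes f :: "('v::finite, 'k::alg_closed_field) mp"
  assumes U: "vec.subspace U" and e: "e \<in> U" "pairing c e \<noteq> 0"
    and f: "\<And>w. w \<in> U \<Longrightarrow> pairing c w = 0 \<Longrightarrow> eval f w = 0" and d: "f \<in> forms d"
  shows "\<exists>a\<in>forms (d - 1). f - a * linform c \<in> vanishing_ideal U"
proof -
  obtain a where a: "f - a * linform c \<in> vanishing_ideal U"
    using vanishing_ideal_divide[OF U e f] by blast
  have "hcomp d (f - a * linform c) = f - hcomp (d - 1) a * linform c"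
    by (simp add: hcomp_minus hcomp_forms[OF d] mult.commute[of _ "linform c"]
        hcomp_mult[OF linform_in_forms])
  then show ?thesis
    using vanishing_ideal_hcomp[OF U a, of d] by (intro bexI[of _ "hcomp (d - 1) a"]) auto
qed

lemma linform_dvd_if_vanishing:
  fixes f :: "('v::finite, 'k::alg_closed_field) mp"
  assumes "c \<noteq> 0" and f: "\<And>w. pairing c w = 0 \<Longrightarrow> eval f w = 0"
  shows "\<exists>a. f = a * linform c"
proof -
  from assms(1) obtain i where "c $ i \<noteq> 0" by (auto simp: vec_eq_iff)
  then obtain a where "f - a * linform c \<in> vanishing_ideal UNIV"
    using vanishing_ideal_divide[of UNIV "axis i 1" c f] f by auto
  then have "f - a * linform c = 0"
    by (intro eval_eq_0_imp_eq_0) (simp only: vanishing_ideal_iff UNIV_I)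
  then show ?thesis by auto
qed

text \<open>Dehomogenise. Without a root of the form \<open>u + x *s v\<close> the polynomial
  \<open>p\<close> is a constant k; homogeneity then gives g(v + xu) = k x^e for x other than 0,
  hence for all x, and x = 0 exhibits the root v at infinity.\<close>

lemma form_root_on_span:
  fixes g :: "('v::finite, 'k::alg_closed_field) mp"
  assumes g: "g \<in> forms (int e)" and e: "e > 0"
  shows "\<exists>a b. (a \<noteq> 0 \<or> b \<noteq> 0) \<and> eval g (a *s u + b *s v) = 0"
proof (rule ccontr)
  assume "\<not> ?thesis"
  then have no: "eval g (a *s u + b *s v) \<noteq> 0" if "a \<noteq> 0 \<or> b \<noteq> 0" for a b
    using that by blast
  define p where "p = subst (\<lambda>c. [:c:]) (\<lambda>i. [:u $ i, v $ i:]) g"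
  have p: "poly p x = eval g (u + x *s v)" for x
    by (simp add: p_def poly_line_restriction)
  have "poly p x \<noteq> 0" for x
    using no[of 1 x] by (simp add: p)
  then have "degree p = 0"
    using alg_closed_imp_poly_has_root[of p] by blast
  then obtain k where "p = [:k:]"
    by (rule degree_eq_zeroE)
  then have k: "eval g (u + x *s v) = k" for x
    using p[of x] by simp
  define q where "q = subst (\<lambda>c. [:c:]) (\<lambda>i. [:v $ i, u $ i:]) g - Polynomial.monom k e"
  have q: "poly q x = eval g (v + x *s u) - k * x ^ e" for x
    by (simp add: q_def poly_line_restriction poly_monom)
  have "poly q x = 0" if "x \<noteq> 0" for x
  proof -
    have eq: "v + x *s u = x *s (u + (1 / x) *s v)"
      using that by (simp add: vec_eq_iff field_simps)
    have "eval g (v + x *s u) = x ^ e * eval g (u + (1 / x) *s v)"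
      unfolding eq using eval_form_scale[OF g, of x "u + (1 / x) *s v"] by simp
    then show ?thesis
      by (simp add: q k)
  qed
  then have "UNIV - {0} \<subseteq> {x. poly q x = 0}" by auto
  then have "q = 0"
    using poly_roots_finite[of q] infinite_UNIV_alg_closed[where 'k = 'k]
    by (metis finite_Diff2 finite_insert finite.emptyI finite_subset)
  then have "eval g v = 0"
    using q[of 0] e by simp
  then show False
    using no[of 0 1] by simp
qed

text \<open>Finitely many hyperplanes do not cover the space, since a product of nonzero linear
  forms is a nonzero polynomial.\<close>

lemma exists_off_hyperplanes:
  fixes C :: "('k::alg_closed_field ^ 'v::finite) set"
  assumes "finite C" "0 \<notin> C"
  shows "\<exists>u. \<forall>c\<in>C. pairing c u \<noteq> 0"
proof -
  have "(\<Prod>c\<in>C. linform c) \<notin> vanishing_ideal UNIV"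
    using assms
  proof (induction C rule: finite_induct)
    case (insert c C)
    have "linform c \<notin> vanishing_ideal UNIV"
    proof -
      from insert obtain i where "c $ i \<noteq> 0" by (auto simp: vec_eq_iff)
      then have "eval (linform c) (axis i 1) \<noteq> 0" by simp
      then show ?thesis unfolding vanishing_ideal_iff by blast
    qed
    then show ?case
      using insert vanishing_ideal_prime[of UNIV "linform c" "\<Prod>c\<in>C. linform c"] by auto
  qed (simp add: vanishing_ideal_iff)
  then show ?thesis
    using assms by (auto simp: vanishing_ideal_iff prod_zero_iff)
qed

section \<open>Derivations\<close>

lemma derivations_one:
  assumes "\<theta> \<in> derivations"
  shows "\<theta> 1 = 0"
proof -
  have "\<theta> (1 * 1) = 1 * \<theta> 1 + 1 * \<theta> 1"
    using assms unfolding derivations_def by blast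
  then show ?thesis by simp
qed

lemma derivations_expand:
  fixes \<theta> :: "('v::finite, 'k::comm_ring_1) mp \<Rightarrow> ('v, 'k) mp"
  assumes "\<theta> \<in> derivations"
  shows "\<theta> f = (\<Sum>i\<in>UNIV. \<theta> (Var i) * pd i f)"
proof (induction f rule: mp_induct)
  case (Const c)
  have "\<theta> (Const c * 1) = Const c * \<theta> 1"
    using assms unfolding derivations_def by blast
  then show ?case by (simp add: derivations_one[OF assms])
next
  case (Var i)
  show ?case by (simp add: pd_Var if_distrib[of "\<lambda>x. _ * x"] cong: if_cong)
next
  case (add f g)
  have "\<theta> (f + g) = \<theta> f + \<theta> g"
    using assms unfolding derivations_def by blast
  then show ?case
    unfolding add by (simp add: pd_add distrib_left sum.distrib)
next
  case (mult f g)
  have "\<theta> (f * g) = f * \<theta> g + g * \<theta> f"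
    using assms unfolding derivations_def by blast
  then show ?case
    unfolding mult by (simp add: pd_mult distrib_left sum.distrib sum_distrib_left mult_ac)
qed

text \<open>Together with \<open>derivations_expand\<close> it lets derivations and tuples of
  polynomials be exchanged freely.\<close>

definition der :: "('v \<Rightarrow> ('v, 'k) mp) \<Rightarrow> ('v::finite, 'k::comm_ring_1) mp \<Rightarrow> ('v, 'k) mp" where
  "der a f = (\<Sum>i\<in>UNIV. a i * pd i f)"

lemma der_in_derivations: "der a \<in> derivations"
  by (auto simp: derivations_def der_def pd_add pd_mult distrib_left sum.distrib sum_distrib_left
      mult_ac)

lemma der_Var [simp]: "der a (Var i) = a i"
  by (simp add: der_def pd_Var if_distrib[of "\<lambda>x. _ * x"] cong: if_cong)

lemma derivations_linform: "\<theta> \<in> derivations \<Longrightarrow> \<theta> (linform c) = (\<Sum>i\<in>UNIV. \<theta> (Var i) * Const (c $ i))"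
  by (subst derivations_expand) auto

lemma euler_eq_der: "euler = der Var"
  by (auto simp: euler_def der_def)

lemma euler_Var [simp]: "euler (Var i) = Var i"
  by (simp add: euler_eq_der)

section \<open>The linear map from \<open>V\<close> to the dual line\<close>

text \<open>\<open>sg\<close> is the map \<open>\<sigma>\<close>, \<open>lf i\<close> its \<open>i\<close>-th coordinate, and \<open>x0\<close>, \<open>y0\<close> span a complement of \<open>Q\<close>.\<close>

locale line_duality =
  fixes L Q :: "('k::alg_closed_field ^ 'v::{finite,linorder}) set"
    and lf :: "'v \<Rightarrow> ('v, 'k) mp"
    and sg :: "('k, 'v) vec \<Rightarrow> ('k, 'v) vec"
    and x0 y0 :: "('k, 'v) vec"
  assumes lf_in_forms: "lf i \<in> forms 1"
    and eval_lf: "eval (lf i) x = sg x $ i"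
    and sg_add: "sg (x + y) = sg x + sg y"
    and sg_scale: "sg (k *s x) = k *s sg x"
    and pairing_sg_self: "pairing x (sg x) = 0"
    and range_sg: "range sg = L"
    and sg_eq_0_iff: "sg x = 0 \<longleftrightarrow> x \<in> Q"
    and perp_Q: "perp Q = L"
    and x0y0: "pairing y0 (sg x0) \<noteq> 0"
    and L_expansion: "w \<in> L \<Longrightarrow>
      pairing y0 (sg x0) *s w = pairing y0 w *s sg x0 - pairing x0 w *s sg y0"

section \<open>The determinant with two free rows\<close>

lemma pos_less: "i < j \<Longrightarrow> pos i < pos j"
  unfolding pos_def by (intro psubset_card_mono) auto

lemma pos_inject: "pos i = pos j \<longleftrightarrow> i = j"
  using pos_less[of i j] pos_less[of j i] by (cases i j rule: linorder_cases) auto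

lemma range_pos: "range (pos :: 'v::{finite,linorder} \<Rightarrow> nat) = {..<CARD('v)}"
proof (rule card_subset_eq)
  have "pos r < CARD('v)" for r :: 'v
    unfolding pos_def by (intro psubset_card_mono) auto
  then show "range (pos :: 'v \<Rightarrow> nat) \<subseteq> {..<CARD('v)}" by auto
  show "card (range (pos :: 'v \<Rightarrow> nat)) = card {..<CARD('v)}"
    by (simp add: card_image inj_on_def pos_inject)
qed simp

text \<open>The form det(y, x, \<open>\<alpha> 1\<close>, ...), bilinear in the two free rows. The
  row at position 2 carries \<open>\<alpha> 1\<close>, which explains the shift by one.\<close>

definition two_row_det ::
    "(nat \<Rightarrow> 'k::field ^ 'v::{finite,linorder}) \<Rightarrow> ('k, 'v) vec \<Rightarrow> ('k, 'v) vec \<Rightarrow> 'k" where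
  "two_row_det \<alpha> y x = det (\<chi> r. if pos r = 0 then y else if pos r = 1 then x else \<alpha> (pos r - 1))"

definition two_row_vec ::
    "(nat \<Rightarrow> 'k::field ^ 'v::{finite,linorder}) \<Rightarrow> ('k, 'v) vec \<Rightarrow> ('k, 'v) vec" where
  "two_row_vec \<alpha> x = (\<chi> i. two_row_det \<alpha> (axis i 1) x)"

context
  fixes \<alpha> :: "nat \<Rightarrow> 'k::field ^ 'v::{finite,linorder}"
  assumes card2: "CARD('v) \<ge> 2"
begin

lemma obtain_pos: "k < CARD('v) \<Longrightarrow> \<exists>r::'v. pos r = k"
  using range_pos[where 'v = 'v] by (metis imageE lessThan_iff)

lemma two_row_det_linear:
  "two_row_det \<alpha> (y + y') x = two_row_det \<alpha> y x + two_row_det \<alpha> y' x"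
  "two_row_det \<alpha> (k *s y) x = k * two_row_det \<alpha> y x"
  "two_row_det \<alpha> y (x + x') = two_row_det \<alpha> y x + two_row_det \<alpha> y x'"
  "two_row_det \<alpha> y (k *s x) = k * two_row_det \<alpha> y x"
proof -
  obtain r0 r1 :: 'v where r: "pos r0 = 0" "pos r1 = 1"
    using obtain_pos[of 0] obtain_pos[of 1] card2 by auto
  have p0: "pos r = 0 \<longleftrightarrow> r = r0" and p1: "pos r = 1 \<longleftrightarrow> r = r1" for r
    using r pos_inject[of r r0] pos_inject[of r r1] by auto
  have r01: "r0 \<noteq> r1" using r by auto
  have A: "two_row_det \<alpha> y x = det (\<chi> r. if r = r0 then y else if r = r1 then x else \<alpha> (pos r - 1))" for y x
    by (simp only: two_row_det_def p0 p1)
  \<comment> \<open>The two tests are exchanged so that the row of x comes first, as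
    \<open>det_row_add\<close> and \<open>det_row_mul\<close> require.\<close>
  have B: "two_row_det \<alpha> y x = det (\<chi> r. if r = r1 then x else if r = r0 then y else \<alpha> (pos r - 1))" for y x
    unfolding A using r01 by (intro arg_cong[of _ _ det]) (auto simp: vec_eq_iff)
  show "two_row_det \<alpha> (y + y') x = two_row_det \<alpha> y x + two_row_det \<alpha> y' x"
    unfolding A by (rule det_row_add)
  show "two_row_det \<alpha> (k *s y) x = k * two_row_det \<alpha> y x"
    unfolding A by (rule det_row_mul)
  show "two_row_det \<alpha> y (x + x') = two_row_det \<alpha> y x + two_row_det \<alpha> y x'"
    unfolding B by (rule det_row_add)
  show "two_row_det \<alpha> y (k *s x) = k * two_row_det \<alpha> y x"
    unfolding B by (rule det_row_mul)
qed

lemma two_row_det_zero: "two_row_det \<alpha> 0 x = 0"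
  using two_row_det_linear(2)[of 0 0 x] by simp

lemma two_row_det_sum: "two_row_det \<alpha> (sum f A) x = (\<Sum>a\<in>A. two_row_det \<alpha> (f a) x)"
  by (induction A rule: infinite_finite_induct) (auto simp: two_row_det_zero two_row_det_linear)

lemma two_row_det_self: "two_row_det \<alpha> x x = 0"
proof -
  obtain r0 r1 :: 'v where r: "pos r0 = 0" "pos r1 = 1"
    using obtain_pos[of 0] obtain_pos[of 1] card2 by auto
  then show ?thesis
    unfolding two_row_det_def
    by (intro det_identical_rows[of r0 r1]) (auto simp: row_def vec_eq_iff)
qed

lemma two_row_det_basis:
  assumes "1 \<le> j" "j + 1 < CARD('v)"
  shows "two_row_det \<alpha> (\<alpha> j) x = 0"
proof -
  obtain r0 r1 :: 'v where r: "pos r0 = 0" "pos r1 = j + 1"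
    using obtain_pos[of 0] obtain_pos[of "j + 1"] assms by auto
  then show ?thesis
    unfolding two_row_det_def using assms
    by (intro det_identical_rows[of r0 r1]) (auto simp: row_def vec_eq_iff)
qed

text \<open>Expansion along the first row; it turns facts about the determinant into facts about the
  pairing.\<close>

lemma pairing_two_row_vec: "pairing y (two_row_vec \<alpha> x) = two_row_det \<alpha> y x"
proof -
  have "two_row_det \<alpha> y x = two_row_det \<alpha> (\<Sum>i\<in>UNIV. (y $ i) *s axis i 1) x"
    by (simp add: basis_expansion)
  also have "\<dots> = pairing y (two_row_vec \<alpha> x)"
    by (simp add: two_row_det_sum two_row_det_linear pairing_def two_row_vec_def)
  finally show ?thesis by simp
qed

lemma two_row_vec_add: "two_row_vec \<alpha> (x + y) = two_row_vec \<alpha> x + two_row_vec \<alpha> y"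
  by (simp add: two_row_vec_def vec_eq_iff two_row_det_linear)

lemma two_row_vec_scale: "two_row_vec \<alpha> (k *s x) = k *s two_row_vec \<alpha> x"
  by (simp add: two_row_vec_def vec_eq_iff two_row_det_linear)

lemma two_row_det_nonzero:
  assumes "vec.span (insert y (insert x (\<alpha> ` {1..CARD('v) - 2}))) = UNIV"
  shows "two_row_det \<alpha> y x \<noteq> 0"
proof -
  let ?A = "(\<chi> r::'v. if pos r = 0 then y else if pos r = 1 then x else \<alpha> (pos r - 1))"
  obtain r0 r1 :: 'v where r: "pos r0 = 0" "pos r1 = 1"
    using obtain_pos[of 0] obtain_pos[of 1] card2 by auto
  have rows_\<alpha>: "\<alpha> j \<in> rows ?A" if "j \<in> {1..CARD('v) - 2}" for j
  proof -
    have "j + 1 < CARD('v)"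
      using that card2 unfolding atLeastAtMost_iff by linarith
    then obtain r :: 'v where "pos r = j + 1"
      using obtain_pos[of "j + 1"] by auto
    then have "row r ?A = \<alpha> j" using that by (auto simp: row_def vec_eq_iff)
    then show ?thesis
      unfolding rows_def by (intro CollectI exI[of _ r] conjI UNIV_I) (rule sym)
  qed
  have rows: "row r ?A \<in> rows ?A" for r
    unfolding rows_def by (rule CollectI, rule exI[of _ r]) simp
  have "row r0 ?A = y" "row r1 ?A = x"
    using r by (auto simp: row_def vec_eq_iff)
  then have "y \<in> rows ?A" "x \<in> rows ?A"
    using rows[of r0] rows[of r1] by (simp_all only:)
  with rows_\<alpha> have "insert y (insert x (\<alpha> ` {1..CARD('v) - 2})) \<subseteq> rows ?A"
    by blast
  then have "vec.span (rows ?A) = UNIV"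
    using vec.span_mono assms by blast
  then show ?thesis
    unfolding two_row_det_def
    by (simp add: invertible_left_inverse matrix_left_invertible_span_rows_gen flip: invertible_det_nz)
qed

end

lemma eval_det: "eval (det A) x = det (\<chi> r c. eval (A $ r $ c) x)"
  for A :: "('v::finite, 'k::comm_ring_1) mp ^ 'w ^ 'w"
proof -
  have "eval (of_int k :: ('v, 'k) mp) x = of_int k" for k
  proof (cases k)
    case (nonneg m)
    have "eval (of_nat m :: ('v, 'k) mp) x = of_nat m" for m by (induction m) auto
    then show ?thesis using nonneg by simp
  next
    case (neg m)
    have "eval (of_nat m :: ('v, 'k) mp) x = of_nat m" for m by (induction m) auto
    then show ?thesis using neg by (simp del: of_nat_Suc)
  qed
  then show ?thesis by (simp add: det_def)
qed

lemma eval_tau_image: "eval (tau_image \<alpha> i) x = two_row_vec \<alpha> x $ i"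
  unfolding tau_image_def eval_det two_row_vec_def two_row_det_def
  by (simp, rule arg_cong[of _ _ det]) (auto simp: vec_eq_iff axis_def)

text \<open>Polynomials with equal values are equal, so the determinant \<open>tau_image\<close> is
  recognised as a linear form without being expanded.\<close>

lemma linear_function_linform:
  fixes f :: "('v::finite, 'k::alg_closed_field) mp"
  assumes "\<And>x y. eval f (x + y) = eval f x + eval f y" "\<And>k x. eval f (k *s x) = k * eval f x"
  shows "f \<in> forms 1"
proof -
  have z: "eval f 0 = 0"
    using assms(2)[of 0 0] by simp
  have s: "eval f (\<Sum>i\<in>A. (x $ i) *s axis i 1) = (\<Sum>i\<in>A. x $ i * eval f (axis i 1))" for x and A :: "'v set"
    by (induction A rule: infinite_finite_induct) (auto simp: z assms)
  have "f = linform (\<chi> i. eval f (axis i 1))"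
  proof (rule mp_eqI)
    fix x
    show "eval f x = eval (linform (\<chi> i. eval f (axis i 1))) x"
      using s[of x UNIV] by (simp add: basis_expansion pairing_def mult.commute)
  qed
  then show ?thesis
    using linform_in_forms by metis
qed

lemma perp_subspace: "vec.subspace (perp U)"
  by (rule vec.subspaceI) (auto simp: perp_def)

lemma pairing_nondegenerate:
  assumes "\<And>y. y \<in> B \<Longrightarrow> pairing y z = 0" and "vec.span B = UNIV"
  shows "z = 0"
proof -
  have "vec.subspace {y. pairing y z = 0}"
    by (rule vec.subspaceI) auto
  then have "vec.span B \<subseteq> {y. pairing y z = 0}"
    using assms(1) by (intro vec.span_minimal) auto
  then have "axis i 1 \<in> {y. pairing y z = 0}" for i
    using assms(2) by blast
  then show ?thesis by (simp add: vec_eq_iff)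
qed

lemma extend_by_two:
  fixes \<alpha> :: "nat \<Rightarrow> 'k::field ^ 'v::{finite,linorder}"
  assumes "CARD('v) = n + 1" "n \<ge> 1" "ordered_basis (n - 1) \<alpha> Q"
  obtains x y where "vec.span (insert y (insert x (\<alpha> ` {1..n - 1}))) = UNIV"
proof -
  let ?A = "\<alpha> ` {1..n - 1}"
  have ind: "vec.independent ?A" and cA: "card ?A = n - 1"
    using assms(3) by (auto simp: ordered_basis_def card_image)
  define B where "B = vec.extend_basis ?A"
  have B: "?A \<subseteq> B" "vec.independent B" "vec.span B = UNIV"
    unfolding B_def using ind
    by (auto simp: vec.extend_basis_superset vec.independent_extend_basis)
  have fB: "finite B"
    using B(2) vec.finiteI_independent by blast
  have "card B = n + 1"
    using B(2,3) vec.dim_eq_card_independent[of B] vec.dim_span[of B] vec_dim_card[where 'a = 'k and 'n = 'v] assms(1)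
    by simp
  then have "card (B - ?A) = 2"
    using B(1) fB cA assms(2) by (simp add: card_Diff_subset)
  then obtain x y where "B - ?A = {x, y}"
    by (auto simp: card_2_iff)
  then have "B = insert y (insert x ?A)"
    using B(1) by auto
  then show ?thesis using that B(3) by auto
qed

text \<open>The determinant is alternating in its free rows, vanishes as soon as one of them lies in
  Q, and is nonzero on the pair \<open>y0\<close>, \<open>x0\<close> completing a basis of Q. All
  properties collected in the locale follow from these three.\<close>

lemma line_duality_two_row:
  fixes L :: "('k::alg_closed_field ^ 'v::{finite,linorder}) set"
  assumes n: "CARD('v) = n + 1" "n \<ge> 1" and L: "L \<in> proj_subspaces 1"
    and \<alpha>: "ordered_basis (n - 1) \<alpha> (perp L)"
  obtains x0 y0 where "line_duality L (perp L) (tau_image \<alpha>) (two_row_vec \<alpha>) x0 y0"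
proof -
  let ?Q = "perp L" let ?sg = "two_row_vec \<alpha>" let ?A = "\<alpha> ` {1..n - 1}"
  have card2: "CARD('v) \<ge> 2" using n by simp
  obtain x0 y0 where sp: "vec.span (insert y0 (insert x0 ?A)) = UNIV"
    using extend_by_two[OF n \<alpha>] .
  have D: "pairing y0 (?sg x0) \<noteq> 0"
    unfolding pairing_two_row_vec[OF card2]
    by (rule two_row_det_nonzero[OF card2]) (use sp n in simp)
  have spA: "vec.span ?A = ?Q"
    using \<alpha> by (simp add: ordered_basis_def)
  have self: "pairing x (?sg x) = 0" for x
    by (simp add: pairing_two_row_vec[OF card2] two_row_det_self[OF card2])
  have anti: "pairing y (?sg x) = - pairing x (?sg y)" for x y
    using self[of "x + y"] by (simp add: two_row_vec_add[OF card2] self add_eq_0_iff2)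
  have Qsg: "pairing q (?sg x) = 0" if "q \<in> ?Q" for q x
  proof -
    have "vec.subspace {q. pairing q (?sg x) = 0}"
      by (rule vec.subspaceI) auto
    moreover have "two_row_det \<alpha> (\<alpha> j) x = 0" if "j \<in> {1..n - 1}" for j
      by (rule two_row_det_basis[OF card2]) (use that n in auto)
    then have "?A \<subseteq> {q. pairing q (?sg x) = 0}"
      by (auto simp: pairing_two_row_vec[OF card2])
    ultimately show ?thesis
      using vec.span_minimal[of ?A] spA that by auto
  qed
  \<comment> \<open>Cramer's rule: both sides have the same pairing with \<open>y0\<close>, with
    \<open>x0\<close> and with the basis of Q, and these vectors span V.\<close>
  have expansion: "pairing y0 (?sg x0) *s w = pairing y0 w *s ?sg x0 - pairing x0 w *s ?sg y0"
    if w: "w \<in> perp ?Q" for w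
  proof -
    let ?z = "pairing y0 (?sg x0) *s w - (pairing y0 w *s ?sg x0 - pairing x0 w *s ?sg y0)"
    have "pairing y ?z = 0" if y: "y \<in> insert y0 (insert x0 ?A)" for y
    proof -
      have "pairing x0 (?sg y0) = - pairing y0 (?sg x0)"
        by (rule anti)
      moreover have "pairing w y = 0" if "y \<in> ?A"
        using w spA vec.span_base[OF that] by (auto simp: perp_def)
      moreover have "pairing (\<alpha> i) (?sg x) = 0" if "i \<in> {1..n - 1}" for i x
        using Qsg spA vec.span_base that by blast
      ultimately show ?thesis
        using y by (auto simp: self pairing_commute[of _ w])
    qed
    then have "?z = 0"
      by (rule pairing_nondegenerate) (use sp in auto)
    then show ?thesis by simp
  qed
  have sgP: "?sg x \<in> perp ?Q" for x
    by (auto simp: perp_def pairing_commute[of "?sg x"] Qsg)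
  have Pspan: "perp ?Q \<subseteq> vec.span {?sg x0, ?sg y0}"
  proof
    fix w assume "w \<in> perp ?Q"
    then have "w = (1 / pairing y0 (?sg x0)) *s (pairing y0 w *s ?sg x0 - pairing x0 w *s ?sg y0)"
      using D by (simp flip: expansion)
    also have "\<dots> \<in> vec.span {?sg x0, ?sg y0}"
      by (intro vec.span_scale vec.span_diff) (auto intro: vec.span_base)
    finally show "w \<in> vec.span {?sg x0, ?sg y0}" .
  qed
  \<comment> \<open>Biduality by dimension: the double annihilator contains the plane L and is
    spanned by two vectors.\<close>
  have "L \<subseteq> perp ?Q"
    by (auto simp: perp_def pairing_commute)
  moreover have "vec.dim (perp ?Q) \<le> vec.dim L"
  proof -
    have "vec.dim (perp ?Q) \<le> card {?sg x0, ?sg y0}"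
      by (rule vec.dim_le_card[OF Pspan]) simp
    also have "\<dots> \<le> 2"
      by (simp add: card_insert_if)
    finally show ?thesis using L by (simp add: proj_subspaces_def)
  qed
  ultimately have PL: "perp ?Q = L"
    using L vec.subspace_dim_equal[of L "perp ?Q"] perp_subspace by (auto simp: proj_subspaces_def)
  have "w \<in> range ?sg" if "w \<in> L" for w
  proof -
    define d where "d = 1 / pairing y0 (?sg x0)"
    have "w = d *s (pairing y0 w *s ?sg x0 - pairing x0 w *s ?sg y0)"
      using D that by (simp add: d_def PL flip: expansion)
    also have "\<dots> = d *s (pairing y0 w *s ?sg x0 + (- pairing x0 w) *s ?sg y0)"
      by simp
    also have "\<dots> = ?sg (d *s (pairing y0 w *s x0 + (- pairing x0 w) *s y0))"
      by (simp only: two_row_vec_add[OF card2] two_row_vec_scale[OF card2])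
    finally show ?thesis by blast
  qed
  then have range: "range ?sg = L"
    using sgP PL by auto
  have ker: "?sg x = 0 \<longleftrightarrow> x \<in> ?Q" for x
  proof
    assume "x \<in> ?Q"
    then have "pairing y (?sg x) = 0" for y
      using anti[of y x] Qsg by simp
    then show "?sg x = 0"
      by (rule pairing_nondegenerate[of UNIV]) simp
  next
    assume x: "?sg x = 0"
    have "x \<in> vec.span (insert y0 (insert x0 ?A))"
      using sp by simp
    \<comment> \<open>Modulo Q the vector x is a combination of \<open>y0\<close> and
      \<open>x0\<close>; pairing its image 0 with \<open>x0\<close> and \<open>y0\<close> isolates
      the two coefficients.\<close>
    then obtain s t where "x - s *s y0 - t *s x0 \<in> ?Q"
      unfolding vec.span_breakdown_eq spA by blast
    moreover define q where "q = x - s *s y0 - t *s x0"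
    ultimately have q: "q \<in> ?Q" and xq: "x = q + (s *s y0 + t *s x0)"
      by (auto simp: algebra_simps)
    have "pairing y (?sg x) = - pairing q (?sg y) + s * pairing y (?sg y0) + t * pairing y (?sg x0)" for y
      by (subst xq) (simp add: two_row_vec_add[OF card2] two_row_vec_scale[OF card2] anti[of y q])
    from this[of x0] this[of y0] have "s * pairing x0 (?sg y0) = 0" "t * pairing y0 (?sg x0) = 0"
      by (simp_all add: x Qsg[OF q] self)
    then have "s = 0" "t = 0"
      using D anti[of x0 y0] by auto
    then show "x \<in> ?Q"
      using q xq by simp
  qed
  have "line_duality L ?Q (tau_image \<alpha>) ?sg x0 y0"
  proof
    show "tau_image \<alpha> i \<in> forms 1" for i
      by (rule linear_function_linform)
        (simp_all add: eval_tau_image two_row_vec_add[OF card2] two_row_vec_scale[OF card2])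
  qed (simp_all add: eval_tau_image two_row_vec_add[OF card2] two_row_vec_scale[OF card2]
      self range ker PL D expansion)
  then show ?thesis by (rule that)
qed

lemma mp_mult_cancel_left: "f * g = f * h \<longleftrightarrow> f = 0 \<or> g = h"
  for f g h :: "('v::linorder, 'k::idom) mp"
  by (rule mult_cancel_left)

lemma mp_mult_eq_0: "f * g = 0 \<longleftrightarrow> f = 0 \<or> g = 0"
  for f g :: "('v::linorder, 'k::idom) mp"
  by (rule mult_eq_0_iff)

lemma linform_eq_0_iff: "linform c = 0 \<longleftrightarrow> c = 0"
proof
  assume "linform c = 0"
  then have "eval (linform c) (axis i 1) = 0" for i
    by simp
  then show "c = 0" by (simp add: vec_eq_iff)
qed (simp add: linform_def)

lemma subspace_kernel_pairing: "vec.subspace {w. pairing c w = 0}"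
  by (rule vec.subspaceI) auto

section \<open>Projective points as spans of vectors\<close>

lemma points_on_span:
  assumes "vec.subspace L" "w \<in> L" "w \<noteq> 0"
  shows "vec.span {w} \<in> points_on L"
proof -
  have "vec.independent {w}"
    using assms(3) by simp
  then have "vec.dim (vec.span {w}) = 1"
    using vec.dim_eq_card_independent[of "{w}"] by simp
  moreover have "vec.span {w} \<subseteq> L"
    using assms by (intro vec.span_minimal) auto
  ultimately show ?thesis
    by (simp add: points_on_def proj_subspaces_def)
qed

lemma proj_point_eq_span:
  assumes "p \<in> proj_subspaces 0"
  obtains w where "w \<noteq> 0" "p = vec.span {w}"
proof -
  obtain B where B: "B \<subseteq> p" "vec.independent B" "p \<subseteq> vec.span B" "card B = vec.dim p"
    using vec.basis_exists by blast
  then obtain w where w: "B = {w}"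
    using assms by (auto simp: proj_subspaces_def card_1_singleton_iff)
  have "vec.span B \<subseteq> p"
    using B(1) assms by (intro vec.span_minimal) (auto simp: proj_subspaces_def)
  then have "p = vec.span {w}"
    using B(3) w by auto
  moreover have "w \<noteq> 0"
    using B(2) w by auto
  ultimately show ?thesis
    using that by blast
qed

lemma points_on_eq_span:
  assumes "p \<in> points_on L"
  obtains w where "w \<noteq> 0" "w \<in> L" "p = vec.span {w}"
proof -
  obtain w where w: "w \<noteq> 0" "p = vec.span {w}"
    using assms proj_point_eq_span by (auto simp: points_on_def)
  moreover have "w \<in> L"
    using w assms vec.span_base[of w "{w}"] by (auto simp: points_on_def)
  ultimately show ?thesis using that by blast
qed

lemma nonvanishing_at_span:
  fixes g :: "('v::finite, 'k::field) mp"
  assumes "g \<in> forms (int e)"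
  shows "nonvanishing_at g (vec.span {w}) \<longleftrightarrow> eval g w \<noteq> 0"
  using assms vec.span_base[of w "{w}"]
  by (auto simp: nonvanishing_at_def vec.span_singleton eval_form_scale)

section \<open>Pullback along \<open>sg\<close> and the kernel of \<open>N\<close>\<close>

context line_duality
begin

text \<open>\<open>N a\<close> is the value of \<open>\<eta>\<^sub>Q\<close> on \<open>\<Sum>\<^sub>i a\<^sub>i \<partial>/\<partial>Y\<^sub>i\<close>.\<close>

definition T :: "('v, 'k) mp \<Rightarrow> ('v, 'k) mp" where
  "T = subst Const lf"

definition N :: "('v \<Rightarrow> ('v, 'k) mp) \<Rightarrow> ('v, 'k) mp" where
  "N a = (\<Sum>i\<in>UNIV. T (a i) * Var i)"

lemma eval_T [simp]: "eval (T f) x = eval f (sg x)"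
  by (simp add: T_def eval_subst eval_lf)

lemma T_simps [simp]: "T 0 = 0" "T 1 = 1" "T (f + g) = T f + T g" "T (f * g) = T f * T g"
  "T (Const c) = Const c" "T (Var i) = lf i" "T (- f) = - T f" "T (f - g) = T f - T g"
  "T (sum F A) = (\<Sum>a\<in>A. T (F a))" "T (prod F A) = (\<Prod>a\<in>A. T (F a))" "T (f ^ m) = T f ^ m"
  by (simp_all add: T_def Const_hom.subst_simps)

lemma sg_in_L [simp]: "sg x \<in> L"
  using range_sg by auto

lemma L_imp_sg: "w \<in> L \<Longrightarrow> \<exists>x. w = sg x"
  using range_sg by auto

lemma subspace_L: "vec.subspace L"
  using perp_subspace[of Q] perp_Q by simp

text \<open>Holds because \<open>sg\<close> maps onto L. It identifies S/I(L) with the image of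
  \<open>T\<close>, so congruences modulo I(L) become equations in R.\<close>

lemma T_eq_0_iff: "T f = 0 \<longleftrightarrow> f \<in> vanishing_ideal L"
proof
  assume "T f = 0"
  then have "eval f (sg x) = 0" for x
    by (metis eval_T eval_simps(1))
  then show "f \<in> vanishing_ideal L"
    using range_sg by (auto simp: vanishing_ideal_iff)
next
  assume "f \<in> vanishing_ideal L"
  then show "T f = 0"
    by (intro eval_eq_0_imp_eq_0) (simp add: vanishing_idealD[OF _ sg_in_L])
qed

lemma T_eq_iff: "T f = T g \<longleftrightarrow> f - g \<in> vanishing_ideal L"
  by (simp flip: T_eq_0_iff)

lemma T_in_forms: "f \<in> forms d \<Longrightarrow> T f \<in> forms d"
  unfolding T_def subst_def
proof (intro forms_sum forms_Const_mult)
  fix t assume f: "f \<in> forms d" and t: "t \<in> Poly_Mapping.keys f"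
  have "(\<Prod>i\<in>UNIV. lf i ^ Poly_Mapping.lookup t i) \<in>
      forms (\<Sum>i\<in>UNIV. int (Poly_Mapping.lookup t i) * 1)"
    by (intro forms_prod forms_power lf_in_forms)
  also have "(\<Sum>i\<in>UNIV. int (Poly_Mapping.lookup t i) * 1) = d"
    using f t by (auto simp: forms_def mdeg_UNIV)
  finally show "(\<Prod>i\<in>UNIV. lf i ^ Poly_Mapping.lookup t i) \<in> forms d" .
qed

lemma hcomp_T: "hcomp d (T f) = T (hcomp d f)"
proof -
  let ?B = "(\<lambda>t. int (mdeg t)) ` Poly_Mapping.keys f"
  have "hcomp d (T f) = (\<Sum>b\<in>?B. hcomp d (T (hcomp b f)))"
    by (subst mp_sum_hcomp[of f]) (simp add: hcomp_sum)
  also have "\<dots> = (\<Sum>b\<in>?B. T (hcomp d (hcomp b f)))"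
    by (intro sum.cong refl) (simp add: hcomp_forms[OF T_in_forms[OF hcomp_in_forms]] hcomp_forms[OF hcomp_in_forms])
  also have "\<dots> = T (hcomp d (\<Sum>b\<in>?B. hcomp b f))"
    by (simp add: hcomp_sum)
  finally show ?thesis
    by (simp flip: mp_sum_hcomp)
qed

lemma N_add: "N (\<lambda>i. a i + b i) = N a + N b"
  by (simp add: N_def distrib_right sum.distrib)

lemma N_minus: "N (\<lambda>i. a i - b i) = N a - N b"
  by (simp add: N_def left_diff_distrib sum_subtractf)

lemma N_scale: "N (\<lambda>i. f * a i) = T f * N a"
  by (simp add: N_def sum_distrib_left mult_ac)

lemma N_sum: "N (\<lambda>i. \<Sum>j\<in>A. a j i) = (\<Sum>j\<in>A. N (a j))"
  by (simp add: N_def sum_distrib_right sum.swap[of _ A])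

lemma N_cong: "(\<And>i. a i - b i \<in> vanishing_ideal L) \<Longrightarrow> N a = N b"
  unfolding N_def T_eq_iff[symmetric] by simp

lemma eval_N: "eval (N a) x = pairing (\<chi> i. eval (a i) (sg x)) x"
  by (simp add: N_def pairing_def)

lemma N_Var: "N Var = 0"
proof (rule eval_eq_0_imp_eq_0)
  fix x
  show "eval (N Var) x = 0"
    using pairing_sg_self[of x] pairing_commute[of x "sg x"] by (simp add: eval_N)
qed

lemma N_in_forms: "(\<And>i. a i \<in> forms d) \<Longrightarrow> N a \<in> forms (d + 1)"
  unfolding N_def by (intro forms_sum forms_mult T_in_forms) auto

text \<open>Polarisation of \<open>pairing_sg_self\<close>. It expands the value at x + y and
  divides by nothing, so characteristic 2 is included.\<close>

lemma pairing_sg_swap: "pairing y (sg x) = - pairing x (sg y)"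
  using pairing_sg_self[of "x + y"] by (simp add: sg_add pairing_sg_self add_eq_0_iff2)

lemma pairing_Q: "q \<in> Q \<Longrightarrow> pairing q (sg x) = 0"
  using pairing_sg_swap[of q x] sg_eq_0_iff[of q] by simp

lemma sg_diff: "sg (x - y) = sg x - sg y"
  using sg_add[of "x - y" y] by (simp add: algebra_simps)

definition D :: 'k where "D = pairing y0 (sg x0)"

lemma D_nz: "D \<noteq> 0" and pairing_x0_y0: "pairing x0 (sg y0) = - D" and pairing_y0_x0: "pairing y0 (sg x0) = D"
  using x0y0 pairing_sg_swap[of x0 y0] by (auto simp: D_def)

lemma L_expansion': "w \<in> L \<Longrightarrow> D *s w = pairing y0 w *s sg x0 - pairing x0 w *s sg y0"
  using L_expansion by (simp add: D_def)

text \<open>The counterpart of \<open>L_expansion'\<close> in V: the remainder is killed by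
  \<open>sg\<close>, hence lies in Q.\<close>

lemma V_expansion:
  obtains q where "q \<in> Q" "D *s x = pairing y0 (sg x) *s x0 - pairing x0 (sg x) *s y0 + q"
proof -
  let ?q = "D *s x - (pairing y0 (sg x) *s x0 - pairing x0 (sg x) *s y0)"
  have "sg ?q = 0"
    using L_expansion'[of "sg x"] by (simp add: sg_diff sg_scale)
  then have "?q \<in> Q" by (simp add: sg_eq_0_iff)
  then show ?thesis by (rule that) simp
qed

lemma sg_add_Q: "q \<in> Q \<Longrightarrow> sg (x + q) = sg x"
  using sg_eq_0_iff[of q] by (simp add: sg_add)

text \<open>L is a plane and c a nonzero functional on it, so its kernel is a line, and it contains
  \<open>sg c\<close>. With A and B the coordinates of \<open>sg c\<close>, the relation
  \<open>rel\<close> says that the coordinates of w are proportional to them.\<close>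

lemma annihilator_sg:
  assumes c: "sg c \<noteq> 0" and w: "w \<in> L" "pairing c w = 0"
  obtains k where "w = k *s sg c"
proof -
  define A where "A = pairing y0 (sg c)"
  define B where "B = pairing x0 (sg c)"
  obtain q where q: "q \<in> Q" "D *s c = A *s x0 - B *s y0 + q"
    unfolding A_def B_def by (rule V_expansion)
  obtain x where x: "w = sg x"
    using L_imp_sg[OF w(1)] ..
  have "pairing (D *s c) w = 0"
    using w by simp
  then have rel: "A * pairing x0 w = B * pairing y0 w"
    unfolding q(2) using pairing_Q[OF q(1), of x] by (simp add: x)
  have Dw: "D *s w = pairing y0 w *s sg x0 - pairing x0 w *s sg y0"
    by (rule L_expansion'[OF w(1)])
  have Dc: "D *s sg c = A *s sg x0 - B *s sg y0"
    using L_expansion'[of "sg c"] by (simp add: A_def B_def)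
  have "A \<noteq> 0 \<or> B \<noteq> 0"
    using c Dc D_nz by auto
  then obtain k where k: "pairing y0 w = k * A" "pairing x0 w = k * B"
  proof
    assume "A \<noteq> 0"
    then show ?thesis
      using that[of "pairing y0 w / A"] rel by (simp add: field_simps)
  next
    assume "B \<noteq> 0"
    then show ?thesis
      using that[of "pairing x0 w / B"] rel by (simp add: field_simps)
  qed
  have "D *s w = D *s (k *s sg c)"
  proof -
    have "D *s w = k *s (A *s sg x0 - B *s sg y0)"
      unfolding Dw k by (simp add: vec_eq_iff algebra_simps)
    also have "\<dots> = k *s (D *s sg c)"
      by (simp only: Dc)
    finally show ?thesis by (simp add: vec_eq_iff mult_ac)
  qed
  then have "w = k *s sg c"
    using D_nz by (simp add: vec_eq_iff)
  then show ?thesis by (rule that)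
qed

lemma exists_pairing_nonzero:
  assumes "sg c \<noteq> 0"
  obtains e where "e \<in> L" "pairing c e \<noteq> 0"
proof -
  obtain i where i: "sg c $ i \<noteq> 0"
    using assms by (auto simp: vec_eq_iff)
  have "pairing c (sg (axis i 1)) = - sg c $ i"
    using pairing_sg_swap[of c "axis i 1"] by simp
  then show ?thesis
    using i that[of "sg (axis i 1)"] by simp
qed

lemma T_linform: "T (linform c) = linform (- sg c)"
proof (rule mp_eqI)
  fix x
  show "eval (T (linform c)) x = eval (linform (- sg c)) x"
    using pairing_sg_swap[of c x] by (simp add: pairing_commute[of "sg c"])
qed

lemma T_linform_nz: "sg c \<noteq> 0 \<Longrightarrow> T (linform c) \<noteq> 0"
  by (simp add: T_linform linform_eq_0_iff del: T_simps)

text \<open>Since \<open>c \<cdot> sg c = 0\<close>, the linear form \<open>linform c\<close> vanishes on \<open>L\<close> exactly at the point \<open>sg c\<close>.\<close>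

lemma L_divide:
  assumes c: "sg c \<noteq> 0" and f: "f \<in> forms d" and z: "eval f (sg c) = 0"
  shows "\<exists>a\<in>forms (d - 1). f - a * linform c \<in> vanishing_ideal L"
proof -
  obtain e where e: "e \<in> L" "pairing c e \<noteq> 0"
    by (rule exists_pairing_nonzero[OF c])
  show ?thesis
  proof (cases "d < 0")
    case True
    then show ?thesis
      using forms_neg[OF True f] by (intro bexI[of _ 0]) (auto simp: vanishing_ideal_iff)
  next
    case False
    show ?thesis
    proof (rule vanishing_ideal_divide_form[OF subspace_L e _ f])
      fix w assume "w \<in> L" "pairing c w = 0"
      then obtain k where "w = k *s sg c"
        by (rule annihilator_sg[OF c])
      then show "eval f w = 0"
        using False z by (simp add: eval_form_scale[OF f])
    qed
  qed
qed

text \<open>On the fibre \<open>sg\<^sup>-\<^sup>1(w) = x + Q\<close> the assumption says that \<open>a(w)\<close> is orthogonal to \<open>Q\<close>, so lies in \<open>L\<close>,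
  and to \<open>x\<close>, so is proportional to \<open>w\<close>; comparing the two coordinates on \<open>L\<close> makes the factor a
  polynomial.\<close>

lemma N_eq_0_imp:
  assumes "N a = 0"
  shows "\<exists>u. \<forall>i. a i - u * Var i \<in> vanishing_ideal L"
proof -
  define av where "av w = (\<chi> i. eval (a i) w)" for w
  define ax where "ax = (\<Sum>i\<in>UNIV. Const (x0 $ i) * a i)"
  define ay where "ay = (\<Sum>i\<in>UNIV. Const (y0 $ i) * a i)"
  have ax: "eval ax w = pairing x0 (av w)" and ay: "eval ay w = pairing y0 (av w)" for w
    by (simp_all add: ax_def ay_def pairing_def av_def)
  have pa: "pairing x (av (sg x)) = 0" for x
    using assms eval_N[of a x] by (simp add: av_def pairing_commute)
  have aQ: "pairing q (av (sg x)) = 0" if "q \<in> Q" for q x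
    using pa[of "x + q"] pa[of x] sg_add_Q[OF that] by simp
  have aL: "av w \<in> L" if "w \<in> L" for w
    using that aQ range_sg perp_Q by (auto simp: perp_def pairing_commute)
  have rel: "pairing y0 w * eval ax w = pairing x0 w * eval ay w" if w: "w \<in> L" for w
  proof -
    obtain x where x: "w = sg x" using L_imp_sg[OF w] ..
    obtain q where q: "q \<in> Q" "D *s x = pairing y0 w *s x0 - pairing x0 w *s y0 + q"
      unfolding x by (rule V_expansion)
    have "pairing (D *s x) (av w) = 0"
      using pa[of x] by (simp add: x)
    then show ?thesis
      unfolding q(2) using aQ[OF q(1), of x] by (simp add: ax ay x)
  qed
  let ?U = "L \<inter> {w. pairing x0 w = 0}"
  have subU: "vec.subspace ?U"
    by (intro vec.subspace_inter subspace_L subspace_kernel_pairing)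
  have "linform y0 * ax \<in> vanishing_ideal ?U"
    using rel by (auto simp: vanishing_ideal_iff)
  moreover have "linform y0 \<notin> vanishing_ideal ?U"
    using vanishing_idealD[of "linform y0" ?U "sg x0"] pairing_y0_x0 D_nz
    by (auto simp: pairing_sg_self)
  ultimately have "ax \<in> vanishing_ideal ?U"
    using vanishing_ideal_prime[OF subU] by blast
  then obtain u where u: "ax - u * linform x0 \<in> vanishing_ideal L"
    using vanishing_ideal_divide[OF subspace_L sg_in_L, of x0 y0 ax] pairing_x0_y0 D_nz
    by (auto simp: vanishing_ideal_iff)
  have ux: "eval ax w = eval u w * pairing x0 w" if "w \<in> L" for w
    using vanishing_idealD[OF u that] by simp
  have "linform x0 * (ay - u * linform y0) \<in> vanishing_ideal L"
    unfolding vanishing_ideal_iff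
  proof
    fix w assume w: "w \<in> L"
    have "eval (linform x0 * (ay - u * linform y0)) w =
      pairing x0 w * eval ay w - pairing y0 w * (eval u w * pairing x0 w)"
      by (simp add: algebra_simps)
    then show "eval (linform x0 * (ay - u * linform y0)) w = 0"
      using rel[OF w] ux[OF w] by (auto simp: mult_ac)
  qed
  moreover have "linform x0 \<notin> vanishing_ideal L"
    using vanishing_idealD[of "linform x0" L "sg y0"] pairing_x0_y0 D_nz by auto
  ultimately have "ay - u * linform y0 \<in> vanishing_ideal L"
    using vanishing_ideal_prime[OF subspace_L] by blast
  then have uy: "eval ay w = eval u w * pairing y0 w" if "w \<in> L" for w
    using vanishing_idealD[of "ay - u * linform y0" L w] that by simp
  have "D *s av w = D *s (eval u w *s w)" if w: "w \<in> L" for w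
  proof -
    have "D *s av w = pairing y0 (av w) *s sg x0 - pairing x0 (av w) *s sg y0"
      by (rule L_expansion'[OF aL[OF w]])
    also have "\<dots> = eval u w *s (pairing y0 w *s sg x0 - pairing x0 w *s sg y0)"
      using ux[OF w] uy[OF w] by (simp add: ax ay vec_eq_iff algebra_simps)
    also have "\<dots> = eval u w *s (D *s w)"
      by (simp add: L_expansion'[OF w])
    finally show ?thesis by (simp add: vec_eq_iff mult_ac)
  qed
  then have "av w = eval u w *s w" if "w \<in> L" for w
    using that D_nz by (simp add: vec_eq_iff)
  then have "eval (a i - u * Var i) w = 0" if "w \<in> L" for w i
    using that by (simp add: av_def vec_eq_iff)
  then show ?thesis
    unfolding vanishing_ideal_iff by blast
qed

lemma N_eq_iff: "N a = N b \<longleftrightarrow> (\<exists>u. \<forall>i. a i - (b i + u * Var i) \<in> vanishing_ideal L)"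
proof
  assume "N a = N b"
  then have "N (\<lambda>i. a i - b i) = 0"
    by (simp add: N_minus)
  then show "\<exists>u. \<forall>i. a i - (b i + u * Var i) \<in> vanishing_ideal L"
    using N_eq_0_imp[of "\<lambda>i. a i - b i"] by (simp add: diff_diff_eq)
next
  assume "\<exists>u. \<forall>i. a i - (b i + u * Var i) \<in> vanishing_ideal L"
  then obtain u where u: "\<And>i. a i - (b i + u * Var i) \<in> vanishing_ideal L" by blast
  have "N a = N (\<lambda>i. b i + u * Var i)"
    by (rule N_cong) (rule u)
  then show "N a = N b"
    by (simp add: N_add N_scale N_Var)
qed

section \<open>Gluing fractions along L\<close>

text \<open>Supplies the induction step of both gluing lemmas. A zero of g on L is written as
  \<open>sg c\<close>, so that the linear form splitting off is that of c.\<close>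

lemma factor_form_on_L:
  assumes g: "g \<in> forms (int (Suc e))"
  obtains c g1 where "sg c \<noteq> 0" "eval g (sg c) = 0" "g1 \<in> forms (int e)" "T g = T g1 * T (linform c)"
proof -
  obtain a b where ab: "a \<noteq> 0 \<or> b \<noteq> 0" "eval g (a *s sg x0 + b *s sg y0) = 0"
    using form_root_on_span[OF g zero_less_Suc] by blast
  define c where "c = a *s x0 + b *s y0"
  have sgc: "sg c = a *s sg x0 + b *s sg y0"
    by (simp add: c_def sg_add sg_scale)
  have "pairing y0 (sg c) = a * D" "pairing x0 (sg c) = - (b * D)"
    by (simp_all add: sgc pairing_y0_x0 pairing_x0_y0 pairing_sg_self)
  then have c: "sg c \<noteq> 0"
    using ab D_nz by auto
  moreover have z: "eval g (sg c) = 0"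
    using ab sgc by simp
  moreover obtain g1 where "g1 \<in> forms (int e)" "g - g1 * linform c \<in> vanishing_ideal L"
    using L_divide[OF c g z] by auto
  then have "g1 \<in> forms (int e)" "T g = T g1 * T (linform c)"
    using T_eq_iff[of g "g1 * linform c"] by simp_all
  ultimately show ?thesis by (rule that)
qed

text \<open>Let \<open>sg c\<close> be a zero of g. Some \<open>g'\<close> does not vanish there, so
  \<open>T g'\<close> does not vanish identically on the hyperplane of \<open>T (linform c)\<close>,
  which contains c. The ideal of this hyperplane is prime, hence the numerator n is divisible by
  \<open>T (linform c)\<close>. The factor cancels from g and n, and the degree of g drops.\<close>

lemma glue:
  assumes "g \<in> forms (int e)" "T g \<noteq> 0"
    and "\<And>p. p \<in> points_on L \<Longrightarrow> \<exists>g' n'. nonvanishing_at g' p \<and> T g * n' = T g' * n"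
  shows "\<exists>F. n = T g * F"
  using assms
proof (induction e arbitrary: g n)
  case 0
  then obtain k where k: "g = Const k"
    using forms_0 by auto
  then have "k \<noteq> 0" using 0 by auto
  then have "n = T g * (Const (1 / k) * n)"
    by (simp add: k flip: mult.assoc Const_mult)
  then show ?case by blast
next
  case (Suc e)
  obtain c g1 where c: "sg c \<noteq> 0" and g1: "g1 \<in> forms (int e)" and Tg: "T g = T g1 * T (linform c)"
    using factor_form_on_L[OF Suc.prems(1)] by metis
  have l: "T (linform c) \<noteq> 0" using c by (rule T_linform_nz)
  obtain g' n' where g': "nonvanishing_at g' (vec.span {sg c})" and eq: "T g * n' = T g' * n"
    using Suc.prems(3) points_on_span[OF subspace_L sg_in_L c] by blast
  let ?U = "{x. pairing (- sg c) x = 0}"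
  have "T g' * n \<in> vanishing_ideal ?U"
    unfolding eq[symmetric] Tg T_linform vanishing_ideal_iff by simp
  moreover have "T g' \<notin> vanishing_ideal ?U"
  proof -
    obtain k where "eval g' (k *s sg c) \<noteq> 0"
      using g' by (auto simp: nonvanishing_at_def vec.span_singleton)
    then have "eval (T g') (k *s c) \<noteq> 0"
      by (simp add: sg_scale)
    moreover have "k *s c \<in> ?U"
      using pairing_sg_self[of c] by (simp add: pairing_commute[of "sg c"])
    ultimately show ?thesis
      unfolding vanishing_ideal_iff by blast
  qed
  ultimately have "n \<in> vanishing_ideal ?U"
    using vanishing_ideal_prime[OF subspace_kernel_pairing] by blast
  then obtain n1 where "n = n1 * linform (- sg c)"
    using linform_dvd_if_vanishing[of "- sg c" n] c by (auto simp: vanishing_ideal_iff)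
  then have n1: "n = n1 * T (linform c)"
    by (simp only: T_linform)
  have "\<exists>F. n1 = T g1 * F"
  proof (rule Suc.IH[OF g1])
    show "T g1 \<noteq> 0" using Suc.prems(2) Tg by auto
    fix p assume "p \<in> points_on L"
    then obtain g' n' where *: "nonvanishing_at g' p" "T g * n' = T g' * n"
      using Suc.prems(3) by blast
    have "T (linform c) * (T g1 * n') = T (linform c) * (T g' * n1)"
      using *(2) unfolding Tg n1 by (simp only: mult_ac)
    then have "T g1 * n' = T g' * n1"
      using l by (simp only: mp_mult_cancel_left) simp
    with *(1) show "\<exists>g' n'. nonvanishing_at g' p \<and> T g1 * n' = T g' * n1" by blast
  qed
  then obtain F where "n1 = T g1 * F" ..
  then have "n = T g * F"
    unfolding n1 Tg by (simp only: mult_ac)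
  then show ?case ..
qed

text \<open>At a zero \<open>w\<close> of \<open>g\<close> on \<open>L\<close> the vector \<open>a(w)\<close> is proportional to \<open>w\<close>; subtracting a multiple of the
  Euler derivation, which needs \<open>m \<ge> 0\<close>, makes \<open>a\<close> divisible by the linear form of \<open>w\<close>.\<close>

lemma glue_form:
  assumes "g \<in> forms (int e)" "T g \<noteq> 0" "T g * F = N a" "\<And>i. a i \<in> forms (m + int e)" "m \<ge> 0"
  shows "\<exists>f. (\<forall>i. f i \<in> forms m) \<and> F = N f"
  using assms
proof (induction e arbitrary: g a)
  case 0
  then obtain k where k: "g = Const k"
    using forms_0 by auto
  then have "k \<noteq> 0" using 0 by auto
  have "F = Const (1 / k) * (T g * F)"
    using \<open>k \<noteq> 0\<close> by (simp add: k flip: mult.assoc Const_mult)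
  also have "\<dots> = N (\<lambda>i. Const (1 / k) * a i)"
    by (simp add: 0 N_scale)
  finally show ?case
    using 0 by (intro exI[of _ "\<lambda>i. Const (1 / k) * a i"]) (auto intro: forms_Const_mult)
next
  case (Suc e)
  obtain c g1 where c: "sg c \<noteq> 0" and gc: "eval g (sg c) = 0"
    and g1: "g1 \<in> forms (int e)" and Tg: "T g = T g1 * T (linform c)"
    using factor_form_on_L[OF Suc.prems(1)] by metis
  have l: "T (linform c) \<noteq> 0" using c by (rule T_linform_nz)
  define av where "av = (\<chi> i. eval (a i) (sg c))"
  \<comment> \<open>\<open>sg\<close> is constant on c + Q, so \<open>T g\<close>, and
    \<open>N a\<close> with it, vanishes on this whole fibre. The case q = 0 then shows that
    \<open>av\<close> is orthogonal to Q.\<close>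
  have av: "pairing (c + q) av = 0" if "q \<in> Q" for q
  proof -
    have "eval (T g * F) (c + q) = 0"
      using gc by (simp add: sg_add_Q[OF that])
    then show ?thesis
      unfolding Suc.prems(3) eval_N sg_add_Q[OF that] av_def by (simp only: pairing_commute)
  qed
  have "0 \<in> Q"
    using sg_scale[of 0 0] by (simp flip: sg_eq_0_iff)
  then have "pairing c av = 0"
    using av[of 0] by simp
  moreover from this av have "av \<in> L"
    unfolding perp_Q[symmetric] by (auto simp: perp_def pairing_commute[of av])
  ultimately obtain k where k: "av = k *s sg c"
    using annihilator_sg[OF c] by metis
  obtain i0 where i0: "sg c $ i0 \<noteq> 0"
    using c by (auto simp: vec_eq_iff)
  define r where "r = nat (m + int e)"
  \<comment> \<open>A form with value k at \<open>sg c\<close>: a rescaled power of a coordinate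
    that does not vanish there. Its degree m + e has to be nonnegative, which fails for m = -1 and e
    = 0.\<close>
  define u where "u = Const (k / (sg c $ i0) ^ r) * Var i0 ^ r"
  have "u \<in> forms (int r * 1)"
    unfolding u_def by (intro forms_Const_mult forms_power) simp
  then have u: "u \<in> forms (m + int e)"
    using Suc.prems(5) by (simp add: r_def)
  have uk: "eval u (sg c) = k"
    using i0 by (simp add: u_def)
  have "\<exists>b\<in>forms (m + int e). (a i - u * Var i) - b * linform c \<in> vanishing_ideal L" for i
  proof -
    have "a i - u * Var i \<in> forms (m + int (Suc e))"
      using Suc.prems(4)[of i] forms_mult[OF u Var_in_forms[of i]]
      by (intro forms_minus) (simp_all add: algebra_simps)
    moreover have "eval (a i - u * Var i) (sg c) = 0"
      using arg_cong[OF k, of "\<lambda>v. v $ i"] uk by (simp add: av_def)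
    ultimately show ?thesis
      using L_divide[OF c, of "a i - u * Var i" "m + int (Suc e)"] by (simp add: algebra_simps)
  qed
  then obtain b where b: "\<And>i. b i \<in> forms (m + int e)"
    "\<And>i. (a i - u * Var i) - b i * linform c \<in> vanishing_ideal L"
    by metis
  have "N a = N (\<lambda>i. a i - u * Var i)"
    by (simp add: N_minus N_scale N_Var)
  also have "\<dots> = N (\<lambda>i. linform c * b i)"
    using b(2) by (intro N_cong) (simp add: mult.commute)
  also have "\<dots> = T (linform c) * N b"
    by (rule N_scale)
  finally have "T (linform c) * (T g1 * F) = T (linform c) * N b"
    unfolding Suc.prems(3)[symmetric] Tg by (simp only: mult_ac)
  then have "T g1 * F = N b"
    using l by (simp only: mp_mult_cancel_left) simp
  moreover have "T g1 \<noteq> 0"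
    using Suc.prems(2) Tg by auto
  ultimately show ?case
    using Suc.IH[of g1 b] g1 b(1) Suc.prems(5) by blast
qed

end

section \<open>Powers of the ideal of \<open>Q\<close>\<close>

lemma mp_ring_simps [simp]:
  "carrier mp_ring = UNIV" "monoid.mult mp_ring = (*)" "one mp_ring = 1"
  "zero mp_ring = 0" "add mp_ring = (+)"
  by (simp_all add: mp_ring_def)

lemma ideal_power_nonpos [simp]: "d \<le> 0 \<Longrightarrow> ideal_power I d = UNIV"
  by (simp add: ideal_power_def)

lemma ideal_power_Suc: "ideal_power I (int (Suc m)) = ideal_prod mp_ring I (ideal_power I (int m))"
  unfolding ideal_power_def nat_int by simp

lemma ideal_power_mult: "x \<in> ideal_power I (int m) \<Longrightarrow> x * r \<in> ideal_power I (int m)"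
proof (induction m arbitrary: x)
  case (Suc m)
  from Suc.prems show ?case
    unfolding ideal_power_Suc
  proof (induction x rule: ideal_prod.induct)
    case (prod i j)
    then show ?case
      using ideal_prod.prod[of i I "j * r" "ideal_power I (int m)" mp_ring] Suc.IH[of j]
      by (simp add: mult_ac)
  next
    case (sum s1 s2)
    then show ?case
      using ideal_prod.sum[of "s1 * r" mp_ring I "ideal_power I (int m)" "s2 * r"]
      by (simp add: distrib_right)
  qed
qed simp

lemma ideal_power_add:
  "x \<in> ideal_power I (int m) \<Longrightarrow> y \<in> ideal_power I (int m) \<Longrightarrow> x + y \<in> ideal_power I (int m)"
proof (cases m)
  case (Suc m')
  assume "x \<in> ideal_power I (int m)" "y \<in> ideal_power I (int m)"
  then show ?thesis
    unfolding Suc ideal_power_Suc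
    using ideal_prod.sum[of x mp_ring I "ideal_power I (int m')" y] by simp
qed simp

lemma ideal_power_sum:
  assumes "0 \<in> I" "\<And>a. a \<in> A \<Longrightarrow> F a \<in> ideal_power I (int m)"
  shows "sum F A \<in> ideal_power I (int m)"
proof -
  have "0 \<in> ideal_power I (int m)"
  proof (induction m)
    case (Suc m)
    then show ?case
      using ideal_prod.prod[OF assms(1) Suc, of mp_ring] by (simp add: ideal_power_Suc del: of_nat_Suc)
  qed simp
  then show ?thesis
    using assms(2) by (induction A rule: infinite_finite_induct) (auto intro: ideal_power_add)
qed

context line_duality
begin

lemma lf_vanishes_on_Q: "lf i \<in> vanishing_ideal Q"
  by (simp add: vanishing_ideal_iff eval_lf sg_eq_0_iff[THEN iffD2])

text \<open>Every variable is sent to a linear form in I(Q); one variable is split off per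
  degree.\<close>

lemma T_in_ideal_power:
  assumes "f \<in> forms (int m)"
  shows "T f \<in> ideal_power (vanishing_ideal Q) (int m)"
  using assms
proof (induction m arbitrary: f)
  case (Suc m)
  have "T (Poly_Mapping.single t a) \<in> ideal_power (vanishing_ideal Q) (int (Suc m))"
    if t: "t \<in> Poly_Mapping.keys f" for t a
  proof -
    have m: "mdeg t = Suc m"
      using Suc.prems t by (auto simp: forms_def)
    then obtain i where i: "Poly_Mapping.lookup t i \<noteq> 0"
      by (metis mdeg_UNIV nat.simps(3) sum.neutral)
    define s where "s = t - Poly_Mapping.single i 1"
    have ts: "t = Poly_Mapping.single i 1 + s"
      unfolding s_def using i
      by (intro poly_mapping_eqI) (auto simp: lookup_add lookup_minus lookup_single when_def)
    then have "mdeg s = m"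
      using m by (simp add: mdeg_add)
    then have "T (Poly_Mapping.single s a) \<in> ideal_power (vanishing_ideal Q) (int m)"
      by (intro Suc.IH) (auto simp: forms_def)
    moreover have "Poly_Mapping.single t a = Var i * Poly_Mapping.single s a"
      by (simp add: ts Var_def mult_single)
    ultimately show ?thesis
      using ideal_prod.prod[OF lf_vanishes_on_Q, of _ _ mp_ring i] by (simp add: ideal_power_Suc del: of_nat_Suc)
  qed
  then show ?case
    by (subst mp_sum_singles[of f]) (simp add: ideal_power_sum vanishing_ideal_iff del: of_nat_Suc)
qed simp

lemma N_in_ideal_power:
  assumes "\<And>i. f i \<in> forms d"
  shows "N f \<in> ideal_power (vanishing_ideal Q) d"
proof (cases "d \<le> 0")
  case False
  then obtain m where d: "d = int m"
    by (metis nle_le zero_le_imp_eq_int)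
  show ?thesis
    unfolding d N_def using assms unfolding d
    by (intro ideal_power_sum ideal_power_mult T_in_ideal_power) (auto simp: vanishing_ideal_iff)
qed simp

text \<open>I(Q)^m through the two generators of I(Q) given by \<open>y0\<close> and
  \<open>x0\<close>. It provides cofactors to recurse on, which the inductively generated
  \<open>ideal_prod\<close> does not offer directly.\<close>

primrec Q_power :: "nat \<Rightarrow> ('v, 'k) mp set" where
  "Q_power 0 = UNIV"
| "Q_power (Suc m) = {T (linform y0) * x + T (linform x0) * y |x y. x \<in> Q_power m \<and> y \<in> Q_power m}"

lemma Q_power_add: "a \<in> Q_power m \<Longrightarrow> b \<in> Q_power m \<Longrightarrow> a + b \<in> Q_power m"
proof (induction m arbitrary: a b)
  case (Suc m)
  then obtain x y x' y' where "a = T (linform y0) * x + T (linform x0) * y" "x \<in> Q_power m" "y \<in> Q_power m"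
    "b = T (linform y0) * x' + T (linform x0) * y'" "x' \<in> Q_power m" "y' \<in> Q_power m" by auto
  moreover from this have "a + b = T (linform y0) * (x + x') + T (linform x0) * (y + y')"
    by (simp add: algebra_simps)
  ultimately show ?case
    using Suc.IH by auto
qed simp

lemma Q_power_mult: "a \<in> Q_power m \<Longrightarrow> r * a \<in> Q_power m"
proof (induction m arbitrary: a)
  case (Suc m)
  then obtain x y where "a = T (linform y0) * x + T (linform x0) * y" "x \<in> Q_power m" "y \<in> Q_power m" by auto
  moreover from this have "r * a = T (linform y0) * (r * x) + T (linform x0) * (r * y)"
    by (simp add: algebra_simps)
  ultimately show ?case
    using Suc.IH by auto
qed simp

text \<open>Q is cut out by the linear forms of \<open>- sg x0\<close> and \<open>- sg y0\<close>.
  Dividing by the second one on the hyperplane of the first leaves a remainder divisible by the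
  first.\<close>

lemma vanishing_on_Q_generators:
  assumes "f \<in> vanishing_ideal Q"
  shows "\<exists>a b. f = T (linform y0) * a + T (linform x0) * b"
proof -
  let ?U = "{x. pairing (- sg x0) x = 0}"
  have sub: "vec.subspace ?U" by (rule subspace_kernel_pairing)
  have nz: "sg x0 \<noteq> 0"
    using pairing_y0_x0 D_nz by auto
  have "eval f x = 0" if x: "x \<in> ?U" "pairing (- sg y0) x = 0" for x
  proof -
    have "pairing x0 (sg x) = 0" "pairing y0 (sg x) = 0"
      using x pairing_sg_swap[of x0 x] pairing_sg_swap[of y0 x] by (simp_all add: pairing_commute)
    then have "D *s sg x = 0"
      using L_expansion'[of "sg x"] by simp
    then have "sg x = 0"
      using D_nz by (simp add: vec_eq_iff)
    then show ?thesis
      using assms by (auto simp: vanishing_ideal_iff sg_eq_0_iff)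
  qed
  moreover have "x0 \<in> ?U" "pairing (- sg y0) x0 \<noteq> 0"
    using pairing_sg_self[of x0] pairing_x0_y0 D_nz by (simp_all add: pairing_commute)
  ultimately obtain a where "f - a * linform (- sg y0) \<in> vanishing_ideal ?U"
    using vanishing_ideal_divide[OF sub, of x0 "- sg y0" f] by blast
  then obtain b where "f - a * linform (- sg y0) = b * linform (- sg x0)"
    using linform_dvd_if_vanishing[of "- sg x0" "f - a * linform (- sg y0)"] nz
    by (auto simp: vanishing_ideal_iff)
  then have "f = T (linform y0) * a + T (linform x0) * b"
    unfolding T_linform by (simp add: algebra_simps)
  then show ?thesis by blast
qed

lemma ideal_power_subset_Q_power: "x \<in> ideal_power (vanishing_ideal Q) (int m) \<Longrightarrow> x \<in> Q_power m"
proof (induction m arbitrary: x)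
  case (Suc m)
  from Suc.prems show ?case
    unfolding ideal_power_Suc
  proof (induction x rule: ideal_prod.induct)
    case (prod i j)
    then obtain a b where "i = T (linform y0) * a + T (linform x0) * b"
      using vanishing_on_Q_generators by blast
    then have "i * j = T (linform y0) * (a * j) + T (linform x0) * (b * j)"
      by (simp add: algebra_simps)
    then show ?case
      using Q_power_mult[OF Suc.IH[OF prod(2)]] by auto
  next
    case (sum s1 s2)
    then show ?case using Q_power_add[of s1 "Suc m" s2] by simp
  qed
qed simp

text \<open>A linear form is \<open>N\<close> of its constant coefficients, and multiplying by a
  generator \<open>T (linform y0)\<close> multiplies the tuple by \<open>linform y0\<close>. Taking
  the component of F spares the choice of homogeneous cofactors.\<close>

lemma hcomp_Q_power: "F \<in> Q_power m \<Longrightarrow> \<exists>f. (\<forall>i. f i \<in> forms (int m)) \<and> hcomp (int m + 1) F = N f"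
proof (induction m arbitrary: F)
  case 0
  obtain c where "hcomp 1 F = linform c"
    using forms_1[OF hcomp_in_forms] by blast
  then have "hcomp 1 F = N (\<lambda>i. Const (c $ i))"
    by (simp add: N_def linform_def)
  then show ?case
    by (intro exI[of _ "\<lambda>i. Const (c $ i)"]) simp
next
  case (Suc m)
  then obtain x y where F: "F = T (linform y0) * x + T (linform x0) * y" and xy: "x \<in> Q_power m" "y \<in> Q_power m"
    by auto
  from xy obtain f g where f: "\<And>i. f i \<in> forms (int m)" "hcomp (int m + 1) x = N f"
    and g: "\<And>i. g i \<in> forms (int m)" "hcomp (int m + 1) y = N g"
    using Suc.IH by meson
  have "hcomp (int (Suc m) + 1) F = T (linform y0) * N f + T (linform x0) * N g"
    unfolding F hcomp_add hcomp_mult[OF T_in_forms[OF linform_in_forms]]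
    using f(2) g(2) by (simp add: add.commute)
  also have "\<dots> = N (\<lambda>i. linform y0 * f i + linform x0 * g i)"
    by (simp only: N_add N_scale)
  finally have "hcomp (int (Suc m) + 1) F = N (\<lambda>i. linform y0 * f i + linform x0 * g i)" .
  moreover have "linform y0 * f i + linform x0 * g i \<in> forms (int (Suc m))" for i
    using forms_add[OF forms_mult[OF linform_in_forms[of y0] f(1)[of i]]
        forms_mult[OF linform_in_forms[of x0] g(1)[of i]]]
    by (simp add: add.commute)
  ultimately show ?case
    by (intro exI[of _ "\<lambda>i. linform y0 * f i + linform x0 * g i"] conjI allI)
qed

lemma ideal_power_forms_eq_N:
  assumes "F \<in> ideal_power (vanishing_ideal Q) d" "F \<in> forms (d + 1)" "d \<ge> 0"
  shows "\<exists>f. (\<forall>i. f i \<in> forms d) \<and> F = N f"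
proof -
  obtain m where d: "d = int m"
    using assms(3) zero_le_imp_eq_int by blast
  show ?thesis
    using hcomp_Q_power[OF ideal_power_subset_Q_power, of F m] assms hcomp_forms[OF assms(2), of "d + 1"]
    unfolding d by simp
qed

end

section \<open>Local structure of the logarithmic derivations along a general line\<close>

text \<open>The value on the linear form of c of the derivation with components a, stated for tuples
  that need not be logarithmic.\<close>

definition contract :: "'k ^ 'v \<Rightarrow> ('v \<Rightarrow> ('v, 'k) mp) \<Rightarrow> ('v::finite, 'k::comm_ring_1) mp" where
  "contract c a = (\<Sum>i\<in>UNIV. a i * Const (c $ i))"

lemma eval_contract [simp]: "eval (contract c a) w = pairing c (\<chi> i. eval (a i) w)"
  by (simp add: contract_def pairing_def mult.commute)

lemma contract_in_forms: "(\<And>i. a i \<in> forms d) \<Longrightarrow> contract c a \<in> forms d"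
  unfolding contract_def mult.commute[of _ "Const _"] by (intro forms_sum forms_Const_mult)

lemma derivations_linform_contract:
  "\<theta> \<in> derivations \<Longrightarrow> \<theta> (linform c) = contract c (\<lambda>i. \<theta> (Var i))"
  by (simp add: derivations_linform contract_def)

text \<open>C holds normal vectors of the hyperplanes. \<open>sg_C\<close> says that none of these
  contains L, \<open>general\<close> that no two of them meet on L.\<close>

locale general_line = line_duality L Q lf sg x0 y0
  for L Q :: "('k::alg_closed_field ^ 'v::{finite,linorder}) set" and lf sg x0 y0 +
  fixes C :: "('k, 'v) vec set"
  assumes finite_C: "finite C" and zero_notin_C: "0 \<notin> C"
    and sg_C: "c \<in> C \<Longrightarrow> sg c \<noteq> 0"
    and general: "c \<in> C \<Longrightarrow> c' \<in> C \<Longrightarrow> c \<noteq> c' \<Longrightarrow> w \<in> L \<Longrightarrow> pairing c w = 0 \<Longrightarrow>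
      pairing c' w = 0 \<Longrightarrow> w = 0"
begin

definition arr :: "('k, 'v) vec set set" where
  "arr = {{w. pairing c w = 0} |c. c \<in> C}"

text \<open>The ideal of a hyperplane is generated by its linear form, and the Leibniz rule reduces
  tangency to this generator.\<close>

lemma log_der_iff:
  "\<theta> \<in> log_der arr \<longleftrightarrow> \<theta> \<in> derivations \<and>
    (\<forall>c\<in>C. \<forall>w. pairing c w = 0 \<longrightarrow> eval (contract c (\<lambda>i. \<theta> (Var i))) w = 0)"
  (is "?l \<longleftrightarrow> ?d \<and> ?r")
proof
  assume l: ?l
  then have d: ?d by (simp add: log_der_def)
  have "eval (contract c (\<lambda>i. \<theta> (Var i))) w = 0" if "c \<in> C" "pairing c w = 0" for c w
  proof -
    have "linform c \<in> vanishing_ideal {w. pairing c w = 0}"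
      by (simp add: vanishing_ideal_iff)
    then have "\<theta> (linform c) \<in> vanishing_ideal {w. pairing c w = 0}"
      using l that(1) by (auto simp: log_der_def arr_def)
    then show ?thesis
      using that(2) derivations_linform_contract[OF d, of c] by (auto simp: vanishing_ideal_iff)
  qed
  with d show "?d \<and> ?r" by blast
next
  assume "?d \<and> ?r"
  then have d: ?d and r: ?r by auto
  have "\<theta> f \<in> vanishing_ideal {w. pairing c w = 0}"
    if c: "c \<in> C" and f: "f \<in> vanishing_ideal {w. pairing c w = 0}" for c f
  proof -
    have "c \<noteq> 0" using c zero_notin_C by auto
    then obtain a where "f = a * linform c"
      using linform_dvd_if_vanishing[of c f] f by (auto simp: vanishing_ideal_iff)
    then have "\<theta> f = a * \<theta> (linform c) + linform c * \<theta> a"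
      using d by (auto simp: derivations_def)
    then show ?thesis
      using r c by (auto simp: vanishing_ideal_iff derivations_linform_contract[OF d])
  qed
  then show ?l
    using d by (auto simp: log_der_def arr_def)
qed

lemma der_log_der_iff:
  "der a \<in> log_der arr \<longleftrightarrow> (\<forall>c\<in>C. \<forall>w. pairing c w = 0 \<longrightarrow> eval (contract c a) w = 0)"
  by (simp add: log_der_iff der_in_derivations)

lemma log_der_deg_iff:
  "\<theta> \<in> log_der_deg arr d \<longleftrightarrow> \<theta> \<in> log_der arr \<and> (\<forall>i. \<theta> (Var i) \<in> forms d)"
proof -
  have "\<theta> l \<in> forms d" if "\<theta> \<in> derivations" "\<forall>i. \<theta> (Var i) \<in> forms d" "l \<in> forms 1" for l
    using forms_1[OF that(3)] that by (auto simp: derivations_linform_contract contract_in_forms)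
  then show ?thesis
    by (auto simp: log_der_deg_def log_der_def)
qed

lemma log_derD: "\<theta> \<in> log_der arr \<Longrightarrow> \<theta> \<in> derivations"
  by (simp add: log_der_def)

abbreviation NN :: "(('v, 'k) mp \<Rightarrow> ('v, 'k) mp) \<Rightarrow> ('v, 'k) mp" where
  "NN \<theta> \<equiv> N (\<lambda>i. \<theta> (Var i))"

lemma restriction_relations_NN:
  assumes "\<rho> \<in> restriction_relations arr L"
  shows "NN \<rho> = 0"
proof -
  obtain u m a \<delta> where \<rho>: "\<rho> = (\<lambda>f. u * euler f + (\<Sum>j<m::nat. a j * \<delta> j f))"
    and a: "\<And>j. j < m \<Longrightarrow> a j \<in> vanishing_ideal L"
    using assms by (auto simp: restriction_relations_def)
  have "NN \<rho> = (\<Sum>j<m. T (a j) * NN (\<delta> j))"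
    by (simp add: \<rho> N_add N_scale N_Var N_sum)
  also have "\<dots> = 0"
    using a by (intro sum.neutral) (simp add: T_eq_0_iff[THEN iffD2] del: T_simps)
  finally show ?thesis .
qed

lemma restriction_relationsI:
  assumes "\<And>i. b i \<in> vanishing_ideal L" "\<And>i::'v. \<delta> i \<in> log_der arr"
    "\<And>f. \<rho> f = u * euler f + (\<Sum>i\<in>UNIV. b i * \<delta> i f)"
  shows "\<rho> \<in> restriction_relations arr L"
proof -
  obtain h where h: "bij_betw h {0..<CARD('v)} (UNIV :: 'v set)"
    using ex_bij_betw_nat_finite[of "UNIV :: 'v set"] by auto
  have "(\<Sum>i\<in>UNIV. b i * \<delta> i f) = (\<Sum>j<CARD('v). b (h j) * \<delta> (h j) f)" for f
    using sum.reindex_bij_betw[OF h, of "\<lambda>i. b i * \<delta> i f"] by (simp add: atLeast0LessThan)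
  then have "\<rho> = (\<lambda>f. u * euler f + (\<Sum>j<CARD('v). b (h j) * \<delta> (h j) f))"
    by (intro ext) (simp only: assms(3))
  then show ?thesis
    unfolding restriction_relations_def mem_Collect_eq
    by (intro exI[of _ u] exI[of _ "CARD('v)"] exI[of _ "\<lambda>j. b (h j)"] exI[of _ "\<lambda>j. \<delta> (h j)"])
      (use assms in auto)
qed

text \<open>h is the product of the equations of the hyperplanes that miss w. It makes tangency to
  them automatic and is invertible at w.\<close>

lemma general_point:
  assumes "w \<in> L" "w \<noteq> 0"
  obtains e h where "h \<in> forms (int e)" "eval h w \<noteq> 0"
    "\<And>c v. c \<in> C \<Longrightarrow> pairing c w \<noteq> 0 \<Longrightarrow> pairing c v = 0 \<Longrightarrow> eval h v = 0"
proof -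
  let ?B = "{c \<in> C. pairing c w \<noteq> 0}"
  let ?h = "\<Prod>c\<in>?B. linform c"
  have fin: "finite ?B" using finite_C by simp
  have "?h \<in> forms (\<Sum>c\<in>?B. 1)"
    by (rule forms_prod) simp
  then have "?h \<in> forms (int (card ?B))" by simp
  moreover have "eval ?h w \<noteq> 0"
    using fin by (simp add: prod_zero_iff)
  moreover have "eval ?h v = 0" if "c \<in> C" "pairing c w \<noteq> 0" "pairing c v = 0" for c v
    using fin that by (auto simp: prod_zero_iff)
  ultimately show ?thesis by (rule that) auto
qed

lemma linform_notin:
  assumes "c \<in> C"
  shows "linform c \<notin> vanishing_ideal L"
proof -
  obtain e where "e \<in> L" "pairing c e \<noteq> 0"
    by (rule exists_pairing_nonzero[OF sg_C[OF assms]])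
  then show ?thesis
    using vanishing_idealD[of "linform c" L e] by auto
qed

end

context general_line
begin

text \<open>At a point of \<open>L\<close> on the single hyperplane \<open>H\<close> of \<open>c\<close> with \<open>c\<^sub>k \<noteq> 0\<close>, a basis of \<open>D(\<A>)\<close> is given by
  \<open>\<ell>\<^sub>c \<partial>\<^sub>k\<close> and \<open>\<partial>\<^sub>i - (c\<^sub>i/c\<^sub>k) \<partial>\<^sub>k\<close> for \<open>i \<noteq> k\<close>; the form \<open>h\<close> absorbs the other hyperplanes.\<close>

lemma local_injective:
  assumes \<theta>: "\<theta> \<in> log_der arr" and N0: "NN \<theta> = 0" and p: "p \<in> points_on L"
  shows "\<exists>e h. h \<in> forms (int e) \<and> nonvanishing_at h p \<and> (\<lambda>f. h * \<theta> f) \<in> restriction_relations arr L"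
proof -
  obtain w where w: "w \<noteq> 0" "w \<in> L" "p = vec.span {w}"
    using points_on_eq_span[OF p] .
  obtain e h where h: "h \<in> forms (int e)" "eval h w \<noteq> 0"
    "\<And>c v. c \<in> C \<Longrightarrow> pairing c w \<noteq> 0 \<Longrightarrow> pairing c v = 0 \<Longrightarrow> eval h v = 0"
    by (rule general_point[OF w(2,1)]) blast
  obtain u where u: "\<And>i. \<theta> (Var i) - u * Var i \<in> vanishing_ideal L"
    using N_eq_0_imp[OF N0] by blast
  \<comment> \<open>Subtracting the Euler part changes nothing modulo the relations and leaves
    coefficients that vanish on L.\<close>
  define t where "t i = \<theta> (Var i) - u * Var i" for i
  have t: "t i \<in> vanishing_ideal L" for i
    using u by (simp add: t_def)
  have ct: "contract c t = contract c (\<lambda>i. \<theta> (Var i)) - u * linform c" for c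
    unfolding t_def contract_def linform_def sum_distrib_left sum_subtractf[symmetric]
    by (intro sum.cong refl) (simp add: algebra_simps)
  have t_log: "eval (contract c t) v = 0" if "c \<in> C" "pairing c v = 0" for c v
  proof -
    have "eval (contract c (\<lambda>i. \<theta> (Var i))) v = 0"
      using \<theta> that unfolding log_der_iff by blast
    then show ?thesis
      using that(2) by (simp only: ct eval_simps eval_linform) simp
  qed
  have \<theta>f: "\<theta> f = u * euler f + (\<Sum>i\<in>UNIV. t i * pd i f)" for f
  proof -
    have "\<theta> f = (\<Sum>i\<in>UNIV. \<theta> (Var i) * pd i f)"
      by (rule derivations_expand[OF log_derD[OF \<theta>]])
    also have "\<dots> = (\<Sum>i\<in>UNIV. u * (Var i * pd i f) + t i * pd i f)"
      by (simp add: t_def algebra_simps)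
    finally show ?thesis
      by (simp add: euler_def sum.distrib sum_distrib_left)
  qed
  have "(\<lambda>f. h * \<theta> f) \<in> restriction_relations arr L"
  proof (cases "\<exists>c0\<in>C. pairing c0 w = 0")
    case False
    let ?\<delta> = "\<lambda>i. der (\<lambda>j. if j = i then h else 0)"
    have "?\<delta> i \<in> log_der arr" for i
      using h(3) False by (auto simp: der_log_der_iff pairing_def if_distrib[of "\<lambda>f. eval f _"] intro!: sum.neutral)
    moreover have "?\<delta> i f = h * pd i f" for i f
      by (simp add: der_def if_distrib[of "\<lambda>x. x * _"] cong: if_cong)
    ultimately show ?thesis
      using t by (intro restriction_relationsI[of t ?\<delta> _ "h * u"])
        (simp_all add: \<theta>f distrib_left sum_distrib_left mult_ac)
  next
    case True
    then obtain c0 where c0: "c0 \<in> C" "pairing c0 w = 0" by blast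
    have other: "eval h v = 0" if "c \<in> C" "c \<noteq> c0" "pairing c v = 0" for c v
      using general[OF that(1) c0(1) that(2) w(2)] w(1) c0(2) h(3)[OF that(1) _ that(3)] by auto
    have "c0 \<noteq> 0" using c0(1) zero_notin_C by auto
    then obtain k where k: "c0 $ k \<noteq> 0" by (auto simp: vec_eq_iff)
    obtain a where a: "contract c0 t = a * linform c0"
      using linform_dvd_if_vanishing[OF \<open>c0 \<noteq> 0\<close>, of "contract c0 t"] t_log[OF c0(1)] by blast
    have "contract c0 t \<in> vanishing_ideal L"
      using t by (simp add: vanishing_ideal_iff pairing_def)
    \<comment> \<open>I(L) is prime and does not contain the linear form of \<open>c0\<close>, so
      the cofactor vanishes on L as well.\<close>
    then have aL: "a \<in> vanishing_ideal L"
      unfolding a using vanishing_ideal_prime[OF subspace_L, of a "linform c0"] linform_notin[OF c0(1)]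
      by blast
    \<comment> \<open>Coordinates of t in the local basis. The coefficient of \<partial>_k left over
      by the fields with i different from k is \<open>contract c0 t\<close> divided by
      \<open>c0 $ k\<close>, that is a / \<open>c0 $ k\<close> times the linear form of
      \<open>c0\<close>.\<close>
    define b where "b i = (if i = k then Const (1 / c0 $ k) * a else t i)" for i
    define \<delta> where "\<delta> i j = h * (if i = k then if j = k then linform c0 else 0
      else if j = i then 1 else if j = k then - Const (c0 $ i / c0 $ k) else 0)" for i j
    have b: "b i \<in> vanishing_ideal L" for i
      using aL t by (auto simp: b_def vanishing_ideal_iff)
    have \<delta>: "der (\<delta> i) \<in> log_der arr" for i
      unfolding der_log_der_iff
    proof (intro ballI allI impI)
      fix c v assume c: "c \<in> C" "pairing c v = 0"
      show "eval (contract c (\<delta> i)) v = 0"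
      proof (cases "c = c0")
        case False
        then show ?thesis
          using other[OF c(1) False c(2)] by (simp add: pairing_def \<delta>_def)
      next
        case True
        show ?thesis
        proof (cases "i = k")
          case True
          then show ?thesis using c(2) \<open>c = c0\<close>
            by (auto simp: pairing_def[of _ "vec_lambda _"] \<delta>_def intro!: sum.neutral)
        next
          case False
          have "eval (contract c (\<delta> i)) v = (\<Sum>j\<in>UNIV. (if j = i then c0 $ i * eval h v else 0) +
              (if j = k then - (c0 $ i * eval h v) else 0))"
            unfolding eval_contract pairing_def using False k
            by (intro sum.cong refl) (auto simp: \<delta>_def \<open>c = c0\<close>)
          then show ?thesis
            by (simp add: sum.distrib)
        qed
      qed
    qed
    have key: "(\<Sum>i\<in>UNIV. b i * \<delta> i j) = h * t j" for j
    proof (cases "j = k")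
      case False
      then have "(\<Sum>i\<in>UNIV. b i * \<delta> i j) = (\<Sum>i\<in>UNIV. if i = j then h * t j else 0)"
        by (intro sum.cong refl) (auto simp: b_def \<delta>_def)
      then show ?thesis by simp
    next
      case True
      have "Const (c0 $ i / c0 $ k) = Const (1 / c0 $ k) * Const (c0 $ i)" for i
        by (simp flip: Const_mult)
      then have "b i * \<delta> i j = (if i = k then h * Const (1 / c0 $ k) * (a * linform c0) + h * t k else 0) -
          h * Const (1 / c0 $ k) * (t i * Const (c0 $ i))" for i
        using True k by (auto simp: b_def \<delta>_def mult_ac simp flip: Const_mult)
      then have "(\<Sum>i\<in>UNIV. b i * \<delta> i j) = h * Const (1 / c0 $ k) * (a * linform c0) + h * t k -
          h * Const (1 / c0 $ k) * contract c0 t"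
        by (simp add: sum_subtractf contract_def sum_distrib_left)
      then show ?thesis
        by (simp add: a True)
    qed
    show ?thesis
    proof (rule restriction_relationsI[of b "\<lambda>i. der (\<delta> i)" _ "h * u", OF b \<delta>])
      fix f
      have "(\<Sum>i\<in>UNIV. b i * der (\<delta> i) f) = (\<Sum>j\<in>UNIV. (\<Sum>i\<in>UNIV. b i * \<delta> i j) * pd j f)"
        unfolding der_def sum_distrib_left sum_distrib_right mult.assoc[symmetric] by (rule sum.swap)
      then show "h * \<theta> f = h * u * euler f + (\<Sum>i\<in>UNIV. b i * der (\<delta> i) f)"
        by (simp add: key \<theta>f distrib_left sum_distrib_left mult_ac)
    qed
  qed
  moreover have "nonvanishing_at h p"
    using h(1,2) by (simp add: w(3) nonvanishing_at_span)
  ultimately show ?thesis using h(1) by blast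
qed

lemma fractionsI:
  assumes "a \<in> log_der arr" "\<And>i. a (Var i) \<in> forms (d + int e)" "g \<in> forms (int e)" "nonvanishing_at g p"
  shows "(a, g) \<in> fractions arr p d"
  using assms by (auto simp: fractions_def log_der_deg_iff)

lemma eval_N_contract: "eval (N a) c = eval (contract c a) (sg c)"
  by (simp add: eval_N pairing_commute)

text \<open>For a hyperplane through the point, F(c0) = 0 says that the value of f on its linear
  form is divisible by that form modulo I(L). A correction along \<partial>_k by a multiple of r,
  which vanishes on L, makes the divisibility exact; the factor h handles the other
  hyperplanes.\<close>

lemma local_surjective:
  assumes f: "\<And>i. f i \<in> forms d" and z: "\<And>c. c \<in> C \<Longrightarrow> eval (N f) c = 0" and p: "p \<in> points_on L"
  shows "\<exists>\<theta> g. (\<theta>, g) \<in> fractions arr p d \<and> T g * N f = NN \<theta>"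
proof -
  obtain w where w: "w \<noteq> 0" "w \<in> L" "p = vec.span {w}"
    using points_on_eq_span[OF p] .
  obtain e h where h: "h \<in> forms (int e)" "eval h w \<noteq> 0"
    "\<And>c v. c \<in> C \<Longrightarrow> pairing c w \<noteq> 0 \<Longrightarrow> pairing c v = 0 \<Longrightarrow> eval h v = 0"
    by (rule general_point[OF w(2,1)]) blast
  have hp: "nonvanishing_at h p"
    using h(1,2) by (simp add: w(3) nonvanishing_at_span)
  have hf: "h * x \<in> forms (d + int e)" if "x \<in> forms d" for x
    using forms_mult[OF h(1) that] by (simp add: add.commute)
  have "\<exists>t. (\<forall>i. t i \<in> forms (d + int e)) \<and> der t \<in> log_der arr \<and> (\<forall>i. t i - h * f i \<in> vanishing_ideal L)"
  proof (cases "\<exists>c0\<in>C. pairing c0 w = 0")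
    case False
    then have "der (\<lambda>i. h * f i) \<in> log_der arr"
      using h(3) by (auto simp: der_log_der_iff pairing_def)
    then show ?thesis
      using hf f by (intro exI[of _ "\<lambda>i. h * f i"]) (auto simp: vanishing_ideal_iff)
  next
    case True
    then obtain c0 where c0: "c0 \<in> C" "pairing c0 w = 0" by blast
    have other: "eval h v = 0" if "c \<in> C" "c \<noteq> c0" "pairing c v = 0" for c v
      using general[OF that(1) c0(1) that(2) w(2)] w(1) c0(2) h(3)[OF that(1) _ that(3)] by auto
    have "c0 \<noteq> 0" using c0(1) zero_notin_C by auto
    then obtain k where k: "c0 $ k \<noteq> 0" by (auto simp: vec_eq_iff)
    obtain a where a: "a \<in> forms (d - 1)" "contract c0 f - a * linform c0 \<in> vanishing_ideal L"
      using L_divide[OF sg_C[OF c0(1)] contract_in_forms[of f d c0, OF f]]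
        z[OF c0(1), unfolded eval_N_contract] by blast
    define r where "r = a * linform c0 - contract c0 f"
    have r: "r \<in> forms d"
      unfolding r_def using forms_mult[OF a(1) linform_in_forms[of c0]] contract_in_forms[OF f]
      by (intro forms_minus) auto
    have rL: "eval r v = 0" if "v \<in> L" for v
      using vanishing_idealD[OF a(2) that] by (simp add: r_def)
    define t where "t i = h * (f i + (if i = k then Const (1 / c0 $ k) * r else 0))" for i
    have "t i \<in> forms (d + int e)" for i
      unfolding t_def by (intro hf forms_add f) (simp add: forms_Const_mult r)
    moreover have "t i - h * f i \<in> vanishing_ideal L" for i
      by (simp add: t_def vanishing_ideal_iff rL)
    moreover have "der t \<in> log_der arr"
      unfolding der_log_der_iff
    proof (intro ballI allI impI)
      fix c v assume c: "c \<in> C" "pairing c v = 0"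
      show "eval (contract c t) v = 0"
      proof (cases "c = c0")
        case False
        then show ?thesis
          using other[OF c(1) False c(2)] by (simp add: pairing_def t_def)
      next
        case True
        have "contract c0 t = (\<Sum>i\<in>UNIV. h * (f i * Const (c0 $ i)) + (if i = k then h * r else 0))"
          unfolding contract_def
        proof (intro sum.cong refl)
          fix i
          have "Const (1 / c0 $ k) * Const (c0 $ k) = (1 :: ('v, 'k) mp)"
            using k by (simp flip: Const_mult)
          moreover have "t k * Const (c0 $ k) =
              h * (f k * Const (c0 $ k)) + h * r * (Const (1 / c0 $ k) * Const (c0 $ k))"
            by (simp add: t_def algebra_simps)
          ultimately show "t i * Const (c0 $ i) = h * (f i * Const (c0 $ i)) + (if i = k then h * r else 0)"
            by (auto simp: t_def algebra_simps)
        qed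
        also have "\<dots> = h * (contract c0 f + r)"
          by (simp add: sum.distrib contract_def sum_distrib_left distrib_left)
        also have "\<dots> = h * (a * linform c0)"
          by (simp add: r_def)
        finally show ?thesis
          using c(2) by (simp only: True eval_simps eval_linform) simp
      qed
    qed
    ultimately show ?thesis by blast
  qed
  then obtain t where t: "\<And>i. t i \<in> forms (d + int e)" "der t \<in> log_der arr"
    "\<And>i. t i - h * f i \<in> vanishing_ideal L" by blast
  have "NN (der t) = T h * N f"
    using N_cong[of t "\<lambda>i. h * f i"] t(3) by (simp add: N_scale)
  moreover have "(der t, h) \<in> fractions arr p d"
    using t h(1) hp by (intro fractionsI) auto
  ultimately show ?thesis by metis
qed

end

section \<open>Sections as polynomials\<close>

lemma derivations_combination:
  fixes \<theta> \<theta>' :: "('v, 'k::comm_ring_1) mp \<Rightarrow> ('v, 'k) mp"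
  assumes "\<theta> \<in> derivations" "\<theta>' \<in> derivations"
  shows "(\<lambda>f. a * \<theta> f + b * \<theta>' f) \<in> derivations"
proof -
  have "\<theta> (f + g) = \<theta> f + \<theta> g" "\<theta>' (f + g) = \<theta>' f + \<theta>' g"
    "\<theta> (Const c * f) = Const c * \<theta> f" "\<theta>' (Const c * f) = Const c * \<theta>' f"
    "\<theta> (f * g) = f * \<theta> g + g * \<theta> f" "\<theta>' (f * g) = f * \<theta>' g + g * \<theta>' f" for c f g
    using assms unfolding derivations_def by blast+
  then show ?thesis
    unfolding derivations_def by (simp add: algebra_simps)
qed

lemma contract_combination:
  "contract c (\<lambda>i. a * s i + b * t i) = a * contract c s + b * contract c t"
  by (simp add: contract_def sum_distrib_left sum.distrib distrib_right mult.assoc)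

context general_line
begin

lemma log_der_combination:
  assumes "\<theta> \<in> log_der arr" "\<theta>' \<in> log_der arr"
  shows "(\<lambda>f. a * \<theta> f + b * \<theta>' f) \<in> log_der arr"
  using assms unfolding log_der_iff contract_combination
  by (simp add: derivations_combination del: eval_contract)

lemma log_der_scale: "\<theta> \<in> log_der arr \<Longrightarrow> (\<lambda>f. a * \<theta> f) \<in> log_der arr"
  using log_der_combination[of \<theta> \<theta> a 0] by simp

lemma fractionsD:
  assumes "(\<theta>, g) \<in> fractions arr p d"
  obtains e where "\<theta> \<in> log_der arr" "\<And>i. \<theta> (Var i) \<in> forms (d + int e)" "g \<in> forms (int e)"
    "nonvanishing_at g p"
  using assms unfolding fractions_def log_der_deg_iff by blast

lemma T_nonvanishing:
  assumes "p \<in> points_on L" "nonvanishing_at g p"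
  shows "T g \<noteq> 0"
  using assms vanishing_idealD[of g L] unfolding T_eq_0_iff nonvanishing_at_def points_on_def by blast

lemma fractions_log_der: "(\<theta>, g) \<in> fractions arr p d \<Longrightarrow> \<theta> \<in> log_der arr"
  and fractions_nonvanishing: "(\<theta>, g) \<in> fractions arr p d \<Longrightarrow> nonvanishing_at g p"
  by (auto simp: fractions_def log_der_deg_def)

lemma T_fraction: "(\<theta>, g) \<in> fractions arr p d \<Longrightarrow> p \<in> points_on L \<Longrightarrow> T g \<noteq> 0"
  by (rule T_nonvanishing[OF _ fractions_nonvanishing])

lemma point_nonempty: "p \<in> points_on L \<Longrightarrow> \<exists>v. v \<in> p"
  by (rule points_on_eq_span) (auto intro: vec.span_base)

lemma germ_self:
  assumes "(\<theta>, g) \<in> fractions arr p d" "p \<in> points_on L"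
  shows "(\<theta>, g) \<in> germ arr L p d \<theta> g"
proof -
  have "(\<lambda>f. 1 * (g * \<theta> f - g * \<theta> f)) \<in> restriction_relations arr L"
    unfolding restriction_relations_def mem_Collect_eq
    by (intro exI[of _ 0] exI[of _ "0::nat"]) simp
  moreover have "nonvanishing_at 1 p"
    using point_nonempty[OF assms(2)] by (simp add: nonvanishing_at_def)
  moreover have "(1 :: ('v, 'k) mp) \<in> forms (int 0)" by simp
  ultimately show ?thesis
    using assms(1) unfolding germ_def by blast
qed

lemma NN_combination: "NN (\<lambda>f. h * (g' * \<theta> f - g * \<theta>' f)) = T h * (T g' * NN \<theta> - T g * NN \<theta>')"
  by (simp only: N_scale N_minus)

lemma germ_relation:
  assumes "(\<theta>', g') \<in> germ arr L p d \<theta> g" "p \<in> points_on L"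
  shows "T g' * NN \<theta> = T g * NN \<theta>'"
proof -
  obtain h where h: "nonvanishing_at h p"
    "(\<lambda>f. h * (g' * \<theta> f - g * \<theta>' f)) \<in> restriction_relations arr L"
    using assms(1) by (auto simp: germ_def)
  have "T h * (T g' * NN \<theta> - T g * NN \<theta>') = 0"
    using restriction_relations_NN[OF h(2)] by (simp only: NN_combination)
  then show ?thesis
    using T_nonvanishing[OF assms(2) h(1)] by (simp only: mp_mult_eq_0) simp
qed

text \<open>Replaces the equivalence relation defining germs by one equation in R. Equivalent pairs
  satisfy it by cancellation; for the converse, the difference of the two fractions has image 0, and
  \<open>local_injective\<close> makes it a relation after multiplication by a form nonvanishing at
  p.\<close>

lemma germ_eq:
  assumes "(\<theta>, g) \<in> fractions arr p d" "p \<in> points_on L" and F: "T g * F = NN \<theta>"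
  shows "germ arr L p d \<theta> g = {(\<theta>', g') \<in> fractions arr p d. T g' * F = NN \<theta>'}"
proof -
  have Tg: "T g \<noteq> 0"
    by (rule T_fraction[OF assms(1,2)])
  have "T g' * F = NN \<theta>'" if "(\<theta>', g') \<in> germ arr L p d \<theta> g" for \<theta>' g'
  proof -
    have "T g * (T g' * F) = T g * NN \<theta>'"
      using germ_relation[OF that assms(2)] unfolding F[symmetric] by (simp only: mult_ac)
    then show ?thesis
      using Tg by (simp only: mp_mult_cancel_left) simp
  qed
  moreover have "(\<theta>', g') \<in> germ arr L p d \<theta> g"
    if frac: "(\<theta>', g') \<in> fractions arr p d" and F': "T g' * F = NN \<theta>'" for \<theta>' g'
  proof -
    let ?\<rho> = "\<lambda>f. g' * \<theta> f - g * \<theta>' f"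
    have "?\<rho> \<in> log_der arr"
      using log_der_combination[OF fractions_log_der[OF assms(1)] fractions_log_der[OF frac], of g' "- g"]
      by simp
    moreover have "NN ?\<rho> = 0"
      by (simp only: N_minus N_scale flip: F F') (simp only: mult_ac diff_self)
    ultimately obtain e h where "h \<in> forms (int e)" "nonvanishing_at h p"
      "(\<lambda>f. h * ?\<rho> f) \<in> restriction_relations arr L"
      using local_injective[OF _ _ assms(2)] by blast
    then show ?thesis
      using frac unfolding germ_def by blast
  qed
  moreover have "germ arr L p d \<theta> g \<subseteq> fractions arr p d"
    by (auto simp: germ_def)
  ultimately show ?thesis by blast
qed

section \<open>The polynomial attached to a section\<close>

definition represented_by :: "('v, 'k) germ_section \<Rightarrow> ('v, 'k) mp \<Rightarrow> bool" where
  "represented_by s F \<longleftrightarrow> (\<forall>p\<in>points_on L. \<forall>\<theta> g. (\<theta>, g) \<in> s p \<longrightarrow> T g * F = NN \<theta>)"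

text \<open>One function for all degrees; uniqueness comes from cancelling a single
  denominator.\<close>

definition eta :: "('v, 'k) germ_section \<Rightarrow> ('v, 'k) mp" where
  "eta s = (THE F. represented_by s F)"

lemma exists_point: "\<exists>p. p \<in> points_on L"
proof -
  have "sg x0 \<noteq> 0"
    using pairing_y0_x0 D_nz by auto
  then show ?thesis
    using points_on_span[OF subspace_L sg_in_L] by blast
qed

lemma eta_eqI:
  assumes F: "represented_by s F" and p: "p \<in> points_on L" "(\<theta>, g) \<in> s p" "nonvanishing_at g p"
  shows "eta s = F"
  unfolding eta_def
proof (rule the_equality)
  fix F' assume "represented_by s F'"
  then have "T g * F' = T g * F"
    using F p unfolding represented_by_def by metis
  then show "F' = F"
    using T_nonvanishing[OF p(1,3)] by (simp only: mp_mult_cancel_left) simp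
qed (rule F)

lemma sections_local:
  assumes "s \<in> sections arr L d" "p \<in> points_on L"
  obtains \<theta> g where "(\<theta>, g) \<in> fractions arr p d"
    "\<And>q. q \<in> points_on L \<Longrightarrow> nonvanishing_at g q \<Longrightarrow> s q = germ arr L q d \<theta> g"
  using assms unfolding sections_def by blast

lemma fractions_move:
  "(\<theta>, g) \<in> fractions arr p d \<Longrightarrow> nonvanishing_at g q \<Longrightarrow> (\<theta>, g) \<in> fractions arr q d"
  by (auto simp: fractions_def)

lemma section_nonempty:
  assumes "s \<in> sections arr L d" "p \<in> points_on L"
  obtains \<theta> g where "(\<theta>, g) \<in> fractions arr p d" "(\<theta>, g) \<in> s p" "nonvanishing_at g p"
proof -
  obtain \<theta> g where 1: "(\<theta>, g) \<in> fractions arr p d"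
    "\<And>q. q \<in> points_on L \<Longrightarrow> nonvanishing_at g q \<Longrightarrow> s q = germ arr L q d \<theta> g"
    using sections_local[OF assms] by metis
  have nv: "nonvanishing_at g p"
    by (rule fractions_nonvanishing[OF 1(1)])
  then have "(\<theta>, g) \<in> s p"
    using 1(2)[OF assms(2)] germ_self[OF 1(1) assms(2)] by simp
  with 1 nv that show ?thesis by blast
qed

text \<open>Two nonempty open subsets of L meet because I(L) is prime. The additional factor
  \<open>linform x0\<close> keeps w away from 0 when the denominators are constants.\<close>

lemma common_nonvanishing:
  assumes "(\<theta>, g) \<in> fractions arr p d" "(\<theta>', g') \<in> fractions arr p' d'"
    "p \<in> points_on L" "p' \<in> points_on L"
  obtains q where "q \<in> points_on L" "nonvanishing_at g q" "nonvanishing_at g' q"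
proof -
  have "g \<notin> vanishing_ideal L" "g' \<notin> vanishing_ideal L"
    using T_fraction[OF assms(1,3)] T_fraction[OF assms(2,4)] by (simp_all only: T_eq_0_iff) simp_all
  moreover have "linform x0 \<notin> vanishing_ideal L"
    using vanishing_idealD[of "linform x0" L "sg y0"] pairing_x0_y0 D_nz by auto
  ultimately have "g * g' * linform x0 \<notin> vanishing_ideal L"
    using vanishing_ideal_prime[OF subspace_L] by blast
  then obtain w where w: "w \<in> L" "eval g w \<noteq> 0" "eval g' w \<noteq> 0" "pairing x0 w \<noteq> 0"
    by (auto simp: vanishing_ideal_iff)
  then have "w \<noteq> 0" by auto
  moreover have "nonvanishing_at g (vec.span {w})" "nonvanishing_at g' (vec.span {w})"
    using w by (auto simp: nonvanishing_at_def intro: vec.span_base)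
  ultimately show ?thesis
    using that points_on_span[OF subspace_L w(1)] by blast
qed

text \<open>Fractions chosen at two points define the same germ at a common point of their domains,
  and this yields an identity in R that is independent of the point. One denominator can therefore
  be fixed and all the others serve as tests for \<open>glue\<close>.\<close>

lemma section_represented:
  assumes s: "s \<in> sections arr L d"
  obtains F where "represented_by s F"
proof -
  have "\<exists>\<theta> g. (\<theta>, g) \<in> fractions arr p d \<and>
      (\<forall>q\<in>points_on L. nonvanishing_at g q \<longrightarrow> s q = germ arr L q d \<theta> g)" if "p \<in> points_on L" for p
    using sections_local[OF s that] by metis
  then obtain \<theta> g where loc: "\<And>p. p \<in> points_on L \<Longrightarrow> (\<theta> p, g p) \<in> fractions arr p d"
    "\<And>p q. p \<in> points_on L \<Longrightarrow> q \<in> points_on L \<Longrightarrow> nonvanishing_at (g p) q \<Longrightarrow>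
      s q = germ arr L q d (\<theta> p) (g p)"
    by metis
  have rel: "T (g p') * NN (\<theta> p) = T (g p) * NN (\<theta> p')"
    if p: "p \<in> points_on L" "p' \<in> points_on L" for p p'
  proof -
    obtain q where q: "q \<in> points_on L" "nonvanishing_at (g p) q" "nonvanishing_at (g p') q"
      using common_nonvanishing[OF loc(1)[OF p(1)] loc(1)[OF p(2)] p] .
    have "(\<theta> p', g p') \<in> germ arr L q d (\<theta> p') (g p')"
      using germ_self fractions_move[OF loc(1)[OF p(2)] q(3)] q(1) by blast
    also have "\<dots> = germ arr L q d (\<theta> p) (g p)"
      using loc(2)[OF p(1) q(1,2)] loc(2)[OF p(2) q(1,3)] by simp
    finally show ?thesis
      by (rule germ_relation[OF _ q(1)])
  qed
  obtain p0 where p0: "p0 \<in> points_on L" using exists_point ..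
  have nv: "nonvanishing_at (g p) p" if "p \<in> points_on L" for p
    by (rule fractions_nonvanishing[OF loc(1)[OF that]])
  have T0: "T (g p) \<noteq> 0" if "p \<in> points_on L" for p
    using T_nonvanishing nv that by blast
  obtain e where "g p0 \<in> forms (int e)"
    using fractionsD[OF loc(1)[OF p0]] by metis
  then obtain F where F0: "NN (\<theta> p0) = T (g p0) * F"
    using glue[OF _ T0[OF p0], of e "NN (\<theta> p0)"] rel[OF _ p0] nv by metis
  have F: "NN (\<theta> p) = T (g p) * F" if p: "p \<in> points_on L" for p
  proof -
    have "T (g p0) * NN (\<theta> p) = T (g p0) * (T (g p) * F)"
      using rel[OF p p0] F0 by (simp only: mult_ac)
    then show ?thesis
      using T0[OF p0] by (simp only: mp_mult_cancel_left) simp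
  qed
  have "represented_by s F"
    unfolding represented_by_def
  proof (intro ballI allI impI)
    fix p \<theta>' g' assume p: "p \<in> points_on L" and "(\<theta>', g') \<in> s p"
    then have "(\<theta>', g') \<in> germ arr L p d (\<theta> p) (g p)"
      using loc(2)[OF p p nv[OF p]] by simp
    then show "T g' * F = NN \<theta>'"
      unfolding germ_eq[OF loc(1)[OF p] p F[OF p, symmetric]] by blast
  qed
  then show ?thesis by (rule that)
qed

lemma represented_by_eta: "s \<in> sections arr L d \<Longrightarrow> represented_by s (eta s)"
  using section_represented exists_point section_nonempty eta_eqI by metis

lemma section_eq:
  assumes s: "s \<in> sections arr L d" and p: "p \<in> points_on L"
  shows "s p = {(\<theta>, g) \<in> fractions arr p d. T g * eta s = NN \<theta>}"
proof -
  obtain \<theta> g where loc: "(\<theta>, g) \<in> fractions arr p d"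
    "\<And>q. q \<in> points_on L \<Longrightarrow> nonvanishing_at g q \<Longrightarrow> s q = germ arr L q d \<theta> g"
    using sections_local[OF s p] by metis
  have sp: "s p = germ arr L p d \<theta> g"
    by (rule loc(2)[OF p fractions_nonvanishing[OF loc(1)]])
  then have "(\<theta>, g) \<in> s p"
    using germ_self[OF loc(1) p] by simp
  then have "T g * eta s = NN \<theta>"
    using represented_by_eta[OF s] p unfolding represented_by_def by blast
  then show ?thesis
    unfolding sp by (rule germ_eq[OF loc(1) p])
qed

text \<open>Indexed by the degree d of the derivations; the polynomials have degree d + 1, which
  accounts for the twist.\<close>

definition target :: "int \<Rightarrow> ('v, 'k) mp set" where
  "target d = {F \<in> forms (d + 1). (\<forall>c\<in>C. eval F c = 0) \<and> F \<in> ideal_power (vanishing_ideal Q) d}"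

lemma eta_in_target:
  assumes s: "s \<in> sections arr L d"
  shows "eta s \<in> target d"
    and "d \<ge> 0 \<Longrightarrow> \<exists>f. (\<forall>i. f i \<in> forms d) \<and> eta s = N f"
proof -
  obtain p where p: "p \<in> points_on L" using exists_point ..
  obtain \<theta> g where \<theta>g: "(\<theta>, g) \<in> fractions arr p d" "(\<theta>, g) \<in> s p" "nonvanishing_at g p"
    using section_nonempty[OF s p] .
  obtain e where e: "\<And>i. \<theta> (Var i) \<in> forms (d + int e)" "g \<in> forms (int e)"
    using fractionsD[OF \<theta>g(1)] by metis
  have Tg: "T g \<noteq> 0"
    using T_nonvanishing[OF p \<theta>g(3)] .
  have eq: "T g * eta s = NN \<theta>"
    using section_eq[OF s p] \<theta>g(2) by auto
  \<comment> \<open>The component of degree d + 1 satisfies the same equation, so cancelling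
    \<open>T g\<close> shows that the polynomial is a form.\<close>
  have "T g * hcomp (d + 1) (eta s) = hcomp (d + int e + 1) (T g * eta s)"
    by (subst hcomp_mult[OF T_in_forms[OF e(2)]]) simp
  also have "\<dots> = T g * eta s"
    unfolding eq using hcomp_forms[OF N_in_forms[OF e(1)]] by simp
  finally have "eta s = hcomp (d + 1) (eta s)"
    using Tg by (simp only: mp_mult_cancel_left) simp
  then have form: "eta s \<in> forms (d + 1)"
    using hcomp_in_forms by metis
  have N: "\<exists>f. (\<forall>i. f i \<in> forms d) \<and> eta s = N f" if "d \<ge> 0"
    by (rule glue_form[OF e(2) Tg eq e(1) that])
  show "d \<ge> 0 \<Longrightarrow> \<exists>f. (\<forall>i. f i \<in> forms d) \<and> eta s = N f" by (rule N)
  have "eta s \<in> ideal_power (vanishing_ideal Q) d"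
    using N N_in_ideal_power by (cases "d \<ge> 0") auto
  moreover have "eval (eta s) c = 0" if c: "c \<in> C" for c
  proof -
    \<comment> \<open>The value of F at c is read off at the point where L meets the hyperplane of
      c.\<close>
    have pc: "vec.span {sg c} \<in> points_on L"
      by (rule points_on_span[OF subspace_L sg_in_L sg_C[OF c]])
    obtain \<theta> g where \<theta>g: "(\<theta>, g) \<in> fractions arr (vec.span {sg c}) d" "(\<theta>, g) \<in> s (vec.span {sg c})"
      "nonvanishing_at g (vec.span {sg c})"
      using section_nonempty[OF s pc] .
    obtain e where e: "\<theta> \<in> log_der arr" "g \<in> forms (int e)"
      using fractionsD[OF \<theta>g(1)] by metis
    have "eval g (sg c) \<noteq> 0"
      using \<theta>g(3) nonvanishing_at_span[OF e(2)] by simp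
    moreover have "T g * eta s = NN \<theta>"
      using section_eq[OF s pc] \<theta>g(2) by auto
    then have "eval g (sg c) * eval (eta s) c = eval (contract c (\<lambda>i. \<theta> (Var i))) (sg c)"
      by (metis eval_N_contract eval_T eval_simps(4))
    moreover have "eval (contract c (\<lambda>i. \<theta> (Var i))) (sg c) = 0"
      using e(1) c pairing_sg_self[of c] unfolding log_der_iff by blast
    ultimately show ?thesis by simp
  qed
  ultimately show "eta s \<in> target d"
    using form by (simp add: target_def)
qed

lemma local_surjective_target:
  assumes F: "F \<in> target d" and p: "p \<in> points_on L"
  shows "\<exists>\<theta> g. (\<theta>, g) \<in> fractions arr p d \<and> T g * F = NN \<theta>"
proof (cases "d \<ge> 0")
  case True
  then obtain f where f: "\<And>i. f i \<in> forms d" "F = N f"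
    using ideal_power_forms_eq_N[of F d] F by (auto simp: target_def)
  then show ?thesis
    using local_surjective[OF f(1) _ p] F by (auto simp: target_def)
next
  case neg: False
  show ?thesis
  proof (cases "F = 0")
    case True
    have "(der (\<lambda>i. 0), 1) \<in> fractions arr p d"
      using point_nonempty[OF p]
      by (intro fractionsI[where e = 0]) (auto simp: der_log_der_iff pairing_def nonvanishing_at_def)
    moreover have "T 1 * F = NN (der (\<lambda>i. 0))"
      using True by (simp add: N_def)
    ultimately show ?thesis by blast
  next
    case False
    then have "d + 1 \<ge> 0"
      using forms_neg[of "d + 1" F] F by (force simp: target_def)
    with neg have d: "d = -1" by simp
    then obtain k where k: "F = Const k"
      using F forms_0[of F] by (auto simp: target_def)
    have "C = {}"
      using F False by (auto simp: target_def k)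
    obtain w where w: "w \<noteq> 0" "w \<in> L" "p = vec.span {w}"
      using points_on_eq_span[OF p] .
    then obtain i where i: "w $ i \<noteq> 0" by (auto simp: vec_eq_iff)
    \<comment> \<open>A constant field \<open>b \<in> L\<close> has the same image in \<open>R\<close> as the linear form on \<open>L\<close> that vanishes at \<open>b\<close>,
      so their quotient represents \<open>1\<close>.\<close>
    define b where "b = - sg (axis i 1)"
    have "nonvanishing_at (linform (axis i 1)) p"
      using nonvanishing_at_span[of "linform (axis i 1)" 1 w] i w(3) by simp
    moreover have "der t \<in> log_der arr" for t
      unfolding der_log_der_iff using \<open>C = {}\<close> by blast
    ultimately have "(der (\<lambda>j. Const (k * b $ j)), linform (axis i 1)) \<in> fractions arr p d"
      unfolding d by (intro fractionsI[where e = 1]) simp_all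
    moreover have "T (linform (axis i 1)) * F = NN (der (\<lambda>j. Const (k * b $ j)))"
      unfolding T_linform k b_def[symmetric]
      by (simp add: N_def linform_def Const_mult sum_distrib_left sum_distrib_right mult_ac)
    ultimately show ?thesis by blast
  qed
qed

text \<open>The inverse of \<open>eta\<close>: by \<open>germ_eq\<close> all fractions at p that
  equal F form a single germ.\<close>

definition section_of :: "int \<Rightarrow> ('v, 'k) mp \<Rightarrow> ('v, 'k) germ_section" where
  "section_of d F p =
    (if p \<in> points_on L then {(\<theta>, g) \<in> fractions arr p d. T g * F = NN \<theta>} else {})"

lemma section_of_in_sections:
  assumes F: "F \<in> target d"
  shows "section_of d F \<in> sections arr L d"
  unfolding sections_def mem_Collect_eq
proof (intro conjI ballI allI impI)
  fix p assume p: "p \<in> points_on L"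
  obtain \<theta> g where \<theta>g: "(\<theta>, g) \<in> fractions arr p d" "T g * F = NN \<theta>"
    using local_surjective_target[OF F p] by blast
  have "section_of d F q = germ arr L q d \<theta> g" if "q \<in> points_on L" "nonvanishing_at g q" for q
    using germ_eq[OF fractions_move[OF \<theta>g(1) that(2)] that(1) \<theta>g(2)] that(1)
    by (simp add: section_of_def)
  then show "\<exists>(\<theta>, g)\<in>fractions arr p d.
      \<forall>q\<in>points_on L. nonvanishing_at g q \<longrightarrow> section_of d F q = germ arr L q d \<theta> g"
    using \<theta>g(1) by blast
qed (simp add: section_of_def)

lemma eta_section_of:
  assumes F: "F \<in> target d"
  shows "eta (section_of d F) = F"
proof -
  obtain p where p: "p \<in> points_on L" using exists_point ..
  obtain \<theta> g where \<theta>g: "(\<theta>, g) \<in> section_of d F p" "nonvanishing_at g p"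
    using section_nonempty[OF section_of_in_sections[OF F] p] by metis
  show ?thesis
    by (rule eta_eqI[of "section_of d F" F p \<theta> g, OF _ p \<theta>g]) (simp add: represented_by_def section_of_def)
qed

lemma section_of_eta:
  assumes "s \<in> sections arr L d"
  shows "section_of d (eta s) = s"
proof
  fix p
  show "section_of d (eta s) p = s p"
    using section_eq[OF assms] assms by (cases "p \<in> points_on L") (auto simp: section_of_def sections_def)
qed

lemma bij_betw_eta: "bij_betw eta (sections arr L d) (target d)"
  by (rule bij_betw_byWitness[where f' = "section_of d"])
    (auto simp: section_of_eta eta_section_of eta_in_target section_of_in_sections)

section \<open>Compatibility with the module operations\<close>

text \<open>All pairs of representatives give fractions of the same polynomial, so the union of
  germs is represented by the sum. One explicit representative shows that it is not empty, as
  \<open>eta_eqI\<close> requires.\<close>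

lemma eta_gadd:
  assumes s: "s \<in> sections arr L d" and t: "t \<in> sections arr L d"
  shows "eta (gadd (D0_restricted arr L) d s t) = eta s + eta t"
proof -
  obtain p where p: "p \<in> points_on L" using exists_point ..
  let ?r = "gadd (D0_restricted arr L) d s t"
  let ?c = "\<lambda>\<theta> g \<theta>' g'. (\<lambda>f. g' * \<theta> f + g * \<theta>' f)"
  have r: "?r p = (\<Union>(\<theta>, g)\<in>s p. \<Union>(\<theta>', g')\<in>t p. germ arr L p d (?c \<theta> g \<theta>' g') (g * g'))" for p
    by (simp add: D0_restricted_def)
  have NNc: "NN (?c \<theta> g \<theta>' g') = T (g * g') * (eta s + eta t)"
    if "p \<in> points_on L" "(\<theta>, g) \<in> s p" "(\<theta>', g') \<in> t p" for p \<theta> g \<theta>' g'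
  proof -
    have "NN \<theta> = T g * eta s" "NN \<theta>' = T g' * eta t"
      using that section_eq[OF s that(1)] section_eq[OF t that(1)] by auto
    then show ?thesis
      by (simp add: N_add N_scale algebra_simps)
  qed
  have frac: "(?c \<theta> g \<theta>' g', g * g') \<in> fractions arr p d" if p: "p \<in> points_on L"
    and mem: "(\<theta>, g) \<in> s p" "(\<theta>', g') \<in> t p" for p \<theta> g \<theta>' g'
  proof -
    have f: "(\<theta>, g) \<in> fractions arr p d" "(\<theta>', g') \<in> fractions arr p d"
      using mem section_eq[OF s p] section_eq[OF t p] by auto
    obtain e where e: "\<theta> \<in> log_der arr" "\<And>i. \<theta> (Var i) \<in> forms (d + int e)" "g \<in> forms (int e)"
      "nonvanishing_at g p" using fractionsD[OF f(1)] by metis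
    obtain e' where e': "\<theta>' \<in> log_der arr" "\<And>i. \<theta>' (Var i) \<in> forms (d + int e')" "g' \<in> forms (int e')"
      "nonvanishing_at g' p" using fractionsD[OF f(2)] by metis
    have "g' * \<theta> (Var i) + g * \<theta>' (Var i) \<in> forms (d + int (e + e'))" for i
      using forms_add[OF forms_mult[OF e'(3) e(2)[of i]], of "g * \<theta>' (Var i)"]
        forms_mult[OF e(3) e'(2)[of i]] by (simp add: algebra_simps)
    moreover have gg': "g * g' \<in> forms (int (e + e'))"
      using forms_mult[OF e(3) e'(3)] by simp
    moreover have "nonvanishing_at (g * g') p"
    proof -
      obtain w where "p = vec.span {w}"
        using points_on_eq_span[OF p] by metis
      then show ?thesis
        using e(4) e'(4) nonvanishing_at_span[OF e(3)] nonvanishing_at_span[OF e'(3)]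
          nonvanishing_at_span[OF gg'] by simp
    qed
    ultimately show ?thesis
      by (intro fractionsI[OF log_der_combination[OF e(1) e'(1)]])
  qed
  obtain \<theta> g \<theta>' g' where *: "(\<theta>, g) \<in> s p" "(\<theta>', g') \<in> t p"
    using section_nonempty[OF s p] section_nonempty[OF t p] by metis
  have "(?c \<theta> g \<theta>' g', g * g') \<in> ?r p"
    unfolding r using * germ_self[OF frac[OF p *] p] by blast
  moreover have "nonvanishing_at (g * g') p"
    by (rule fractions_nonvanishing[OF frac[OF p *]])
  moreover have "represented_by ?r (eta s + eta t)"
    unfolding represented_by_def
  proof (intro ballI allI impI)
    fix p \<theta>'' g'' assume p: "p \<in> points_on L" and "(\<theta>'', g'') \<in> ?r p"
    then obtain \<theta> g \<theta>' g' where *: "(\<theta>, g) \<in> s p" "(\<theta>', g') \<in> t p"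
      "(\<theta>'', g'') \<in> germ arr L p d (?c \<theta> g \<theta>' g') (g * g')"
      unfolding r by blast
    then show "T g'' * (eta s + eta t) = NN \<theta>''"
      using germ_eq[OF frac[OF p *(1,2)] p NNc[OF p *(1,2), symmetric]] by blast
  qed
  ultimately show ?thesis
    using eta_eqI[OF _ p] by blast
qed

text \<open>The hypothesis \<open>ne\<close> guarantees that the class acts at all: without a form
  of degree e in it the union would be empty.\<close>

lemma eta_gsmult:
  assumes s: "s \<in> sections arr L d" and b: "\<And>f. f \<in> a \<Longrightarrow> T f = b" and ne: "a \<inter> forms (int e) \<noteq> {}"
  shows "eta (gsmult (D0_restricted arr L) e d a s) = b * eta s"
proof -
  obtain p where p: "p \<in> points_on L" using exists_point ..
  let ?r = "gsmult (D0_restricted arr L) e d a s"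
  have r: "?r p = (\<Union>f\<in>a \<inter> forms (int e). \<Union>(\<theta>, g)\<in>s p. germ arr L p (d + int e) (\<lambda>x. f * \<theta> x) g)" for p
    by (simp add: D0_restricted_def)
  have NNc: "NN (\<lambda>x. f * \<theta> x) = T g * (b * eta s)"
    if "p \<in> points_on L" "(\<theta>, g) \<in> s p" "f \<in> a" for p \<theta> g f
  proof -
    have "NN \<theta> = T g * eta s"
      using that section_eq[OF s that(1)] by auto
    then show ?thesis
      by (simp add: N_scale b[OF that(3)] mult_ac)
  qed
  have frac: "((\<lambda>x. f * \<theta> x), g) \<in> fractions arr p (d + int e)" if "p \<in> points_on L"
    "(\<theta>, g) \<in> s p" "f \<in> forms (int e)" for p \<theta> g f
  proof -
    have f: "(\<theta>, g) \<in> fractions arr p d"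
      using that section_eq[OF s that(1)] by auto
    obtain k where k: "\<theta> \<in> log_der arr" "\<And>i. \<theta> (Var i) \<in> forms (d + int k)" "g \<in> forms (int k)"
      "nonvanishing_at g p" using fractionsD[OF f] by metis
    have "f * \<theta> (Var i) \<in> forms (d + int e + int k)" for i
      using forms_mult[OF that(3) k(2)[of i]] by (simp add: algebra_simps)
    then show ?thesis
      by (intro fractionsI[OF log_der_scale[OF k(1)] _ k(3,4)])
  qed
  obtain \<theta> g where *: "(\<theta>, g) \<in> s p"
    using section_nonempty[OF s p] by metis
  obtain f where f: "f \<in> a" "f \<in> forms (int e)"
    using ne by blast
  have "((\<lambda>x. f * \<theta> x), g) \<in> ?r p"
    unfolding r using * f germ_self[OF frac[OF p * f(2)] p] by blast
  moreover have "nonvanishing_at g p"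
    by (rule fractions_nonvanishing[OF frac[OF p * f(2)]])
  moreover have "represented_by ?r (b * eta s)"
    unfolding represented_by_def
  proof (intro ballI allI impI)
    fix p \<theta>'' g'' assume p: "p \<in> points_on L" and "(\<theta>'', g'') \<in> ?r p"
    then obtain f \<theta> g where *: "(\<theta>, g) \<in> s p" "f \<in> a" "f \<in> forms (int e)"
      "(\<theta>'', g'') \<in> germ arr L p (d + int e) (\<lambda>x. f * \<theta> x) g"
      unfolding r by blast
    then show "T g'' * (b * eta s) = NN \<theta>''"
      using germ_eq[OF frac[OF p *(1,3)] p NNc[OF p *(1,2), symmetric]] by blast
  qed
  ultimately show ?thesis
    using eta_eqI[OF _ p] by blast
qed

section \<open>Tuples lifting a section and tangency\<close>

lemma represents_iff:
  assumes s: "s \<in> sections arr L d"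
  shows "represents L f s \<longleftrightarrow> eta s = N f"
proof -
  have eq: "(\<exists>u. \<forall>i. \<theta> (Var i) - (g * f i + u * Var i) \<in> vanishing_ideal L) \<longleftrightarrow> NN \<theta> = T g * N f" for \<theta> g
    unfolding N_scale[symmetric] N_eq_iff by simp
  have pairs: "(\<forall>(\<theta>, g)\<in>S. P \<theta> g) \<longleftrightarrow> (\<forall>\<theta> g. (\<theta>, g) \<in> S \<longrightarrow> P \<theta> g)"
    for S and P :: "(('v, 'k) mp \<Rightarrow> ('v, 'k) mp) \<Rightarrow> ('v, 'k) mp \<Rightarrow> bool" by auto
  have "represents L f s \<longleftrightarrow> represented_by s (N f)"
    unfolding represents_def represented_by_def eq pairs by (simp only: eq_commute)
  also have "\<dots> \<longleftrightarrow> eta s = N f"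
  proof
    assume "represented_by s (N f)"
    then show "eta s = N f"
      using exists_point section_nonempty[OF s] eta_eqI by metis
  next
    assume "eta s = N f"
    then show "represented_by s (N f)"
      using represented_by_eta[OF s] by simp
  qed
  finally show ?thesis .
qed

lemma tangent_on_iff:
  assumes f: "\<And>i. f i \<in> forms d"
  shows "tangent_on arr L f \<longleftrightarrow> (\<forall>c\<in>C. eval (N f) c = 0)"
proof
  assume t: "tangent_on arr L f"
  show "\<forall>c\<in>C. eval (N f) c = 0"
  proof
    fix c assume c: "c \<in> C"
    have "{w. pairing c w = 0} \<in> arr" using c by (auto simp: arr_def)
    moreover have "{w. eval (linform c) w = 0} = {w. pairing c w = 0}" by simp
    ultimately obtain a where "(\<Sum>i\<in>UNIV. f i * pd i (linform c)) - a * linform c \<in> vanishing_ideal L"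
      using t linform_in_forms[of c] unfolding tangent_on_def by blast
    then have "contract c f - a * linform c \<in> vanishing_ideal L"
      by (simp add: contract_def)
    then have "eval (contract c f - a * linform c) (sg c) = 0"
      by (rule vanishing_idealD) simp
    then show "eval (N f) c = 0"
      unfolding eval_N_contract using pairing_sg_self[of c] by simp
  qed
next
  assume z: "\<forall>c\<in>C. eval (N f) c = 0"
  show "tangent_on arr L f"
    unfolding tangent_on_def
  proof (intro ballI impI)
    fix H l assume H: "H \<in> arr" and l: "l \<in> forms 1" and zero: "{w. eval l w = 0} = H"
    obtain c where c: "c \<in> C" "H = {w. pairing c w = 0}"
      using H by (auto simp: arr_def)
    obtain b where b: "l = linform b" using forms_1[OF l] by blast
    have bc: "pairing b w = 0 \<longleftrightarrow> pairing c w = 0" for w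
      using zero c(2) b by auto
    have "c \<noteq> 0" using c(1) zero_notin_C by auto
    then obtain k where k: "c $ k \<noteq> 0" by (auto simp: vec_eq_iff)
    define r where "r = b $ k / c $ k"
    \<comment> \<open>Two linear forms with the same zeros are proportional; test on the vector
      \<open>c $ k *s axis j 1 - c $ j *s axis k 1\<close>, a zero of c.\<close>
    have "b $ j = r * c $ j" for j
      unfolding r_def using bc[of "c $ k *s axis j 1 - c $ j *s axis k 1"] k by (simp add: field_simps)
    then have b': "b = r *s c"
      unfolding vec_eq_iff vector_smult_component by blast
    obtain a where a: "contract c f - a * linform c \<in> vanishing_ideal L"
      using L_divide[OF sg_C[OF c(1)] contract_in_forms[of f d c, OF f]] z c(1)
      unfolding eval_N_contract by blast
    have "contract b f = Const r * contract c f"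
      unfolding b' by (simp add: contract_def Const_mult sum_distrib_left mult_ac)
    moreover have "linform b = Const r * linform c"
      unfolding b' by (simp add: linform_def Const_mult sum_distrib_left mult_ac)
    ultimately have "contract b f - a * linform b = Const r * (contract c f - a * linform c)"
      by (simp add: algebra_simps)
    then have "contract b f - a * linform b \<in> vanishing_ideal L"
      using a by (simp add: vanishing_ideal_iff)
    then show "\<exists>a. (\<Sum>i\<in>UNIV. f i * pd i l) - a * l \<in> vanishing_ideal L"
      by (auto simp: b contract_def)
  qed
qed

end

section \<open>The isomorphism of graded modules\<close>

lemma ring_mp_ring: "ring (mp_ring :: ('v, 'k::comm_ring_1) mp ring)"
proof (rule ringI)
  show "abelian_group (mp_ring :: ('v, 'k) mp ring)"
  proof (rule abelian_groupI)
    fix x :: "('v, 'k) mp"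
    show "\<exists>y\<in>carrier mp_ring. y \<oplus>\<^bsub>mp_ring\<^esub> x = \<zero>\<^bsub>mp_ring\<^esub>"
      by (rule bexI[of _ "- x"]) simp_all
  qed (simp_all add: add_ac)
  show "Group.monoid (mp_ring :: ('v, 'k) mp ring)"
    by (rule monoidI) (simp_all add: mult_ac)
qed (simp_all add: algebra_simps)

lemma mp_ring_uminus: "\<ominus>\<^bsub>mp_ring\<^esub> x = - x"
proof -
  interpret ring mp_ring by (rule ring_mp_ring)
  show ?thesis
    by (rule minus_equality) simp_all
qed

lemma residue_class_eq: "residue_class L f = {g. g - f \<in> vanishing_ideal L}"
proof -
  have "g - f \<in> vanishing_ideal L \<longleftrightarrow> (\<exists>h\<in>vanishing_ideal L. g = h + f)" for g
    by (metis add_diff_cancel diff_add_cancel)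
  then show ?thesis
    by (auto simp: residue_class_def a_r_coset_def')
qed

lemma carrier_coord_ring: "carrier (coord_ring L) = range (residue_class L)"
  by (auto simp: coord_ring_def FactRing_def A_RCOSETS_def' residue_class_def)

lemma sym_ring_eq_generate_ring: "sym_ring Q = mp_ring\<lparr>carrier := generate_ring mp_ring (range Const \<union> (vanishing_ideal Q \<inter> forms 1))\<rparr>"
  by (simp add: sym_ring_def sym_algebra_def)

context line_duality
begin

text \<open>For the inclusion of generators: a linear form in I(Q) has its coefficient vector in
  Q^perp = L, which is the image of \<open>sg\<close>, so by \<open>T_linform\<close> it is the
  pullback of a linear form.\<close>

lemma range_T: "range T = sym_algebra Q"
proof
  show "range T \<subseteq> sym_algebra Q"
  proof
    fix g assume "g \<in> range T"
    then obtain f where g: "g = T f" ..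
    show "g \<in> sym_algebra Q"
      unfolding g sym_algebra_def
    proof (induction f rule: mp_induct)
      case (Var i)
      then show ?case
        using lf_vanishes_on_Q lf_in_forms by (intro generate_ring.incl) simp
    next
      case (add f g)
      then show ?case
        using generate_ring.eng_add[of "T f" mp_ring _ "T g"] by simp
    next
      case (mult f g)
      then show ?case
        using generate_ring.eng_mult[of "T f" mp_ring _ "T g"] by simp
    qed (simp add: generate_ring.incl)
  qed
  show "sym_algebra Q \<subseteq> range T"
  proof
    fix g assume "g \<in> sym_algebra Q"
    then show "g \<in> range T"
      unfolding sym_algebra_def
    proof (induction g rule: generate_ring.induct)
      case one
      show ?case using T_simps(2) by (metis mp_ring_simps(3) rangeI)
    next
      case (incl h)
      then show ?case
      proof
        assume "h \<in> range Const"
        then show ?thesis using T_simps(5) by (metis imageE rangeI)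
      next
        assume h: "h \<in> vanishing_ideal Q \<inter> forms 1"
        then obtain c where c: "h = linform c" using forms_1 by blast
        have "c \<in> perp Q"
          using h by (auto simp: c vanishing_ideal_iff perp_def)
        then obtain x where "c = sg x"
          using L_imp_sg perp_Q by auto
        then have "h = T (linform ((-1) *s x))"
          unfolding c T_linform sg_scale by simp
        then show ?thesis by blast
      qed
    next
      case (a_inv h)
      then obtain f where "h = T f" by blast
      then have "\<ominus>\<^bsub>mp_ring\<^esub> h = T (- f)"
        by (simp add: mp_ring_uminus)
      then show ?case by blast
    next
      case (eng_add h1 h2)
      then obtain f g where "h1 = T f" "h2 = T g" by blast
      then have "h1 \<oplus>\<^bsub>mp_ring\<^esub> h2 = T (f + g)" by simp
      then show ?case by blast
    next
      case (eng_mult h1 h2)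
      then obtain f g where "h1 = T f" "h2 = T g" by blast
      then have "h1 \<otimes>\<^bsub>mp_ring\<^esub> h2 = T (f * g)" by simp
      then show ?case by blast
    qed
  qed
qed

lemma T_residue_class: "T ` residue_class L f = {T f}"
proof -
  have "f \<in> residue_class L f"
    by (simp add: residue_class_eq vanishing_ideal_iff)
  then show ?thesis
    by (auto simp: residue_class_eq T_eq_iff simp del: T_simps)
qed

text \<open>The first isomorphism theorem: \<open>T\<close> has image \<open>sym_algebra Q\<close>
  and kernel I(L).\<close>

lemma T_ring_iso: "(\<lambda>a. the_elem (T ` a)) \<in> ring_iso (coord_ring L) (sym_ring Q)"
proof -
  have ring_sym: "ring (sym_ring Q)"
    unfolding sym_ring_eq_generate_ring by (rule ring.generate_ring_is_ring[OF ring_mp_ring]) simp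
  have sym: "carrier (sym_ring Q) = range T" "monoid.mult (sym_ring Q) = (*)" "one (sym_ring Q) = 1"
    "zero (sym_ring Q) = 0" "add (sym_ring Q) = (+)"
    by (simp_all add: sym_ring_def range_T)
  have hom: "ring_hom_ring mp_ring (sym_ring Q) T"
  proof (rule ring_hom_ringI2[OF ring_mp_ring ring_sym])
    show "T \<in> ring_hom mp_ring (sym_ring Q)"
      by (rule ring_hom_memI) (simp_all add: sym)
  qed
  have ker: "a_kernel mp_ring (sym_ring Q) T = vanishing_ideal L"
    by (auto simp: a_kernel_def' sym T_eq_0_iff)
  show ?thesis
    using ring_hom_ring.FactRing_iso_set[OF hom] by (simp add: ker sym coord_ring_def)
qed

end

context general_line
begin

lemma eta_isomorphism:
  assumes lf: "lf = tau_image \<alpha>" and arr: "arr = dual_arrangement Z"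
    and Z: "\<And>F d. F \<in> forms d \<Longrightarrow> F \<in> vanishing_ideal (\<Union>Z) \<longleftrightarrow> (\<forall>c\<in>C. eval F c = 0)"
  shows "tau \<alpha> \<in> ring_iso (coord_ring L) (sym_ring Q) \<and>
      (\<forall>c. tau \<alpha> (residue_class L (Const c)) = Const c) \<and>
      (\<forall>i. tau \<alpha> (residue_class L (Var i)) = tau_image \<alpha> i) \<and>
      (\<forall>m f. (\<forall>i. f i \<in> forms m) \<longrightarrow>
         (tangent_on (dual_arrangement Z) L f \<longleftrightarrow>
          (\<exists>s\<in>component (D0_restricted (dual_arrangement Z) L) m. represents L f s))) \<and>
      (\<forall>m\<ge>0. \<forall>s\<in>component (D0_restricted (dual_arrangement Z) L) m.
         \<exists>f. (\<forall>i. f i \<in> forms m) \<and> represents L f s) \<and>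
      (\<exists>\<eta>. graded_module_iso (\<lambda>e. sym_algebra Q \<inter> forms (int e))
             (twist (- 1) (base_change (coord_ring L) (tau \<alpha>)
                (D0_restricted (dual_arrangement Z) L)))
             (Igg Q Z) \<eta> \<and>
           (\<forall>m f s. s \<in> component (D0_restricted (dual_arrangement Z) L) m \<longrightarrow>
              (\<forall>i. f i \<in> forms m) \<longrightarrow> represents L f s \<longrightarrow>
              \<eta> (m + 1) s = (\<Sum>i\<in>UNIV. tau \<alpha> (residue_class L (f i)) * Var i)) \<and>
           (\<forall>m::nat. \<eta> (int m + 1) ` component (D0_restricted (dual_arrangement Z) L) (int m) =
              vanishing_ideal (\<Union>Z) \<inter> ideal_power (vanishing_ideal Q) (int m)
                \<inter> forms (int m + 1)))"
proof -
  have T: "T = subst Const (tau_image \<alpha>)"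
    using T_def by (rule trans) (rule arg_cong[OF lf])
  have tau: "tau \<alpha> = (\<lambda>a. the_elem (T ` a))"
    by (simp add: tau_def T fun_eq_iff)
  have iso: "tau \<alpha> \<in> ring_iso (coord_ring L) (sym_ring Q)"
    unfolding tau by (rule T_ring_iso)
  have tau_class: "tau \<alpha> (residue_class L f) = T f" for f
    by (simp add: tau T_residue_class)
  have tau_Const: "tau \<alpha> (residue_class L (Const c)) = Const c" for c
    by (rule trans[OF tau_class T_simps(5)])
  have tau_Var: "tau \<alpha> (residue_class L (Var i)) = tau_image \<alpha> i" for i
    by (rule trans[OF tau_class trans[OF T_simps(6) fun_cong[OF lf]]])
  have comp: "component (D0_restricted arr L) = sections arr L"
    by (simp add: D0_restricted_def)
  have target: "vanishing_ideal (\<Union>Z) \<inter> ideal_power (vanishing_ideal Q) d \<inter> forms (d + 1) = target d" for d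
    using Z by (auto simp: target_def)
  have tangent: "tangent_on arr L f \<longleftrightarrow> (\<exists>s\<in>sections arr L m. represents L f s)"
    if f: "\<forall>i. f i \<in> forms m" for m f
  proof -
    have "tangent_on arr L f \<longleftrightarrow> N f \<in> target m"
      using tangent_on_iff[of f m] f N_in_forms[of f m] N_in_ideal_power[of f m] by (simp add: target_def)
    also have "\<dots> \<longleftrightarrow> (\<exists>s\<in>sections arr L m. eta s = N f)"
      using bij_betw_eta[of m] eta_section_of section_of_in_sections eta_in_target(1) by metis
    also have "\<dots> \<longleftrightarrow> (\<exists>s\<in>sections arr L m. represents L f s)"
      using represents_iff by blast
    finally show ?thesis .
  qed
  have lift: "\<exists>f. (\<forall>i. f i \<in> forms m) \<and> represents L f s" if "m \<ge> 0" "s \<in> sections arr L m" for m s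
    using eta_in_target(2)[OF that(2,1)] represents_iff[OF that(2)] by blast
  have formula: "eta s = (\<Sum>i\<in>UNIV. tau \<alpha> (residue_class L (f i)) * Var i)"
    if "s \<in> sections arr L m" "represents L f s" for m f s
    using represents_iff[OF that(1), of f] that(2) by (simp only: tau_class N_def)
  have scalar: "eta (gsmult (D0_restricted arr L) e d (inv_into (carrier (coord_ring L)) (tau \<alpha>) b) s) = b * eta s"
    if b: "b \<in> sym_algebra Q" "b \<in> forms (int e)" and s: "s \<in> sections arr L d" for e d b s
  proof (rule eta_gsmult[OF s])
    let ?a = "inv_into (carrier (coord_ring L)) (tau \<alpha>) b"
    obtain h where h: "b = T h"
      using b(1) range_T by auto
    then have "b \<in> tau \<alpha> ` carrier (coord_ring L)"
      unfolding carrier_coord_ring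
      by (intro image_eqI[of _ _ "residue_class L h"]) (simp_all only: tau_class rangeI)
    then have "?a \<in> carrier (coord_ring L)" "tau \<alpha> ?a = b"
      by (auto intro: inv_into_into f_inv_into_f)
    moreover then obtain f where "?a = residue_class L f"
      unfolding carrier_coord_ring by blast
    ultimately have f: "?a = residue_class L f" "T f = b"
      using tau_class[of f] by simp_all
    show "T g = b" if "g \<in> ?a" for g
      using that T_eq_iff[of g f] f by (simp add: residue_class_eq del: T_simps)
    \<comment> \<open>The preimage h need not be homogeneous, but b is a form, so the component of h
      of degree e has the same image. It is the form that the class has to contain.\<close>
    have "T (hcomp (int e) h) = T f"
      using b(2) h f(2) by (simp add: hcomp_forms flip: hcomp_T)
    then have "hcomp (int e) h \<in> ?a"
      unfolding f(1) by (simp add: residue_class_eq T_eq_iff del: T_simps)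
    then show "?a \<inter> forms (int e) \<noteq> {}"
      using hcomp_in_forms by blast
  qed
  have graded: "graded_module_iso (\<lambda>e. sym_algebra Q \<inter> forms (int e))
      (twist (- 1) (base_change (coord_ring L) (tau \<alpha>) (D0_restricted arr L))) (Igg Q Z) (\<lambda>d. eta)"
    unfolding graded_module_iso_def
  proof (intro conjI allI ballI)
    fix d :: int
    \<comment> \<open>The twist by -1 takes the sections of degree d - 1 to polynomials of degree
      d.\<close>
    have "bij_betw eta (sections arr L (d - 1)) (target (d - 1))"
      by (rule bij_betw_eta)
    then show "bij_betw eta (component (twist (- 1) (base_change (coord_ring L) (tau \<alpha>) (D0_restricted arr L))) d)
        (component (Igg Q Z) d)"
      using target[of "d - 1"] by (simp add: twist_def base_change_def Igg_def D0_restricted_def)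
  next
    fix d :: int and x y
    assume "x \<in> component (twist (- 1) (base_change (coord_ring L) (tau \<alpha>) (D0_restricted arr L))) d"
      "y \<in> component (twist (- 1) (base_change (coord_ring L) (tau \<alpha>) (D0_restricted arr L))) d"
    then have "x \<in> sections arr L (d - 1)" "y \<in> sections arr L (d - 1)"
      by (simp_all add: twist_def base_change_def D0_restricted_def)
    then show "eta (gadd (twist (- 1) (base_change (coord_ring L) (tau \<alpha>) (D0_restricted arr L))) d x y) =
        gadd (Igg Q Z) d (eta x) (eta y)"
      using eta_gadd[of x "d - 1" y] by (simp add: twist_def base_change_def Igg_def)
  next
    fix e and d :: int and b x
    assume "b \<in> sym_algebra Q \<inter> forms (int e)"
      "x \<in> component (twist (- 1) (base_change (coord_ring L) (tau \<alpha>) (D0_restricted arr L))) d"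
    then have "b \<in> sym_algebra Q" "b \<in> forms (int e)" "x \<in> sections arr L (d - 1)"
      by (simp_all add: twist_def base_change_def D0_restricted_def)
    then show "eta (gsmult (twist (- 1) (base_change (coord_ring L) (tau \<alpha>) (D0_restricted arr L))) e d b x) =
        gsmult (Igg Q Z) e d b (eta x)"
      using scalar[of b e x "d - 1"] by (simp add: twist_def base_change_def Igg_def)
  qed
  have image: "eta ` sections arr L (int m) = vanishing_ideal (\<Union>Z) \<inter> ideal_power (vanishing_ideal Q) (int m)
      \<inter> forms (int m + 1)" for m
    unfolding target using bij_betw_eta by (rule bij_betw_imp_surj_on)
  show ?thesis
    unfolding arr[symmetric] comp
  proof (intro conjI)
    show "\<exists>\<eta>. graded_module_iso (\<lambda>e. sym_algebra Q \<inter> forms (int e))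
             (twist (- 1) (base_change (coord_ring L) (tau \<alpha>) (D0_restricted arr L))) (Igg Q Z) \<eta> \<and>
           (\<forall>m f s. s \<in> sections arr L m \<longrightarrow> (\<forall>i. f i \<in> forms m) \<longrightarrow> represents L f s \<longrightarrow>
              \<eta> (m + 1) s = (\<Sum>i\<in>UNIV. tau \<alpha> (residue_class L (f i)) * Var i)) \<and>
           (\<forall>m::nat. \<eta> (int m + 1) ` sections arr L (int m) =
              vanishing_ideal (\<Union>Z) \<inter> ideal_power (vanishing_ideal Q) (int m) \<inter> forms (int m + 1))"
      by (intro exI[of _ "\<lambda>d. eta"] conjI allI impI graded image formula)
  qed (use iso tau_Const tau_Var tangent lift in simp_all)
qed

end

section \<open>General lines\<close>

text \<open>The determinant of the functionals c and c' on u and v. It is linear in the Pluecker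
  coordinates, which makes its nonvanishing an open condition on lines.\<close>

definition pluecker_minor ::
    "'k::comm_ring_1 ^ 'v::finite \<Rightarrow> 'k ^ 'v \<Rightarrow> 'k ^ 'v \<Rightarrow> 'k ^ 'v \<Rightarrow> 'k" where
  "pluecker_minor c c' u v = pairing c u * pairing c' v - pairing c v * pairing c' u"

lemma pairing_pluecker:
  "pairing (\<chi> ij. c $ fst ij * c' $ snd ij) (pluecker u v) = pluecker_minor c c' u v"
proof -
  have "pairing (\<chi> ij. c $ fst ij * c' $ snd ij) (pluecker u v) =
      (\<Sum>(i, j)\<in>UNIV \<times> UNIV. (c $ i * u $ i) * (c' $ j * v $ j) - (c $ i * v $ i) * (c' $ j * u $ j))"
    unfolding pairing_def pluecker_def UNIV_Times_UNIV
    by (intro sum.cong refl) (auto simp: algebra_simps)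
  also have "\<dots> = pluecker_minor c c' u v"
    unfolding pluecker_minor_def pairing_def sum_product sum.cartesian_product[symmetric]
    by (simp add: sum_subtractf)
  finally show ?thesis .
qed

definition minor_nonvanishing ::
    "(('k::field ^ 'v::finite) \<times> ('k ^ 'v)) set \<Rightarrow> ('k ^ 'v) set set" where
  "minor_nonvanishing P = {L \<in> proj_subspaces 1.
     \<exists>u v. L = vec.span {u, v} \<and> (\<forall>(c, c')\<in>P. pluecker_minor c c' u v \<noteq> 0)}"

text \<open>The product of the minors is one form in the Pluecker coordinates, so this is a basic
  open set.\<close>

lemma minor_nonvanishing_open:
  fixes P :: "(('k::field ^ 'v::finite) \<times> ('k ^ 'v)) set"
  assumes "finite P"
  shows "zariski_open_lines (minor_nonvanishing P)"
proof -
  define f :: "('v \<times> 'v, 'k) mp"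
    where "f = (\<Prod>(c, c')\<in>P. linform (\<chi> ij. c $ fst ij * c' $ snd ij))"
  have "f \<in> forms (\<Sum>p\<in>P. 1)"
    unfolding f_def by (rule forms_prod) auto
  moreover have "eval f (pluecker u v) \<noteq> 0 \<longleftrightarrow> (\<forall>(c, c')\<in>P. pluecker_minor c c' u v \<noteq> 0)" for u v
    using assms by (auto simp: f_def prod_zero_iff pairing_pluecker case_prod_beta)
  ultimately show ?thesis
    unfolding zariski_open_lines_def minor_nonvanishing_def by (intro exI[of _ "{f}"]) auto
qed

text \<open>Choose u off all the hyperplanes of the first components. The minor is then the value at
  v of a nonzero functional, since c' is not a multiple of c, and v is chosen off these hyperplanes
  too.\<close>

lemma minor_nonvanishing_nonempty:
  fixes P :: "(('k::alg_closed_field ^ 'v::finite) \<times> ('k ^ 'v)) set"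
  assumes P: "finite P" "P \<noteq> {}" and ind: "\<And>c c'. (c, c') \<in> P \<Longrightarrow> c \<noteq> 0 \<and> (\<forall>k. c' \<noteq> k *s c)"
  shows "minor_nonvanishing P \<noteq> {}"
proof -
  have "0 \<notin> fst ` P"
    using ind by force
  then obtain u where u: "\<And>c c'. (c, c') \<in> P \<Longrightarrow> pairing c u \<noteq> 0"
    using exists_off_hyperplanes[of "fst ` P"] P(1) by force
  let ?d = "\<lambda>(c, c'). pairing c u *s c' - pairing c' u *s c"
  have "0 \<notin> ?d ` P"
  proof
    assume "0 \<in> ?d ` P"
    then obtain c c' where cc: "(c, c') \<in> P" "pairing c u *s c' = pairing c' u *s c" by auto
    then have "c' = (pairing c' u / pairing c u) *s c"
      using u[OF cc(1)] by (simp add: vec_eq_iff field_simps)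
    then show False using ind[OF cc(1)] by blast
  qed
  then obtain v where v: "\<And>c c'. (c, c') \<in> P \<Longrightarrow> pairing (?d (c, c')) v \<noteq> 0"
    using exists_off_hyperplanes[of "?d ` P"] P(1) by force
  have nz: "pluecker_minor c c' u v \<noteq> 0" if "(c, c') \<in> P" for c c'
    using v[OF that] by (simp add: pluecker_minor_def mult_ac)
  obtain c c' where cc: "(c, c') \<in> P" using P(2) by auto
  have "v \<noteq> 0"
    using nz[OF cc] by (auto simp: pluecker_minor_def)
  moreover have "u \<notin> vec.span {v}"
    using nz[OF cc] by (auto simp: pluecker_minor_def vec.span_singleton mult_ac)
  moreover from this have "u \<noteq> v"
    using vec.span_base by blast
  ultimately have "vec.independent {u, v}" "card {u, v} = 2"
    by (auto simp: vec.independent_insert)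
  then have "vec.dim (vec.span {u, v}) = 2"
    using vec.dim_eq_card_independent[of "{u, v}"] by simp
  then have "vec.span {u, v} \<in> minor_nonvanishing P"
    using nz unfolding minor_nonvanishing_def by (auto simp: proj_subspaces_def)
  then show ?thesis by blast
qed

text \<open>Cramer's rule for the coordinates of w with respect to u and v.\<close>

lemma minor_nonvanishing_meet:
  assumes L: "L \<in> minor_nonvanishing P" "(c, c') \<in> P"
    and w: "w \<in> L" "pairing c w = 0" "pairing c' w = 0"
  shows "w = 0"
proof -
  obtain u v where uv: "L = vec.span {u, v}" "pluecker_minor c c' u v \<noteq> 0"
    using L by (auto simp: minor_nonvanishing_def)
  obtain a b where ab: "w = a *s u + b *s v"
    using w(1) by (auto simp: uv(1) vec.span_insert vec.span_singleton algebra_simps)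
  have eqs: "a * pluecker_minor c c' u v = pairing c' v * pairing c w - pairing c v * pairing c' w"
    "b * pluecker_minor c c' u v = pairing c u * pairing c' w - pairing c' u * pairing c w"
    by (simp_all add: ab pluecker_minor_def algebra_simps)
  then have "a = 0" "b = 0"
    using uv(2) unfolding w(2,3) by simp_all
  then show ?thesis
    by (simp add: ab)
qed

lemma minor_nonvanishing_not_perp:
  assumes L: "L \<in> minor_nonvanishing P" "(c, c') \<in> P"
  shows "c \<notin> perp L"
proof
  assume c: "c \<in> perp L"
  obtain u v where uv: "L = vec.span {u, v}" "pluecker_minor c c' u v \<noteq> 0"
    using L by (auto simp: minor_nonvanishing_def)
  have "u \<in> L" "v \<in> L"
    by (auto simp: uv(1) intro: vec.span_base)
  then show False
    using c uv(2) by (auto simp: perp_def pluecker_minor_def)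
qed

lemma span_scale_singleton:
  fixes c :: "'k::field ^ 'v::finite"
  assumes "k \<noteq> 0"
  shows "vec.span {k *s c} = vec.span {c}"
proof -
  have "c = (1 / k) *s (k *s c)"
    using assms by (simp add: vec_eq_iff)
  then have "c \<in> vec.span {k *s c}"
    using vec.span_scale[OF vec.span_base[of "k *s c" "{k *s c}"]] by (metis singletonI)
  moreover have "k *s c \<in> vec.span {c}"
    by (intro vec.span_scale vec.span_base) simp
  ultimately show ?thesis
    by (simp add: vec.span_eq)
qed

theorem theorem4p14:
  fixes Z :: "('k::alg_closed_field ^ 'v::{finite,linorder}) set set"
    and n :: nat
  assumes "CARD('v) = n + 1" and "n \<ge> 2"
    and "finite Z" and "Z \<subseteq> proj_subspaces 0"
  shows "\<exists>U. zariski_open_lines U \<and> U \<noteq> {} \<and>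
    (\<forall>L\<in>U. \<forall>Q \<alpha>. Q = perp L \<longrightarrow> ordered_basis (n - 1) \<alpha> Q \<longrightarrow>
      tau \<alpha> \<in> ring_iso (coord_ring L) (sym_ring Q) \<and>
      (\<forall>c. tau \<alpha> (residue_class L (Const c)) = Const c) \<and>
      (\<forall>i. tau \<alpha> (residue_class L (Var i)) = tau_image \<alpha> i) \<and>
      (\<forall>m f. (\<forall>i. f i \<in> forms m) \<longrightarrow>
         (tangent_on (dual_arrangement Z) L f \<longleftrightarrow>
          (\<exists>s\<in>component (D0_restricted (dual_arrangement Z) L) m. represents L f s))) \<and>
      (\<forall>m\<ge>0. \<forall>s\<in>component (D0_restricted (dual_arrangement Z) L) m.
         \<exists>f. (\<forall>i. f i \<in> forms m) \<and> represents L f s) \<and>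
      (\<exists>\<eta>. graded_module_iso (\<lambda>e. sym_algebra Q \<inter> forms (int e))
             (twist (- 1) (base_change (coord_ring L) (tau \<alpha>)
                (D0_restricted (dual_arrangement Z) L)))
             (Igg Q Z) \<eta> \<and>
           (\<forall>m f s. s \<in> component (D0_restricted (dual_arrangement Z) L) m \<longrightarrow>
              (\<forall>i. f i \<in> forms m) \<longrightarrow> represents L f s \<longrightarrow>
              \<eta> (m + 1) s = (\<Sum>i\<in>UNIV. tau \<alpha> (residue_class L (f i)) * Var i)) \<and>
           (\<forall>m::nat. \<eta> (int m + 1) ` component (D0_restricted (dual_arrangement Z) L) (int m) =
              vanishing_ideal (\<Union>Z) \<inter> ideal_power (vanishing_ideal Q) (int m)
                \<inter> forms (int m + 1))))"
proof -
  \<comment> \<open>One normal vector per point: distinct elements of C then span distinct points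
    and are not proportional, so they form a pair in P.\<close>
  define rep where "rep z = (SOME c. c \<noteq> 0 \<and> z = vec.span {c})" for z :: "('k, 'v) vec set"
  define C where "C = rep ` Z"
  define B where "B = C \<union> range (\<lambda>i. axis i 1)"
  \<comment> \<open>The unit vectors put every \<open>c \<in> C\<close> into some pair, which keeps \<open>L\<close> out of its hyperplane.\<close>
  define P where "P = {(c, c'). c \<in> B \<and> c' \<in> B \<and> c \<noteq> 0 \<and> (\<forall>k. c' \<noteq> k *s c)}"
  have rep: "rep z \<noteq> 0 \<and> z = vec.span {rep z}" if "z \<in> Z" for z
  proof -
    have "z \<in> proj_subspaces 0" using that assms(4) by blast
    then obtain w where "w \<noteq> 0" "z = vec.span {w}"
      by (rule proj_point_eq_span)
    then have "\<exists>c. c \<noteq> 0 \<and> z = vec.span {c}" by blast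
    then show ?thesis unfolding rep_def by (rule someI_ex)
  qed
  have finC: "finite C" and C0: "0 \<notin> C"
    using assms(3) rep by (auto simp: C_def)
  have finP: "finite P"
  proof (rule finite_subset)
    show "P \<subseteq> B \<times> B" by (auto simp: P_def)
    show "finite (B \<times> B)" using finC by (simp add: B_def)
  qed
  have axis_pair: "\<exists>c'. (c, c') \<in> P" if c: "c \<in> B" "c \<noteq> 0" for c
  proof (rule ccontr)
    assume "\<nexists>c'. (c, c') \<in> P"
    then have "\<exists>k. axis i 1 = k *s c" for i
      using c by (auto simp: P_def B_def)
    then obtain k where k: "\<And>i. axis i 1 = k i *s c" by metis
    \<comment> \<open>Two different unit vectors cannot both be multiples of c.\<close>
    obtain i j :: 'v where ij: "i \<noteq> j"
      using assms(1,2) card_le_Suc0_iff_eq[of "UNIV :: 'v set"] by auto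
    have "k i * c $ i = 1" "k i * c $ j = 0" "k j * c $ j = 1"
      using arg_cong[OF k[of i], of "\<lambda>x. x $ i"] arg_cong[OF k[of i], of "\<lambda>x. x $ j"]
        arg_cong[OF k[of j], of "\<lambda>x. x $ j"] ij by (auto simp: axis_def)
    then show False by auto
  qed
  have "P \<noteq> {}"
    using axis_pair[of "axis undefined 1"] by (auto simp: B_def axis_eq_0_iff)
  then have "minor_nonvanishing P \<noteq> {}"
    by (intro minor_nonvanishing_nonempty finP) (auto simp: P_def)
  moreover have "zariski_open_lines (minor_nonvanishing P)"
    by (rule minor_nonvanishing_open[OF finP])
  moreover have arr_eq: "dual_arrangement Z = {{w. pairing c w = 0} |c. c \<in> C}"
  proof -
    have "\<exists>c'\<in>C. {w. pairing c w = 0} = {w. pairing c' w = 0}" if c: "c \<noteq> 0" "vec.span {c} \<in> Z" for c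
    proof -
      have "c \<in> vec.span {rep (vec.span {c})}"
        using rep[OF c(2)] vec.span_base[of c "{c}"] by auto
      then obtain k where k: "c = k *s rep (vec.span {c})"
        by (auto simp: vec.span_singleton)
      then have "k \<noteq> 0" using c(1) by auto
      then have "pairing c w = 0 \<longleftrightarrow> pairing (rep (vec.span {c})) w = 0" for w
        by (subst k) simp
      then show ?thesis using c(2) by (auto simp: C_def)
    qed
    moreover have "c \<noteq> 0 \<and> vec.span {c} \<in> Z" if "c \<in> C" for c
      using that rep by (auto simp: C_def)
    ultimately show ?thesis
      unfolding dual_arrangement_def
    proof (intro equalityI subsetI, goal_cases)
      case (1 H)
      then obtain c where "H = {w. pairing c w = 0}" "c \<noteq> 0" "vec.span {c} \<in> Z" by blast
      with 1(1)[of c] show ?case by (auto simp only: mem_Collect_eq)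
    next
      case (2 H)
      then obtain c where "H = {w. pairing c w = 0}" "c \<in> C" by blast
      with 2(2)[of c] show ?case by (auto simp only: mem_Collect_eq)
    qed
  qed
  moreover have vanish: "F \<in> vanishing_ideal (\<Union>Z) \<longleftrightarrow> (\<forall>c\<in>C. eval F c = 0)" if F: "F \<in> forms d" for F d
  proof (cases "d < 0")
    case True
    then show ?thesis
      using forms_neg[OF True F] by (simp add: vanishing_ideal_iff)
  next
    case False
    have "(\<forall>v\<in>z. eval F v = 0) \<longleftrightarrow> eval F (rep z) = 0" if z: "z \<in> Z" for z
    proof -
      define r where "r = rep z"
      have "z = range (\<lambda>k. k *s r)"
        using rep[OF z] vec.span_singleton[of r] by (simp add: r_def)
      moreover have "eval F (k *s r) = k ^ nat d * eval F r" for k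
        using False by (simp add: eval_form_scale[OF F])
      moreover have "r = 1 *s r" by simp
      ultimately show ?thesis
        unfolding r_def[symmetric] by auto
    qed
    then show ?thesis
      by (auto simp: vanishing_ideal_iff C_def)
  qed
  have main: "general_line L (perp L) (tau_image \<alpha>) (two_row_vec \<alpha>) x0 y0 C"
    if L: "L \<in> minor_nonvanishing P"
      and dual: "line_duality L (perp L) (tau_image \<alpha>) (two_row_vec \<alpha>) x0 y0" for L \<alpha> x0 y0
  proof -
    interpret line_duality L "perp L" "tau_image \<alpha>" "two_row_vec \<alpha>" x0 y0 by (rule dual)
    show ?thesis
    proof
      fix c assume c: "c \<in> C"
      then obtain c' where "(c, c') \<in> P"
        using axis_pair[of c] C0 by (auto simp: B_def)
      then show "two_row_vec \<alpha> c \<noteq> 0"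
        unfolding sg_eq_0_iff by (rule minor_nonvanishing_not_perp[OF L])
    next
      fix c c' w assume c: "c \<in> C" "c' \<in> C" "c \<noteq> c'" and w: "w \<in> L" "pairing c w = 0" "pairing c' w = 0"
      have "c' \<noteq> k *s c" for k
      proof
        assume k: "c' = k *s c"
        obtain z z' where z: "z \<in> Z" "c = rep z" "z' \<in> Z" "c' = rep z'"
          using c by (auto simp: C_def)
        have "k \<noteq> 0"
          using k c(2) C0 by auto
        then have "vec.span {c'} = vec.span {c}"
          unfolding k by (rule span_scale_singleton)
        then have "z = z'"
          using rep[OF z(1)] rep[OF z(3)] z by metis
        then show False using z c(3) by simp
      qed
      then have "(c, c') \<in> P"
        using c C0 by (auto simp: P_def B_def)
      then show "w = 0"
        by (rule minor_nonvanishing_meet[OF L _ w])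
    qed (use finC C0 in auto)
  qed
  show ?thesis
  proof (intro exI[of _ "minor_nonvanishing P"] conjI[OF \<open>zariski_open_lines _\<close> conjI[OF \<open>minor_nonvanishing P \<noteq> {}\<close>]] ballI allI impI, goal_cases)
    case (1 L Q \<alpha>)
    then have "L \<in> proj_subspaces 1"
      by (simp add: minor_nonvanishing_def)
    then obtain x0 y0 where "line_duality L (perp L) (tau_image \<alpha>) (two_row_vec \<alpha>) x0 y0"
      using line_duality_two_row[OF assms(1), of L \<alpha>] assms(2) 1 by auto
    then interpret general_line L "perp L" "tau_image \<alpha>" "two_row_vec \<alpha>" x0 y0 C
      by (rule main[OF 1(1)])
    show ?case
      unfolding \<open>Q = perp L\<close>
      by (rule eta_isomorphism[OF refl _ vanish]) (simp_all add: arr_def arr_eq)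
  qed
qed

end
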